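(* Let $(\mathcal A,\mathcal E)$ be an exact category. Let $\phi:\mathcal A\to\mathbb Z$ be a function on the objects of $\mathcal A$ such that $\phi$ is constant on isomorphism classes of objects in $\mathcal A$, $\phi$ is additive on finite biproducts, and $\phi$ is sub-additive on kernel-cokernel pairs in $\mathcal E$ (i.e., if $M\rightarrowtail N\twoheadrightarrow L$ is in $\mathcal E$, then $\phi(N)\le\phi(M)+\phi(L)$). Set $\mathcal E^{\phi}:=\{\text{kernel-cokernel pairs in }\mathcal E\text{ on which }\phi\text{ is additive}\}$, i.e. those $M\rightarrowtail N\twoheadrightarrow L$ in $\mathcal E$ with $\phi(N)=\phi(M)+\phi(L)$. Then $\mathcal E^{\phi}$ gives rise, via the Yoneda construction, to a subfunctor of $\operatorname{Ext}_{\mathcal E}(-,-):\mathcal A^{op}\times\mathcal A\to\mathbf{Ab}$; namely, the assignment $(C,A)\mapsto\{[\sigma]\in\operatorname{Ext}_{\mathcal E}(C,A):\sigma\in\mathcal E^{\phi}\}$ is a subfunctor of $\operatorname{Ext}_{\mathcal E}(-,-)$ via the inclusion maps.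
   Context: An exact category $(\mathcal A,\mathcal E)$ (Quillen) is an additive category $\mathcal A$ with a class $\mathcal E$ of kernel-cokernel pairs $M\xrightarrow{i}N\xrightarrow{p}L$ ($i$ is a kernel of $p$ and $p$ is a cokernel of $i$), closed under isomorphism, such that, calling the maps $i$ (resp. $p$) occurring in $\mathcal E$ admissible monics (resp. epics): identities are admissible monics and admissible epics; admissible monics (resp. epics) are closed under composition; the pushout of an admissible monic along any morphism exists and is an admissible monic; the pullback of an admissible epic along any morphism exists and is an admissible epic. For $C,A\in\mathcal A$, $\operatorname{Ext}_{\mathcal E}(C,A)$ is the abelian group (under Baer sum) of equivalence classes of kernel-cokernel pairs $A\rightarrowtail B\twoheadrightarrow C$ in $\mathcal E$, where two such are equivalent if there is a morphism between the middle objects commuting with identities on $A$ and $C$. It is functorial in $A$ by pushout and in $C$ by pullback. A functor $G$ is a subfunctor of $F$ (both with values in abelian groups) if there are injective homomorphisms $G(X)\to F(X)$, for all objects $X$, compatible with the maps induced by morphisms. *)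

theory Defs
  imports "HOL-Algebra.FiniteProduct"
begin

section \<open>Categories\<close>

record ('o, 'm) cat =
  Obj :: "'o set"
  Arr :: "'m set"
  Dom :: "'m \<Rightarrow> 'o"
  Cod :: "'m \<Rightarrow> 'o"
  Ide :: "'o \<Rightarrow> 'm"
  Comp :: "'m \<Rightarrow> 'm \<Rightarrow> 'm"  (infixl \<open>\<cdot>\<index>\<close> 70)

text \<open>Composition is written in the usual order: \<open>g \<cdot>\<^bsub>\<C>\<^esub> f\<close> is ``first f, then g''.\<close>

definition homset :: "('o, 'm, 'z) cat_scheme \<Rightarrow> 'o \<Rightarrow> 'o \<Rightarrow> 'm set" where
  "homset \<C> X Y = {f \<in> Arr \<C>. Dom \<C> f = X \<and> Cod \<C> f = Y}"

locale category =
  fixes \<C> :: "('o, 'm, 'z) cat_scheme" (structure)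
  assumes Dom_in_Obj: "f \<in> Arr \<C> \<Longrightarrow> Dom \<C> f \<in> Obj \<C>"
    and Cod_in_Obj: "f \<in> Arr \<C> \<Longrightarrow> Cod \<C> f \<in> Obj \<C>"
    and Ide_in_homset: "X \<in> Obj \<C> \<Longrightarrow> Ide \<C> X \<in> homset \<C> X X"
    and Comp_in_homset:
      "\<lbrakk>f \<in> homset \<C> X Y; g \<in> homset \<C> Y Z\<rbrakk> \<Longrightarrow> g \<cdot> f \<in> homset \<C> X Z"
    and Comp_Ide: "f \<in> homset \<C> X Y \<Longrightarrow> f \<cdot> Ide \<C> X = f"
    and Ide_Comp: "f \<in> homset \<C> X Y \<Longrightarrow> Ide \<C> Y \<cdot> f = f"
    and Comp_assoc:
      "\<lbrakk>f \<in> homset \<C> W X; g \<in> homset \<C> X Y; h \<in> homset \<C> Y Z\<rbrakk>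
        \<Longrightarrow> (h \<cdot> g) \<cdot> f = h \<cdot> (g \<cdot> f)"

definition op_cat :: "('o, 'm, 'z) cat_scheme \<Rightarrow> ('o, 'm) cat" where
  "op_cat \<C> = \<lparr>Obj = Obj \<C>, Arr = Arr \<C>, Dom = Cod \<C>, Cod = Dom \<C>, Ide = Ide \<C>,
     Comp = (\<lambda>g f. f \<cdot>\<^bsub>\<C>\<^esub> g)\<rparr>"

definition prod_cat ::
  "('o, 'm, 'z) cat_scheme \<Rightarrow> ('p, 'n, 'y) cat_scheme \<Rightarrow> ('o \<times> 'p, 'm \<times> 'n) cat" where
  "prod_cat \<C> \<D> = \<lparr>Obj = Obj \<C> \<times> Obj \<D>, Arr = Arr \<C> \<times> Arr \<D>,
     Dom = map_prod (Dom \<C>) (Dom \<D>), Cod = map_prod (Cod \<C>) (Cod \<D>),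
     Ide = map_prod (Ide \<C>) (Ide \<D>),
     Comp = (\<lambda>(g, g') (f, f'). (g \<cdot>\<^bsub>\<C>\<^esub> f, g' \<cdot>\<^bsub>\<D>\<^esub> f'))\<rparr>"

definition iso_arr :: "('o, 'm, 'z) cat_scheme \<Rightarrow> 'o \<Rightarrow> 'o \<Rightarrow> 'm \<Rightarrow> bool" where
  "iso_arr \<C> X Y f \<longleftrightarrow> f \<in> homset \<C> X Y \<and>
     (\<exists>g \<in> homset \<C> Y X. g \<cdot>\<^bsub>\<C>\<^esub> f = Ide \<C> X \<and> f \<cdot>\<^bsub>\<C>\<^esub> g = Ide \<C> Y)"

text \<open>
  \<open>is_pushout \<C> i f g i'\<close> says that the square

    M --i--> N
    |f       |g
    M'--i'-> N'

  is a pushout; \<open>is_pullback \<C> p h g p'\<close> says that the square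

    N'--p'-> L'
    |g       |h
    N --p--> L

  is a pullback.
\<close>

definition is_pushout ::
  "('o, 'm, 'z) cat_scheme \<Rightarrow> 'm \<Rightarrow> 'm \<Rightarrow> 'm \<Rightarrow> 'm \<Rightarrow> bool" where
  "is_pushout \<C> i f g i' \<longleftrightarrow>
     {i, f, g, i'} \<subseteq> Arr \<C> \<and>
     Dom \<C> f = Dom \<C> i \<and> Dom \<C> g = Cod \<C> i \<and> Dom \<C> i' = Cod \<C> f \<and> Cod \<C> g = Cod \<C> i' \<and>
     g \<cdot>\<^bsub>\<C>\<^esub> i = i' \<cdot>\<^bsub>\<C>\<^esub> f \<and>
     (\<forall>X \<in> Obj \<C>. \<forall>u \<in> homset \<C> (Cod \<C> i) X. \<forall>v \<in> homset \<C> (Cod \<C> f) X.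
        u \<cdot>\<^bsub>\<C>\<^esub> i = v \<cdot>\<^bsub>\<C>\<^esub> f \<longrightarrow>
        (\<exists>!w. w \<in> homset \<C> (Cod \<C> i') X \<and> w \<cdot>\<^bsub>\<C>\<^esub> g = u \<and> w \<cdot>\<^bsub>\<C>\<^esub> i' = v))"

definition is_pullback ::
  "('o, 'm, 'z) cat_scheme \<Rightarrow> 'm \<Rightarrow> 'm \<Rightarrow> 'm \<Rightarrow> 'm \<Rightarrow> bool" where
  "is_pullback \<C> p h g p' \<longleftrightarrow>
     {p, h, g, p'} \<subseteq> Arr \<C> \<and>
     Cod \<C> h = Cod \<C> p \<and> Cod \<C> g = Dom \<C> p \<and> Cod \<C> p' = Dom \<C> h \<and> Dom \<C> g = Dom \<C> p' \<and>
     p \<cdot>\<^bsub>\<C>\<^esub> g = h \<cdot>\<^bsub>\<C>\<^esub> p' \<and>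
     (\<forall>X \<in> Obj \<C>. \<forall>u \<in> homset \<C> X (Dom \<C> p). \<forall>v \<in> homset \<C> X (Dom \<C> h).
        p \<cdot>\<^bsub>\<C>\<^esub> u = h \<cdot>\<^bsub>\<C>\<^esub> v \<longrightarrow>
        (\<exists>!w. w \<in> homset \<C> X (Dom \<C> p') \<and> g \<cdot>\<^bsub>\<C>\<^esub> w = u \<and> p' \<cdot>\<^bsub>\<C>\<^esub> w = v))"


section \<open>Additive categories\<close>

text \<open>\<open>Add\<close> is only meaningful on parallel arrows, \<open>Zero \<A> X Y\<close> is the zero arrow X \<open>\<rightarrow>\<close> Y.\<close>

record ('o, 'm) add_cat = "('o, 'm) cat" +
  Add :: "'m \<Rightarrow> 'm \<Rightarrow> 'm"  (infixl \<open>\<boxplus>\<index>\<close> 65)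
  Zero :: "'o \<Rightarrow> 'o \<Rightarrow> 'm"

definition hom_group :: "('o, 'm, 'z) add_cat_scheme \<Rightarrow> 'o \<Rightarrow> 'o \<Rightarrow> 'm monoid" where
  "hom_group \<A> X Y = \<lparr>carrier = homset \<A> X Y, monoid.mult = Add \<A>, one = Zero \<A> X Y\<rparr>"

text \<open>
  \<open>is_biproduct \<A> Xs P i p\<close>: the object P, with injections \<open>i k\<close> and projections \<open>p k\<close>
  for \<open>k < length Xs\<close>, is a biproduct of the finite family Xs. For \<open>Xs = []\<close> this says that
  the identity of P is zero, i.e. that P is a zero object. The finite product below is the sum
  in the (multiplicatively written) abelian group of endomorphisms of P.
\<close>

definition is_biproduct ::
  "('o, 'm, 'z) add_cat_scheme \<Rightarrow> 'o list \<Rightarrow> 'o \<Rightarrow> (nat \<Rightarrow> 'm) \<Rightarrow> (nat \<Rightarrow> 'm) \<Rightarrow> bool" where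
  "is_biproduct \<A> Xs P i p \<longleftrightarrow>
     set Xs \<subseteq> Obj \<A> \<and> P \<in> Obj \<A> \<and>
     (\<forall>k < length Xs. i k \<in> homset \<A> (Xs ! k) P \<and> p k \<in> homset \<A> P (Xs ! k)) \<and>
     (\<forall>k < length Xs. \<forall>l < length Xs.
        p k \<cdot>\<^bsub>\<A>\<^esub> i l = (if k = l then Ide \<A> (Xs ! k) else Zero \<A> (Xs ! l) (Xs ! k))) \<and>
     finprod (hom_group \<A> P P) (\<lambda>k. i k \<cdot>\<^bsub>\<A>\<^esub> p k) {..<length Xs} = Ide \<A> P"

locale additive_category = category \<A>
  for \<A> :: "('o, 'm, 'z) add_cat_scheme" (structure) +
  assumes hom_comm_group:
      "\<lbrakk>X \<in> Obj \<A>; Y \<in> Obj \<A>\<rbrakk> \<Longrightarrow> comm_group (hom_group \<A> X Y)"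
    and Comp_Add:
      "\<lbrakk>f \<in> homset \<A> X Y; f' \<in> homset \<A> X Y; g \<in> homset \<A> Y Z\<rbrakk>
        \<Longrightarrow> g \<cdot> (f \<boxplus> f') = g \<cdot> f \<boxplus> g \<cdot> f'"
    and Add_Comp:
      "\<lbrakk>f \<in> homset \<A> X Y; g \<in> homset \<A> Y Z; g' \<in> homset \<A> Y Z\<rbrakk>
        \<Longrightarrow> (g \<boxplus> g') \<cdot> f = g \<cdot> f \<boxplus> g' \<cdot> f"
    and ex_biproduct: "set Xs \<subseteq> Obj \<A> \<Longrightarrow> \<exists>P i p. is_biproduct \<A> Xs P i p"


section \<open>Exact categories\<close>

text \<open>
  A sequence \<open>M \<rightarrow> N \<rightarrow> L\<close> is encoded as the pair \<open>(i, p)\<close> of its arrows; its objects are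
  \<open>Dom i\<close>, \<open>Cod i = Dom p\<close> and \<open>Cod p\<close>.
\<close>

definition is_kernel :: "('o, 'm, 'z) add_cat_scheme \<Rightarrow> 'm \<Rightarrow> 'm \<Rightarrow> bool" where
  "is_kernel \<A> i p \<longleftrightarrow> i \<in> Arr \<A> \<and> p \<in> Arr \<A> \<and> Cod \<A> i = Dom \<A> p \<and>
     p \<cdot>\<^bsub>\<A>\<^esub> i = Zero \<A> (Dom \<A> i) (Cod \<A> p) \<and>
     (\<forall>X \<in> Obj \<A>. \<forall>f \<in> homset \<A> X (Dom \<A> p). p \<cdot>\<^bsub>\<A>\<^esub> f = Zero \<A> X (Cod \<A> p) \<longrightarrow>
        (\<exists>!g. g \<in> homset \<A> X (Dom \<A> i) \<and> i \<cdot>\<^bsub>\<A>\<^esub> g = f))"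

definition is_cokernel :: "('o, 'm, 'z) add_cat_scheme \<Rightarrow> 'm \<Rightarrow> 'm \<Rightarrow> bool" where
  "is_cokernel \<A> p i \<longleftrightarrow> i \<in> Arr \<A> \<and> p \<in> Arr \<A> \<and> Cod \<A> i = Dom \<A> p \<and>
     p \<cdot>\<^bsub>\<A>\<^esub> i = Zero \<A> (Dom \<A> i) (Cod \<A> p) \<and>
     (\<forall>X \<in> Obj \<A>. \<forall>f \<in> homset \<A> (Cod \<A> i) X. f \<cdot>\<^bsub>\<A>\<^esub> i = Zero \<A> (Dom \<A> i) X \<longrightarrow>
        (\<exists>!g. g \<in> homset \<A> (Cod \<A> p) X \<and> g \<cdot>\<^bsub>\<A>\<^esub> p = f))"

definition kernel_cokernel_pair :: "('o, 'm, 'z) add_cat_scheme \<Rightarrow> 'm \<times> 'm \<Rightarrow> bool" where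
  "kernel_cokernel_pair \<A> = (\<lambda>(i, p). is_kernel \<A> i p \<and> is_cokernel \<A> p i)"

definition iso_pairs :: "('o, 'm, 'z) add_cat_scheme \<Rightarrow> 'm \<times> 'm \<Rightarrow> 'm \<times> 'm \<Rightarrow> bool" where
  "iso_pairs \<A> = (\<lambda>(i, p) (i', p'). \<exists>a b c.
     iso_arr \<A> (Dom \<A> i) (Dom \<A> i') a \<and> iso_arr \<A> (Cod \<A> i) (Cod \<A> i') b \<and>
     iso_arr \<A> (Cod \<A> p) (Cod \<A> p') c \<and>
     b \<cdot>\<^bsub>\<A>\<^esub> i = i' \<cdot>\<^bsub>\<A>\<^esub> a \<and> c \<cdot>\<^bsub>\<A>\<^esub> p = p' \<cdot>\<^bsub>\<A>\<^esub> b)"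

definition admissible_monic :: "('m \<times> 'm) set \<Rightarrow> 'm \<Rightarrow> bool" where
  "admissible_monic \<E> i \<longleftrightarrow> (\<exists>p. (i, p) \<in> \<E>)"

definition admissible_epic :: "('m \<times> 'm) set \<Rightarrow> 'm \<Rightarrow> bool" where
  "admissible_epic \<E> p \<longleftrightarrow> (\<exists>i. (i, p) \<in> \<E>)"

locale exact_category = additive_category \<A>
  for \<A> :: "('o, 'm, 'z) add_cat_scheme" (structure) +
  fixes \<E> :: "('m \<times> 'm) set"
  assumes E_kernel_cokernel: "\<sigma> \<in> \<E> \<Longrightarrow> kernel_cokernel_pair \<A> \<sigma>"
    and E_iso_closed:
      "\<lbrakk>\<sigma> \<in> \<E>; kernel_cokernel_pair \<A> \<tau>; iso_pairs \<A> \<sigma> \<tau>\<rbrakk> \<Longrightarrow> \<tau> \<in> \<E>"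
    and Ide_admissible_monic: "X \<in> Obj \<A> \<Longrightarrow> admissible_monic \<E> (Ide \<A> X)"
    and Ide_admissible_epic: "X \<in> Obj \<A> \<Longrightarrow> admissible_epic \<E> (Ide \<A> X)"
    and Comp_admissible_monic:
      "\<lbrakk>admissible_monic \<E> i; admissible_monic \<E> j; Cod \<A> i = Dom \<A> j\<rbrakk>
        \<Longrightarrow> admissible_monic \<E> (j \<cdot> i)"
    and Comp_admissible_epic:
      "\<lbrakk>admissible_epic \<E> p; admissible_epic \<E> q; Cod \<A> p = Dom \<A> q\<rbrakk>
        \<Longrightarrow> admissible_epic \<E> (q \<cdot> p)"
    and pushout_admissible_monic:
      "\<lbrakk>admissible_monic \<E> i; f \<in> Arr \<A>; Dom \<A> f = Dom \<A> i\<rbrakk>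
        \<Longrightarrow> \<exists>g i'. is_pushout \<A> i f g i' \<and> admissible_monic \<E> i'"
    and pullback_admissible_epic:
      "\<lbrakk>admissible_epic \<E> p; h \<in> Arr \<A>; Cod \<A> h = Cod \<A> p\<rbrakk>
        \<Longrightarrow> \<exists>g p'. is_pullback \<A> p h g p' \<and> admissible_epic \<E> p'"


section \<open>The functor Ext\<close>

definition ext_pairs ::
  "('o, 'm, 'z) add_cat_scheme \<Rightarrow> ('m \<times> 'm) set \<Rightarrow> 'o \<Rightarrow> 'o \<Rightarrow> ('m \<times> 'm) set" where
  "ext_pairs \<A> \<E> C A = {(i, p) \<in> \<E>. Dom \<A> i = A \<and> Cod \<A> p = C}"

definition ext_rel ::
  "('o, 'm, 'z) add_cat_scheme \<Rightarrow> ('m \<times> 'm) set \<Rightarrow> 'o \<Rightarrow> 'o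
    \<Rightarrow> (('m \<times> 'm) \<times> ('m \<times> 'm)) set" where
  "ext_rel \<A> \<E> C A = {((i, p), (i', p')).
     (i, p) \<in> ext_pairs \<A> \<E> C A \<and> (i', p') \<in> ext_pairs \<A> \<E> C A \<and>
     (\<exists>b \<in> homset \<A> (Cod \<A> i) (Cod \<A> i'). b \<cdot>\<^bsub>\<A>\<^esub> i = i' \<and> p' \<cdot>\<^bsub>\<A>\<^esub> b = p)}"

text \<open>
  \<open>pushout_pair \<A> \<E> f \<sigma> \<tau>\<close>: the sequence \<open>\<tau>\<close> in \<open>\<E>\<close> is a pushout of \<open>\<sigma>\<close> along f; that is,
  there is a commutative diagram

    A --i--> B --p--> C
    |f       |g       ||
    A'--i'-> B'--p'-> C

  with rows \<open>\<sigma>\<close>, \<open>\<tau>\<close> whose left square is a pushout. Dually for \<open>pullback_pair\<close>.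
\<close>

definition pushout_pair ::
  "('o, 'm, 'z) add_cat_scheme \<Rightarrow> ('m \<times> 'm) set \<Rightarrow> 'm \<Rightarrow> 'm \<times> 'm \<Rightarrow> 'm \<times> 'm \<Rightarrow> bool" where
  "pushout_pair \<A> \<E> f = (\<lambda>(i, p) (i', p'). (i, p) \<in> \<E> \<and> (i', p') \<in> \<E> \<and>
     (\<exists>g. is_pushout \<A> i f g i' \<and> p' \<cdot>\<^bsub>\<A>\<^esub> g = p))"

definition pullback_pair ::
  "('o, 'm, 'z) add_cat_scheme \<Rightarrow> ('m \<times> 'm) set \<Rightarrow> 'm \<Rightarrow> 'm \<times> 'm \<Rightarrow> 'm \<times> 'm \<Rightarrow> bool" where
  "pullback_pair \<A> \<E> h = (\<lambda>(i, p) (i', p'). (i, p) \<in> \<E> \<and> (i', p') \<in> \<E> \<and>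
     (\<exists>g. is_pullback \<A> p h g p' \<and> g \<cdot>\<^bsub>\<A>\<^esub> i' = i))"

text \<open>
  \<open>direct_sum_pair \<A> \<sigma> \<sigma>' (PA, iA, pA) (PC, iC, pC) \<rho>\<close>: the sequence \<open>\<rho>\<close> is a direct sum
  of \<open>\<sigma>\<close> and \<open>\<sigma>'\<close> whose outer objects are the given biproducts PA and PC.
\<close>

definition direct_sum_pair ::
  "('o, 'm, 'z) add_cat_scheme \<Rightarrow> 'm \<times> 'm \<Rightarrow> 'm \<times> 'm
    \<Rightarrow> 'o \<times> (nat \<Rightarrow> 'm) \<times> (nat \<Rightarrow> 'm) \<Rightarrow> 'o \<times> (nat \<Rightarrow> 'm) \<times> (nat \<Rightarrow> 'm)
    \<Rightarrow> 'm \<times> 'm \<Rightarrow> bool" where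
  "direct_sum_pair \<A> = (\<lambda>(i, p) (i', p') (PA, iA, pA) (PC, iC, pC) (j, q).
     is_biproduct \<A> [Dom \<A> i, Dom \<A> i'] PA iA pA \<and>
     is_biproduct \<A> [Cod \<A> p, Cod \<A> p'] PC iC pC \<and>
     (\<exists>PB iB pB. is_biproduct \<A> [Cod \<A> i, Cod \<A> i'] PB iB pB \<and>
        j = iB 0 \<cdot>\<^bsub>\<A>\<^esub> i \<cdot>\<^bsub>\<A>\<^esub> pA 0 \<boxplus>\<^bsub>\<A>\<^esub> iB 1 \<cdot>\<^bsub>\<A>\<^esub> i' \<cdot>\<^bsub>\<A>\<^esub> pA 1 \<and>
        q = iC 0 \<cdot>\<^bsub>\<A>\<^esub> p \<cdot>\<^bsub>\<A>\<^esub> pB 0 \<boxplus>\<^bsub>\<A>\<^esub> iC 1 \<cdot>\<^bsub>\<A>\<^esub> p' \<cdot>\<^bsub>\<A>\<^esub> pB 1))"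

text \<open>
  The Baer sum of \<open>\<sigma>\<close> and \<open>\<sigma>'\<close> (both from A to C) is obtained from their direct sum by pulling
  back along the diagonal \<open>C \<rightarrow> C \<oplus> C\<close> and pushing out along the codiagonal \<open>A \<oplus> A \<rightarrow> A\<close>. It is
  a relation, as biproducts, pullbacks and pushouts are only determined up to isomorphism.
\<close>

definition is_baer_sum ::
  "('o, 'm, 'z) add_cat_scheme \<Rightarrow> ('m \<times> 'm) set
    \<Rightarrow> 'm \<times> 'm \<Rightarrow> 'm \<times> 'm \<Rightarrow> 'm \<times> 'm \<Rightarrow> bool" where
  "is_baer_sum \<A> \<E> \<sigma> \<sigma>' \<tau> \<longleftrightarrow> (\<exists>PA iA pA PC iC pC \<rho> \<rho>'.
     direct_sum_pair \<A> \<sigma> \<sigma>' (PA, iA, pA) (PC, iC, pC) \<rho> \<and>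
     pullback_pair \<A> \<E> (iC 0 \<boxplus>\<^bsub>\<A>\<^esub> iC 1) \<rho> \<rho>' \<and>
     pushout_pair \<A> \<E> (pA 0 \<boxplus>\<^bsub>\<A>\<^esub> pA 1) \<rho>' \<tau>)"

text \<open>
  The operations on classes collect all possible outcomes on representatives. Since these
  outcomes are determined exactly up to equivalence, the result is again a single class. In
  particular the neutral element, the class of the split sequence \<open>A \<rightarrow> A \<oplus> C \<rightarrow> C\<close>, consists
  of all such sequences for all biproducts of A and C.
\<close>

definition Ext_group ::
  "('o, 'm, 'z) add_cat_scheme \<Rightarrow> ('m \<times> 'm) set \<Rightarrow> 'o \<Rightarrow> 'o \<Rightarrow> ('m \<times> 'm) set monoid" where
  "Ext_group \<A> \<E> C A =
     \<lparr>carrier = ext_pairs \<A> \<E> C A // ext_rel \<A> \<E> C A,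
      monoid.mult = (\<lambda>S T. {\<tau>. \<exists>\<sigma> \<in> S. \<exists>\<sigma>' \<in> T. is_baer_sum \<A> \<E> \<sigma> \<sigma>' \<tau>}),
      one = {(i 0, p 1) |P i p. is_biproduct \<A> [A, C] P i p}\<rparr>"

definition Ext_push ::
  "('o, 'm, 'z) add_cat_scheme \<Rightarrow> ('m \<times> 'm) set \<Rightarrow> 'm \<Rightarrow> ('m \<times> 'm) set \<Rightarrow> ('m \<times> 'm) set" where
  "Ext_push \<A> \<E> f S = {\<tau>. \<exists>\<sigma> \<in> S. pushout_pair \<A> \<E> f \<sigma> \<tau>}"

definition Ext_pull ::
  "('o, 'm, 'z) add_cat_scheme \<Rightarrow> ('m \<times> 'm) set \<Rightarrow> 'm \<Rightarrow> ('m \<times> 'm) set \<Rightarrow> ('m \<times> 'm) set" where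
  "Ext_pull \<A> \<E> h S = {\<tau>. \<exists>\<sigma> \<in> S. pullback_pair \<A> \<E> h \<sigma> \<tau>}"


section \<open>Functors to abelian groups and subfunctors\<close>

record ('o, 'm, 'a) ab_functor_data =
  on_obj :: "'o \<Rightarrow> 'a monoid"
  on_arr :: "'m \<Rightarrow> 'a \<Rightarrow> 'a"

locale ab_functor = category \<D>
  for \<D> :: "('o, 'm, 'z) cat_scheme" (structure) +
  fixes F :: "('o, 'm, 'a) ab_functor_data"
  assumes on_obj_comm_group: "X \<in> Obj \<D> \<Longrightarrow> comm_group (on_obj F X)"
    and on_arr_hom: "f \<in> homset \<D> X Y \<Longrightarrow> on_arr F f \<in> hom (on_obj F X) (on_obj F Y)"
    and on_arr_Ide:
      "\<lbrakk>X \<in> Obj \<D>; x \<in> carrier (on_obj F X)\<rbrakk> \<Longrightarrow> on_arr F (Ide \<D> X) x = x"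
    and on_arr_Comp:
      "\<lbrakk>f \<in> homset \<D> X Y; g \<in> homset \<D> Y Z; x \<in> carrier (on_obj F X)\<rbrakk>
        \<Longrightarrow> on_arr F (g \<cdot> f) x = on_arr F g (on_arr F f x)"

definition subfunctor_via ::
  "('o, 'm, 'z) cat_scheme \<Rightarrow> ('o, 'm, 'a) ab_functor_data \<Rightarrow> ('o, 'm, 'b) ab_functor_data
    \<Rightarrow> ('o \<Rightarrow> 'a \<Rightarrow> 'b) \<Rightarrow> bool" where
  "subfunctor_via \<D> G F \<iota> \<longleftrightarrow>
     ab_functor \<D> G \<and> ab_functor \<D> F \<and>
     (\<forall>X \<in> Obj \<D>. \<iota> X \<in> hom (on_obj G X) (on_obj F X) \<and>
        inj_on (\<iota> X) (carrier (on_obj G X))) \<and>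
     (\<forall>X \<in> Obj \<D>. \<forall>Y \<in> Obj \<D>. \<forall>f \<in> homset \<D> X Y. \<forall>x \<in> carrier (on_obj G X).
        \<iota> Y (on_arr G f x) = on_arr F f (\<iota> X x))"

text \<open>
  An arrow \<open>(C, A) \<rightarrow> (C', A')\<close> of \<open>\<A>\<^sup>o\<^sup>p \<times> \<A>\<close> is a pair \<open>(h, f)\<close> of arrows \<open>h : C' \<rightarrow> C\<close> and
  \<open>f : A \<rightarrow> A'\<close> of \<open>\<A>\<close>.
\<close>

definition Ext ::
  "('o, 'm, 'z) add_cat_scheme \<Rightarrow> ('m \<times> 'm) set
    \<Rightarrow> ('o \<times> 'o, 'm \<times> 'm, ('m \<times> 'm) set) ab_functor_data" where
  "Ext \<A> \<E> =
     \<lparr>on_obj = (\<lambda>(C, A). Ext_group \<A> \<E> C A),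
      on_arr = (\<lambda>(h, f) S. Ext_push \<A> \<E> f (Ext_pull \<A> \<E> h S))\<rparr>"

definition additive_pairs ::
  "('o, 'm, 'z) add_cat_scheme \<Rightarrow> ('m \<times> 'm) set \<Rightarrow> ('o \<Rightarrow> int) \<Rightarrow> ('m \<times> 'm) set" where
  "additive_pairs \<A> \<E> \<phi> = {(i, p) \<in> \<E>. \<phi> (Cod \<A> i) = \<phi> (Dom \<A> i) + \<phi> (Cod \<A> p)}"

text \<open>
  For a subclass \<open>\<E>'\<close> of \<open>\<E>\<close>: the assignment \<open>(C, A) \<mapsto> {[\<sigma>] \<in> Ext(C, A) | \<sigma> \<in> \<E>'}\<close>, with
  operations and maps inherited from Ext. The classes are those of Ext, i.e. they are
  taken with respect to \<open>\<E>\<close>.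
\<close>

definition Ext_restrict ::
  "('o, 'm, 'z) add_cat_scheme \<Rightarrow> ('m \<times> 'm) set \<Rightarrow> ('m \<times> 'm) set
    \<Rightarrow> ('o \<times> 'o, 'm \<times> 'm, ('m \<times> 'm) set) ab_functor_data" where
  "Ext_restrict \<A> \<E> \<E>' =
     \<lparr>on_obj = (\<lambda>(C, A). (Ext_group \<A> \<E> C A)
        \<lparr>carrier := {ext_rel \<A> \<E> C A `` {\<sigma>} |\<sigma>. \<sigma> \<in> ext_pairs \<A> \<E> C A \<and> \<sigma> \<in> \<E>'}\<rparr>),
      on_arr = on_arr (Ext \<A> \<E>)\<rparr>"

end

theory Submission
  imports Defs
begin

text \<open>
  A morphism of conflations which is the identity on cokernels is a pushout, and dually one which is
  the identity on kernels is a pullback. Hence Ext is governed by the relation ``there is a morphism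
  of conflations from \<open>\<sigma>\<close> to \<open>\<tau>\<close> with outer components \<open>f\<close> and \<open>h\<close>'', through which pushouts and
  pullbacks can be factored. Since \<open>Ext(C, -)\<close> carries biproducts to products, its Baer sum is the unique
  abelian group structure with \<open>f\<^sub>* + g\<^sub>* = (f + g)\<^sub>*\<close>, and pullback respects it.

  If \<open>A' \<rightarrow> B' \<rightarrow> C\<close> is the pushout of \<open>A \<rightarrow> B \<rightarrow> C\<close>, then \<open>A \<rightarrow> A' \<oplus> B \<rightarrow> B'\<close> is again a conflation, and
  subadditivity of \<open>\<phi>\<close> on it is the inequality missing for additivity on the pushout. Pullbacks are
  dual, split sequences and direct sums are additive because \<open>\<phi>\<close> is additive on biproducts, so the
  additive classes form subgroups preserved by all induced maps.
\<close>

section \<open>Opposite categories\<close>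

text \<open>The axioms hand out single admissible arrows, pushouts of admissible monics and
  pullbacks of admissible epics, but no larger diagrams. Pullback and direct sum conflations are
  therefore recognised by exhibiting a kernel of an arrow already known to be an admissible epic. In
  particular \<open>A \<rightarrow> A' \<oplus> B \<rightarrow> B'\<close> is not formed from a
  biproduct: it arises by pulling back \<open>B \<rightarrow> C\<close> along
  \<open>B' \<rightarrow> C\<close>, and the given arrow \<open>B \<rightarrow> B'\<close> splits
  this pullback, with \<open>-f\<close> and \<open>i\<close> as the components of its first arrow.

  The operations on Ext collect all outcomes on all representatives, so they are relations before
  they are functions. Stating everything through \<open>ext_mor\<close> avoids choices: one
  cancellation rule for pullbacks and one for pushouts stand in for the universal properties, and
  identities between classes become composition followed by cancellation.

  Passing to the opposite category exchanges pushouts and pullbacks. This opposite has to keep the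
  addition, its conflations are \<open>\<E>\<inverse>\<close>, and the assumptions on \<phi> are
  self-dual as well.\<close>

definition op_add_cat :: "('o, 'm, 'z) add_cat_scheme \<Rightarrow> ('o, 'm) add_cat" where
  "op_add_cat \<A> = \<lparr>Obj = Obj \<A>, Arr = Arr \<A>, Dom = Cod \<A>, Cod = Dom \<A>, Ide = Ide \<A>,
     Comp = (\<lambda>g f. f \<cdot>\<^bsub>\<A>\<^esub> g), Add = Add \<A>, Zero = (\<lambda>X Y. Zero \<A> Y X)\<rparr>"

lemma op_add_cat_simps [simp]:
  "Obj (op_add_cat \<A>) = Obj \<A>" "Arr (op_add_cat \<A>) = Arr \<A>"
  "Dom (op_add_cat \<A>) = Cod \<A>" "Cod (op_add_cat \<A>) = Dom \<A>"
  "Ide (op_add_cat \<A>) = Ide \<A>" "g \<cdot>\<^bsub>op_add_cat \<A>\<^esub> f = f \<cdot>\<^bsub>\<A>\<^esub> g"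
  "Add (op_add_cat \<A>) = Add \<A>" "Zero (op_add_cat \<A>) X Y = Zero \<A> Y X"
  by (simp_all add: op_add_cat_def)

lemma homset_op [simp]: "homset (op_add_cat \<A>) X Y = homset \<A> Y X"
  by (auto simp: homset_def)

lemma hom_group_op [simp]: "hom_group (op_add_cat \<A>) X Y = hom_group \<A> Y X"
  by (simp add: hom_group_def)

lemma is_kernel_op [simp]: "is_kernel (op_add_cat \<A>) p i \<longleftrightarrow> is_cokernel \<A> p i"
  by (auto simp: is_kernel_def is_cokernel_def)

lemma is_cokernel_op [simp]: "is_cokernel (op_add_cat \<A>) i p \<longleftrightarrow> is_kernel \<A> i p"
  by (auto simp: is_kernel_def is_cokernel_def)

text \<open>The argument orders of \<open>is_pushout\<close> and \<open>is_pullback\<close> match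
  under reversal of arrows, so nothing has to be permuted.\<close>

lemma is_pushout_op [simp]: "is_pushout (op_add_cat \<A>) p h g p' \<longleftrightarrow> is_pullback \<A> p h g p'"
  by (simp add: is_pullback_def is_pushout_def)

lemma is_pullback_op [simp]: "is_pullback (op_add_cat \<A>) i f g i' \<longleftrightarrow> is_pushout \<A> i f g i'"
  by (simp add: is_pullback_def is_pushout_def)

lemma iso_arr_op: "iso_arr (op_add_cat \<A>) Y X f \<longleftrightarrow> iso_arr \<A> X Y f"
  by (auto simp: iso_arr_def)

lemma admissible_monic_op [simp]: "admissible_monic (\<E>\<inverse>) p \<longleftrightarrow> admissible_epic \<E> p"
  by (simp add: admissible_monic_def admissible_epic_def)

lemma admissible_epic_op [simp]: "admissible_epic (\<E>\<inverse>) i \<longleftrightarrow> admissible_monic \<E> i"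
  by (simp add: admissible_monic_def admissible_epic_def)

lemma is_biproduct_op:
  assumes "is_biproduct \<A> Xs P i p"
  shows "is_biproduct (op_add_cat \<A>) Xs P p i"
  using assms by (auto simp: is_biproduct_def)

section \<open>Arrows and sums of arrows\<close>

context category
begin

lemma homset_iff: "f \<in> homset \<C> X Y \<longleftrightarrow> f \<in> Arr \<C> \<and> Dom \<C> f = X \<and> Cod \<C> f = Y"
  by (simp add: homset_def)

lemma Ide_typing [simp]:
  assumes "X \<in> Obj \<C>"
  shows "Ide \<C> X \<in> Arr \<C>" "Dom \<C> (Ide \<C> X) = X" "Cod \<C> (Ide \<C> X) = X"
  using Ide_in_homset[OF assms] by (auto simp: homset_def)

lemma Comp_typing [simp]:
  assumes "f \<in> Arr \<C>" "g \<in> Arr \<C>" "Cod \<C> f = Dom \<C> g"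
  shows "g \<cdot> f \<in> Arr \<C>" "Dom \<C> (g \<cdot> f) = Dom \<C> f" "Cod \<C> (g \<cdot> f) = Cod \<C> g"
  using Comp_in_homset[of f "Dom \<C> f" "Dom \<C> g" g "Cod \<C> g"] assms by (auto simp: homset_def)

lemma Dom_Cod_Obj [simp]: "f \<in> Arr \<C> \<Longrightarrow> Dom \<C> f \<in> Obj \<C>" "f \<in> Arr \<C> \<Longrightarrow> Cod \<C> f \<in> Obj \<C>"
  by (simp_all add: Dom_in_Obj Cod_in_Obj)

lemma Comp_Ide_simp [simp]: "\<lbrakk>f \<in> Arr \<C>; Dom \<C> f = X\<rbrakk> \<Longrightarrow> f \<cdot> Ide \<C> X = f"
  by (simp add: Comp_Ide homset_def)

lemma Ide_Comp_simp [simp]: "\<lbrakk>f \<in> Arr \<C>; Cod \<C> f = X\<rbrakk> \<Longrightarrow> Ide \<C> X \<cdot> f = f"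
  by (simp add: Ide_Comp homset_def)

lemma Comp_assoc_simp [simp]:
  "\<lbrakk>f \<in> Arr \<C>; g \<in> Arr \<C>; h \<in> Arr \<C>; Cod \<C> f = Dom \<C> g; Cod \<C> g = Dom \<C> h\<rbrakk>
    \<Longrightarrow> (h \<cdot> g) \<cdot> f = h \<cdot> (g \<cdot> f)"
  by (rule Comp_assoc) (auto simp: homset_def)

text \<open>Composites are normalised by associating to the right, so an equation
  \<open>g \<cdot> f = k\<close> no longer matches once a further arrow \<open>x\<close> stands on
  its right. This is the form that still does.\<close>

lemma Comp_reassoc:
  assumes "g \<cdot> f = k" "f \<in> Arr \<C>" "g \<in> Arr \<C>" "Cod \<C> f = Dom \<C> g" "x \<in> Arr \<C>" "Cod \<C> x = Dom \<C> f"
  shows "g \<cdot> (f \<cdot> x) = k \<cdot> x"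
  using Comp_assoc_simp[of x f g] assms by simp

end

lemma category_op_cat:
  assumes "category \<C>" shows "category (op_cat \<C>)"
proof -
  interpret category \<C> by fact
  show ?thesis by unfold_locales (auto simp: op_cat_def homset_def)
qed

lemma category_prod_cat:
  assumes "category \<C>" "category \<D>" shows "category (prod_cat \<C> \<D>)"
proof -
  interpret C: category \<C> by fact
  interpret D: category \<D> by fact
  show ?thesis by unfold_locales (auto simp: prod_cat_def homset_def)
qed

context additive_category
begin

definition neg :: "'m \<Rightarrow> 'm" where
  "neg f = inv\<^bsub>hom_group \<A> (Dom \<A> f) (Cod \<A> f)\<^esub> f"

lemma Zero_typing [simp]:
  assumes "X \<in> Obj \<A>" "Y \<in> Obj \<A>"
  shows "Zero \<A> X Y \<in> Arr \<A>" "Dom \<A> (Zero \<A> X Y) = X" "Cod \<A> (Zero \<A> X Y) = Y"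
proof -
  interpret comm_group "hom_group \<A> X Y" using assms by (rule hom_comm_group)
  from one_closed show "Zero \<A> X Y \<in> Arr \<A>" "Dom \<A> (Zero \<A> X Y) = X" "Cod \<A> (Zero \<A> X Y) = Y"
    by (auto simp: hom_group_def homset_def)
qed

lemma Add_typing [simp]:
  assumes "f \<in> Arr \<A>" "g \<in> Arr \<A>" "Dom \<A> f = Dom \<A> g" "Cod \<A> f = Cod \<A> g"
  shows "f \<boxplus> g \<in> Arr \<A>" "Dom \<A> (f \<boxplus> g) = Dom \<A> g" "Cod \<A> (f \<boxplus> g) = Cod \<A> g"
proof -
  interpret comm_group "hom_group \<A> (Dom \<A> g) (Cod \<A> g)" using assms by (intro hom_comm_group) auto
  from m_closed[of f g] assms
  show "f \<boxplus> g \<in> Arr \<A>" "Dom \<A> (f \<boxplus> g) = Dom \<A> g" "Cod \<A> (f \<boxplus> g) = Cod \<A> g"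
    by (auto simp: hom_group_def homset_def)
qed

lemma Add_assoc:
  assumes "f \<in> Arr \<A>" "g \<in> Arr \<A>" "h \<in> Arr \<A>" "Dom \<A> f = Dom \<A> g" "Cod \<A> f = Cod \<A> g"
    "Dom \<A> g = Dom \<A> h" "Cod \<A> g = Cod \<A> h"
  shows "f \<boxplus> g \<boxplus> h = f \<boxplus> (g \<boxplus> h)"
proof -
  interpret comm_group "hom_group \<A> (Dom \<A> g) (Cod \<A> g)" using assms by (intro hom_comm_group) auto
  from m_assoc[of f g h] assms show ?thesis by (auto simp: hom_group_def homset_def)
qed

lemma Add_comm:
  assumes "f \<in> Arr \<A>" "g \<in> Arr \<A>" "Dom \<A> f = Dom \<A> g" "Cod \<A> f = Cod \<A> g"
  shows "f \<boxplus> g = g \<boxplus> f"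
proof -
  interpret comm_group "hom_group \<A> (Dom \<A> g) (Cod \<A> g)" using assms by (intro hom_comm_group) auto
  from m_comm[of f g] assms show ?thesis by (auto simp: hom_group_def homset_def)
qed

lemma Add_Zero [simp]:
  assumes "f \<in> Arr \<A>" "Dom \<A> f = X" "Cod \<A> f = Y"
  shows "f \<boxplus> Zero \<A> X Y = f" "Zero \<A> X Y \<boxplus> f = f"
proof -
  interpret comm_group "hom_group \<A> X Y" using assms by (intro hom_comm_group) auto
  from r_one[of f] l_one[of f] assms show "f \<boxplus> Zero \<A> X Y = f" "Zero \<A> X Y \<boxplus> f = f"
    by (auto simp: hom_group_def homset_def)
qed

lemma neg_typing [simp]:
  assumes "f \<in> Arr \<A>"
  shows "neg f \<in> Arr \<A>" "Dom \<A> (neg f) = Dom \<A> f" "Cod \<A> (neg f) = Cod \<A> f"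
proof -
  interpret comm_group "hom_group \<A> (Dom \<A> f) (Cod \<A> f)" using assms by (intro hom_comm_group) auto
  from inv_closed[of f] assms
  show "neg f \<in> Arr \<A>" "Dom \<A> (neg f) = Dom \<A> f" "Cod \<A> (neg f) = Cod \<A> f"
    unfolding neg_def by (auto simp: hom_group_def homset_def)
qed

lemma Add_neg [simp]:
  assumes "f \<in> Arr \<A>" "Dom \<A> f = X" "Cod \<A> f = Y"
  shows "f \<boxplus> neg f = Zero \<A> X Y" "neg f \<boxplus> f = Zero \<A> X Y"
proof -
  interpret comm_group "hom_group \<A> X Y" using assms by (intro hom_comm_group) auto
  have f: "f \<in> carrier (hom_group \<A> X Y)" using assms by (simp add: hom_group_def homset_def)
  from r_inv[OF f] l_inv[OF f] assms
  show "f \<boxplus> neg f = Zero \<A> X Y" "neg f \<boxplus> f = Zero \<A> X Y"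
    unfolding neg_def by (auto simp: hom_group_def)
qed

lemma Add_right_cancel:
  assumes "f \<boxplus> h = g \<boxplus> h" "f \<in> Arr \<A>" "g \<in> Arr \<A>" "h \<in> Arr \<A>"
    "Dom \<A> f = Dom \<A> h" "Cod \<A> f = Cod \<A> h" "Dom \<A> g = Dom \<A> h" "Cod \<A> g = Cod \<A> h"
  shows "f = g"
proof -
  interpret comm_group "hom_group \<A> (Dom \<A> h) (Cod \<A> h)" using assms by (intro hom_comm_group) auto
  from right_cancel[of h f g] assms show ?thesis by (auto simp: hom_group_def homset_def)
qed

lemma Comp_Add_simp [simp]:
  assumes "f \<in> Arr \<A>" "f' \<in> Arr \<A>" "g \<in> Arr \<A>"
    "Dom \<A> f = Dom \<A> f'" "Cod \<A> f = Dom \<A> g" "Cod \<A> f' = Dom \<A> g"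
  shows "g \<cdot> (f \<boxplus> f') = g \<cdot> f \<boxplus> g \<cdot> f'"
  using assms by (intro Comp_Add[of _ "Dom \<A> f" "Dom \<A> g" _ _ "Cod \<A> g"]) (auto simp: homset_def)

lemma Add_Comp_simp [simp]:
  assumes "f \<in> Arr \<A>" "g \<in> Arr \<A>" "g' \<in> Arr \<A>"
    "Cod \<A> g = Cod \<A> g'" "Dom \<A> g = Cod \<A> f" "Dom \<A> g' = Cod \<A> f"
  shows "(g \<boxplus> g') \<cdot> f = g \<cdot> f \<boxplus> g' \<cdot> f"
  using assms by (intro Add_Comp[of _ "Dom \<A> f" "Cod \<A> f" _ "Cod \<A> g"]) (auto simp: homset_def)

text \<open>By bilinearity \<open>g \<cdot> 0\<close> equals its own double, and cancellation leaves
  zero.\<close>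

lemma Comp_Zero [simp]:
  assumes "g \<in> Arr \<A>" "Dom \<A> g = Y" "X \<in> Obj \<A>"
  shows "g \<cdot> Zero \<A> X Y = Zero \<A> X (Cod \<A> g)"
proof -
  have Y: "Y \<in> Obj \<A>" using assms by auto
  have "g \<cdot> (Zero \<A> X Y \<boxplus> Zero \<A> X Y) = g \<cdot> Zero \<A> X Y"
    using assms Y by (subst Add_Zero) auto
  then have "g \<cdot> Zero \<A> X Y \<boxplus> g \<cdot> Zero \<A> X Y = Zero \<A> X (Cod \<A> g) \<boxplus> g \<cdot> Zero \<A> X Y"
    using assms Y by (simp add: Comp_Add_simp[symmetric] del: Comp_Add_simp)
  then show ?thesis by (rule Add_right_cancel) (use assms Y in auto)
qed

lemma Zero_Comp [simp]:
  assumes "f \<in> Arr \<A>" "Cod \<A> f = Y" "Z \<in> Obj \<A>"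
  shows "Zero \<A> Y Z \<cdot> f = Zero \<A> (Dom \<A> f) Z"
proof -
  have Y: "Y \<in> Obj \<A>" using assms by auto
  have "(Zero \<A> Y Z \<boxplus> Zero \<A> Y Z) \<cdot> f = Zero \<A> Y Z \<cdot> f"
    using assms Y by (subst Add_Zero) auto
  then have "Zero \<A> Y Z \<cdot> f \<boxplus> Zero \<A> Y Z \<cdot> f = Zero \<A> (Dom \<A> f) Z \<boxplus> Zero \<A> Y Z \<cdot> f"
    using assms Y by (simp add: Add_Comp_simp[symmetric] del: Add_Comp_simp)
  then show ?thesis by (rule Add_right_cancel) (use assms Y in auto)
qed

lemma Comp_neg [simp]:
  assumes "f \<in> Arr \<A>" "g \<in> Arr \<A>" "Cod \<A> f = Dom \<A> g"
  shows "g \<cdot> neg f = neg (g \<cdot> f)"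
proof (rule Add_right_cancel)
  have "g \<cdot> neg f \<boxplus> g \<cdot> f = g \<cdot> (neg f \<boxplus> f)"
    using assms by (subst Comp_Add_simp) auto
  then show "g \<cdot> neg f \<boxplus> g \<cdot> f = neg (g \<cdot> f) \<boxplus> g \<cdot> f"
    using assms by simp
qed (use assms in auto)

lemma neg_Comp [simp]:
  assumes "f \<in> Arr \<A>" "g \<in> Arr \<A>" "Cod \<A> f = Dom \<A> g"
  shows "neg g \<cdot> f = neg (g \<cdot> f)"
proof (rule Add_right_cancel)
  have "neg g \<cdot> f \<boxplus> g \<cdot> f = (neg g \<boxplus> g) \<cdot> f"
    using assms by (subst Add_Comp_simp) auto
  then show "neg g \<cdot> f \<boxplus> g \<cdot> f = neg (g \<cdot> f) \<boxplus> g \<cdot> f"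
    using assms by simp
qed (use assms in auto)

lemma neg_Zero [simp]:
  assumes "X \<in> Obj \<A>" "Y \<in> Obj \<A>"
  shows "neg (Zero \<A> X Y) = Zero \<A> X Y"
  using Add_Zero(2)[of "neg (Zero \<A> X Y)" X Y] Add_neg(1)[of "Zero \<A> X Y" X Y] assms by simp

lemma is_biproduct_pair_iff:
  "is_biproduct \<A> [X, Y] P i p \<longleftrightarrow>
     X \<in> Obj \<A> \<and> Y \<in> Obj \<A> \<and> P \<in> Obj \<A> \<and>
     i 0 \<in> homset \<A> X P \<and> p 0 \<in> homset \<A> P X \<and> i 1 \<in> homset \<A> Y P \<and> p 1 \<in> homset \<A> P Y \<and>
     p 0 \<cdot> i 0 = Ide \<A> X \<and> p 1 \<cdot> i 1 = Ide \<A> Y \<and>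
     p 0 \<cdot> i 1 = Zero \<A> Y X \<and> p 1 \<cdot> i 0 = Zero \<A> X Y \<and>
     i 0 \<cdot> p 0 \<boxplus> i 1 \<cdot> p 1 = Ide \<A> P"
proof -
  \<comment> \<open>The product can be expanded only if its terms lie in the group, hence the typing
    premises. They are among the other conjuncts on both sides of the equivalence.\<close>
  have fin: "finprod (hom_group \<A> P P) (\<lambda>k. i k \<cdot> p k) {..<length [X, Y]} = i 0 \<cdot> p 0 \<boxplus> i 1 \<cdot> p 1"
    if "P \<in> Obj \<A>" "i 0 \<in> homset \<A> X P" "p 0 \<in> homset \<A> P X" "i 1 \<in> homset \<A> Y P" "p 1 \<in> homset \<A> P Y"
  proof -
    interpret comm_group "hom_group \<A> P P" using that by (intro hom_comm_group)
    have ar: "i 0 \<cdot> p 0 \<in> carrier (hom_group \<A> P P)" "i 1 \<cdot> p 1 \<in> carrier (hom_group \<A> P P)"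
      using that by (auto simp: hom_group_def homset_def)
    have "{..<length [X, Y]} = {0, 1}" by auto
    then have "finprod (hom_group \<A> P P) (\<lambda>k. i k \<cdot> p k) {..<length [X, Y]} =
        (i 0 \<cdot> p 0) \<otimes>\<^bsub>hom_group \<A> P P\<^esub> (i 1 \<cdot> p 1)"
      using ar by (simp add: Pi_def)
    then show ?thesis by (simp add: hom_group_def)
  qed
  have all2: "(\<forall>k < length [X, Y]. Q k) \<longleftrightarrow> Q 0 \<and> Q 1" for Q :: "nat \<Rightarrow> bool"
    by (auto simp: less_Suc_eq)
  show ?thesis
    unfolding is_biproduct_def all2 using fin by auto
qed

end

section \<open>Duality for additive and exact categories\<close>

lemma additive_category_op:
  assumes "additive_category \<A>" shows "additive_category (op_add_cat \<A>)"
proof -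
  interpret additive_category \<A> by fact
  show ?thesis
  proof (intro additive_category.intro additive_category_axioms.intro)
    show "category (op_add_cat \<A>)" by unfold_locales (auto simp: homset_def)
  next
    fix X Y assume "X \<in> Obj (op_add_cat \<A>)" "Y \<in> Obj (op_add_cat \<A>)"
    then show "comm_group (hom_group (op_add_cat \<A>) X Y)" by (simp add: hom_comm_group)
  next
    fix Xs assume "set Xs \<subseteq> Obj (op_add_cat \<A>)"
    then obtain P i p where "is_biproduct \<A> Xs P i p" using ex_biproduct[of Xs] by auto
    then show "\<exists>P i p. is_biproduct (op_add_cat \<A>) Xs P i p" by (meson is_biproduct_op)
  qed (auto simp: homset_def)
qed

lemma exact_category_op:
  fixes \<A> (structure)
  assumes "exact_category \<A> \<E>" shows "exact_category (op_add_cat \<A>) (\<E>\<inverse>)"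
proof -
  interpret exact_category \<A> \<E> by fact
  interpret op: additive_category "op_add_cat \<A>"
    by (rule additive_category_op) unfold_locales
  have kc: "kernel_cokernel_pair (op_add_cat \<A>) \<sigma> \<longleftrightarrow> kernel_cokernel_pair \<A> (prod.swap \<sigma>)" for \<sigma>
    by (auto simp: kernel_cokernel_pair_def split: prod.splits)
  show ?thesis
  proof unfold_locales
    fix \<sigma> assume "\<sigma> \<in> \<E>\<inverse>"
    then show "kernel_cokernel_pair (op_add_cat \<A>) \<sigma>"
      using E_kernel_cokernel by (cases \<sigma>) (auto simp: kc)
  next
    fix \<sigma> \<tau>
    assume *: "\<sigma> \<in> \<E>\<inverse>" "kernel_cokernel_pair (op_add_cat \<A>) \<tau>" "iso_pairs (op_add_cat \<A>) \<sigma> \<tau>"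
    obtain p i p' i' where st: "\<sigma> = (p, i)" "\<tau> = (p', i')" by (cases \<sigma>, cases \<tau>) auto
    have "is_kernel \<A> i p" "is_cokernel \<A> p' i'" "is_kernel \<A> i' p'"
      using * E_kernel_cokernel[of "(i, p)"] by (auto simp: st kernel_cokernel_pair_def)
    then have ty: "i \<in> Arr \<A>" "p \<in> Arr \<A>" "Cod \<A> i = Dom \<A> p" "i' \<in> Arr \<A>" "p' \<in> Arr \<A>" "Cod \<A> i' = Dom \<A> p'"
      by (auto simp: is_kernel_def)
    have inv: "\<exists>b'. iso_arr \<A> Y X b' \<and> b \<cdot> b' = Ide \<A> Y \<and> b' \<cdot> b = Ide \<A> X" if "iso_arr \<A> X Y b" for b X Y
      using that unfolding iso_arr_def by blast
    from *(3) obtain a b c where abc: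
      "iso_arr \<A> (Cod \<A> p') (Cod \<A> p) a" "iso_arr \<A> (Cod \<A> i') (Cod \<A> i) b"
      "iso_arr \<A> (Dom \<A> i') (Dom \<A> i) c" "p \<cdot> b = a \<cdot> p'" "i \<cdot> c = b \<cdot> i'"
      using ty by (auto simp: iso_pairs_def st iso_arr_op)
    obtain a' where a': "iso_arr \<A> (Cod \<A> p) (Cod \<A> p') a'" "a' \<cdot> a = Ide \<A> (Cod \<A> p')"
      using inv[OF abc(1)] by blast
    obtain b' where b': "iso_arr \<A> (Cod \<A> i) (Cod \<A> i') b'" "b' \<cdot> b = Ide \<A> (Cod \<A> i')" "b \<cdot> b' = Ide \<A> (Cod \<A> i)"
      using inv[OF abc(2)] by blast
    obtain c' where c': "iso_arr \<A> (Dom \<A> i) (Dom \<A> i') c'" "c \<cdot> c' = Ide \<A> (Dom \<A> i)"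
      using inv[OF abc(3)] by blast
    have t2: "a \<in> homset \<A> (Cod \<A> p') (Cod \<A> p)" "b \<in> homset \<A> (Cod \<A> i') (Cod \<A> i)"
      "c \<in> homset \<A> (Dom \<A> i') (Dom \<A> i)" "a' \<in> homset \<A> (Cod \<A> p) (Cod \<A> p')"
      "b' \<in> homset \<A> (Cod \<A> i) (Cod \<A> i')" "c' \<in> homset \<A> (Dom \<A> i) (Dom \<A> i')"
      using abc a' b' c' by (auto simp: iso_arr_def)
    note t3 = t2[unfolded homset_iff] ty
    have "b' \<cdot> i = b' \<cdot> (i \<cdot> (c \<cdot> c'))" using t3 c' by simp
    also have "\<dots> = b' \<cdot> ((b \<cdot> i') \<cdot> c')"
      using t3 abc(5) by (metis Comp_assoc_simp)
    also have "\<dots> = (b' \<cdot> b) \<cdot> (i' \<cdot> c')" using t3 by simp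
    also have "\<dots> = i' \<cdot> c'" using t3 b' by simp
    finally have e1: "b' \<cdot> i = i' \<cdot> c'" .
    have "a' \<cdot> p = a' \<cdot> (p \<cdot> (b \<cdot> b'))" using t3 b' by simp
    also have "\<dots> = a' \<cdot> ((a \<cdot> p') \<cdot> b')"
      using t3 abc(4) by (metis Comp_assoc_simp)
    also have "\<dots> = (a' \<cdot> a) \<cdot> (p' \<cdot> b')" using t3 by simp
    also have "\<dots> = p' \<cdot> b'" using t3 a' by simp
    finally have e2: "a' \<cdot> p = p' \<cdot> b'" .
    have "iso_pairs \<A> (i, p) (i', p')"
      unfolding iso_pairs_def using a'(1) b'(1) c'(1) e1 e2 by auto
    moreover have "(i, p) \<in> \<E>" "kernel_cokernel_pair \<A> (i', p')" using * by (auto simp: st kc)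
    ultimately have "(i', p') \<in> \<E>" by (rule E_iso_closed[rotated 2])
    then show "\<tau> \<in> \<E>\<inverse>" by (simp add: st)
  next
    fix i f
    assume "admissible_monic (\<E>\<inverse>) i" "f \<in> Arr (op_add_cat \<A>)" "Dom (op_add_cat \<A>) f = Dom (op_add_cat \<A>) i"
    then show "\<exists>g i'. is_pushout (op_add_cat \<A>) i f g i' \<and> admissible_monic (\<E>\<inverse>) i'"
      using pullback_admissible_epic by simp
  next
    fix p h
    assume "admissible_epic (\<E>\<inverse>) p" "h \<in> Arr (op_add_cat \<A>)" "Cod (op_add_cat \<A>) h = Cod (op_add_cat \<A>) p"
    then show "\<exists>g p'. is_pullback (op_add_cat \<A>) p h g p' \<and> admissible_epic (\<E>\<inverse>) p'"
      using pushout_admissible_monic by simp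
  qed (use Ide_admissible_epic Ide_admissible_monic Comp_admissible_epic Comp_admissible_monic in auto)
qed

section \<open>Universal properties of kernels, cokernels and pullbacks\<close>

context additive_category
begin

lemma kernel_factor:
  assumes "is_kernel \<A> i p" "f \<in> Arr \<A>" "Cod \<A> f = Dom \<A> p" "p \<cdot> f = Zero \<A> (Dom \<A> f) (Cod \<A> p)"
  obtains g where "g \<in> Arr \<A>" "Dom \<A> g = Dom \<A> f" "Cod \<A> g = Dom \<A> i" "i \<cdot> g = f"
proof -
  have "\<exists>!g. g \<in> homset \<A> (Dom \<A> f) (Dom \<A> i) \<and> i \<cdot> g = f"
    using assms unfolding is_kernel_def homset_def by auto
  then show ?thesis using that unfolding homset_def by blast
qed

lemma kernel_mono:
  assumes "is_kernel \<A> i p" "i \<cdot> x = i \<cdot> y" "x \<in> Arr \<A>" "y \<in> Arr \<A>" "Dom \<A> x = Dom \<A> y"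
    "Cod \<A> x = Dom \<A> i" "Cod \<A> y = Dom \<A> i"
  shows "x = y"
proof -
  note k = assms(1)[unfolded is_kernel_def]
  have "p \<cdot> (i \<cdot> y) = Zero \<A> (Dom \<A> y) (Cod \<A> p)"
    using assms k by (subst Comp_reassoc[where g = p and f = i]) auto
  moreover have "i \<cdot> y \<in> homset \<A> (Dom \<A> y) (Dom \<A> p)"
    using assms k by (simp add: homset_def)
  ultimately have "\<exists>!g. g \<in> homset \<A> (Dom \<A> y) (Dom \<A> i) \<and> i \<cdot> g = i \<cdot> y"
    using k assms by auto
  then show ?thesis using assms unfolding homset_def by blast
qed

lemma cokernel_factor:
  assumes "is_cokernel \<A> p i" "f \<in> Arr \<A>" "Dom \<A> f = Cod \<A> i" "f \<cdot> i = Zero \<A> (Dom \<A> i) (Cod \<A> f)"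
  obtains g where "g \<in> Arr \<A>" "Dom \<A> g = Cod \<A> p" "Cod \<A> g = Cod \<A> f" "g \<cdot> p = f"
proof -
  interpret op: additive_category "op_add_cat \<A>" by (rule additive_category_op) unfold_locales
  show ?thesis
    using op.kernel_factor[of p i f] assms that by (auto simp: is_cokernel_def)
qed

lemma cokernel_epi:
  assumes "is_cokernel \<A> p i" "x \<cdot> p = y \<cdot> p" "x \<in> Arr \<A>" "y \<in> Arr \<A>" "Cod \<A> x = Cod \<A> y"
    "Dom \<A> x = Cod \<A> p" "Dom \<A> y = Cod \<A> p"
  shows "x = y"
proof -
  interpret op: additive_category "op_add_cat \<A>" by (rule additive_category_op) unfold_locales
  show ?thesis
    using op.kernel_mono[of p i x y] assms by auto
qed

lemma pullback_typing:
  assumes "is_pullback \<A> p h g p'"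
  shows "p \<in> Arr \<A>" "h \<in> Arr \<A>" "g \<in> Arr \<A>" "p' \<in> Arr \<A>" "Cod \<A> h = Cod \<A> p"
    "Cod \<A> g = Dom \<A> p" "Cod \<A> p' = Dom \<A> h" "Dom \<A> g = Dom \<A> p'" "p \<cdot> g = h \<cdot> p'"
  using assms by (auto simp: is_pullback_def)

lemma pullback_factor:
  assumes "is_pullback \<A> p h g p'" "u \<in> Arr \<A>" "v \<in> Arr \<A>" "Dom \<A> u = Dom \<A> v"
    "Cod \<A> u = Dom \<A> p" "Cod \<A> v = Dom \<A> h" "p \<cdot> u = h \<cdot> v"
  obtains w where "w \<in> Arr \<A>" "Dom \<A> w = Dom \<A> v" "Cod \<A> w = Dom \<A> p'" "g \<cdot> w = u" "p' \<cdot> w = v"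
proof -
  have "\<exists>!w. w \<in> homset \<A> (Dom \<A> v) (Dom \<A> p') \<and> g \<cdot> w = u \<and> p' \<cdot> w = v"
    using assms unfolding is_pullback_def homset_def by auto
  then show ?thesis using that unfolding homset_def by blast
qed

lemma pullback_unique:
  assumes "is_pullback \<A> p h g p'" "x \<in> Arr \<A>" "y \<in> Arr \<A>" "Dom \<A> x = Dom \<A> y"
    "Cod \<A> x = Dom \<A> p'" "Cod \<A> y = Dom \<A> p'" "g \<cdot> x = g \<cdot> y" "p' \<cdot> x = p' \<cdot> y"
  shows "x = y"
proof -
  note t = pullback_typing[OF assms(1)]
  have "p \<cdot> (g \<cdot> y) = h \<cdot> (p' \<cdot> y)"
    using t assms by (subst Comp_reassoc[OF t(9)]) auto
  then have "\<exists>!w. w \<in> homset \<A> (Dom \<A> y) (Dom \<A> p') \<and> g \<cdot> w = g \<cdot> y \<and> p' \<cdot> w = p' \<cdot> y"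
    using assms t unfolding is_pullback_def homset_def by auto
  then show ?thesis using assms unfolding homset_def by blast
qed

end

section \<open>Conflations\<close>

text \<open>
  \<open>ext_mor \<A> \<E> f h \<sigma> \<tau>\<close> expresses that the pushout of \<open>\<sigma>\<close> along \<open>f\<close> is equivalent to the pullback of \<open>\<tau>\<close>
  along \<open>h\<close>; with identities for \<open>f\<close> and \<open>h\<close> it is the equivalence of extensions.
\<close>

definition ext_mor ::
  "('o, 'm, 'z) add_cat_scheme \<Rightarrow> ('m \<times> 'm) set \<Rightarrow> 'm \<Rightarrow> 'm \<Rightarrow> 'm \<times> 'm \<Rightarrow> 'm \<times> 'm \<Rightarrow> bool" where
  "ext_mor \<A> \<E> f h = (\<lambda>(i, p) (i', p'). (i, p) \<in> \<E> \<and> (i', p') \<in> \<E> \<and>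
     f \<in> homset \<A> (Dom \<A> i) (Dom \<A> i') \<and> h \<in> homset \<A> (Cod \<A> p) (Cod \<A> p') \<and>
     (\<exists>b \<in> homset \<A> (Cod \<A> i) (Cod \<A> i'). b \<cdot>\<^bsub>\<A>\<^esub> i = i' \<cdot>\<^bsub>\<A>\<^esub> f \<and> p' \<cdot>\<^bsub>\<A>\<^esub> b = h \<cdot>\<^bsub>\<A>\<^esub> p))"

context exact_category
begin

lemma conflation:
  assumes "(i, p) \<in> \<E>"
  shows "is_kernel \<A> i p" "is_cokernel \<A> p i" "i \<in> Arr \<A>" "p \<in> Arr \<A>" "Cod \<A> i = Dom \<A> p"
    "p \<cdot> i = Zero \<A> (Dom \<A> i) (Cod \<A> p)"
  using E_kernel_cokernel[OF assms] by (auto simp: kernel_cokernel_pair_def is_kernel_def)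

text \<open>Two kernels of \<open>p\<close> differ by an isomorphism \<open>a\<close>, along which
  \<open>\<E>\<close> is closed. That axiom presupposes a kernel-cokernel pair, so it must also be
  checked that \<open>p\<close> is a cokernel of \<open>i\<close>; this is inherited from
  \<open>k\<close> because \<open>k\<close> factors through \<open>i\<close>.\<close>

lemma kernel_of_admissible_epic:
  assumes kp: "(k, p) \<in> \<E>" and ip: "is_kernel \<A> i p"
  shows "(i, p) \<in> \<E>"
proof -
  note k = conflation[OF kp]
  have i: "i \<in> Arr \<A>" "Cod \<A> i = Dom \<A> p" "p \<cdot> i = Zero \<A> (Dom \<A> i) (Cod \<A> p)"
    using ip by (auto simp: is_kernel_def)
  obtain a where a: "a \<in> Arr \<A>" "Dom \<A> a = Dom \<A> k" "Cod \<A> a = Dom \<A> i" "i \<cdot> a = k"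
    using kernel_factor[OF ip, of k] k by auto
  obtain a' where a': "a' \<in> Arr \<A>" "Dom \<A> a' = Dom \<A> i" "Cod \<A> a' = Dom \<A> k" "k \<cdot> a' = i"
    using kernel_factor[OF k(1), of i] i by auto
  have "a \<cdot> a' = Ide \<A> (Dom \<A> i)"
    by (rule kernel_mono[OF ip]) (use a a' i k in \<open>auto simp: Comp_reassoc[OF a(4)]\<close>)
  moreover have "a' \<cdot> a = Ide \<A> (Dom \<A> k)"
    by (rule kernel_mono[OF k(1)]) (use a a' i k in \<open>auto simp: Comp_reassoc[OF a'(4)]\<close>)
  ultimately have iso: "iso_arr \<A> (Dom \<A> k) (Dom \<A> i) a"
    using a a' unfolding iso_arr_def homset_def by blast
  have ide: "iso_arr \<A> X X (Ide \<A> X)" if "X \<in> Obj \<A>" for X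
    using that unfolding iso_arr_def homset_def by auto
  have "is_cokernel \<A> p i"
    unfolding is_cokernel_def
  proof (intro conjI ballI impI)
    fix X f assume X: "X \<in> Obj \<A>" "f \<in> homset \<A> (Cod \<A> i) X" "f \<cdot> i = Zero \<A> (Dom \<A> i) X"
    then have f: "f \<in> Arr \<A>" "Dom \<A> f = Dom \<A> p" "Cod \<A> f = X" using i by (auto simp: homset_def)
    have "f \<cdot> k = Zero \<A> (Dom \<A> k) X"
      using Comp_reassoc[OF X(3), of a] f a i X k by auto
    then have "f \<cdot> k = Zero \<A> (Dom \<A> k) (Cod \<A> f)" using f by simp
    then obtain g where
      g: "g \<in> Arr \<A>" "Dom \<A> g = Cod \<A> p" "Cod \<A> g = Cod \<A> f" "g \<cdot> p = f"
      by (rule cokernel_factor[OF k(2) f(1), rotated]) (use f k in auto)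
    show "\<exists>!g. g \<in> homset \<A> (Cod \<A> p) X \<and> g \<cdot> p = f"
    proof (rule ex1I[of _ g])
      fix g' assume g': "g' \<in> homset \<A> (Cod \<A> p) X \<and> g' \<cdot> p = f"
      show "g' = g" by (rule cokernel_epi[OF k(2)]) (use g g' f in \<open>auto simp: homset_def\<close>)
    qed (use g f in \<open>auto simp: homset_def\<close>)
  qed (use i k in auto)
  then have "kernel_cokernel_pair \<A> (i, p)" using ip by (simp add: kernel_cokernel_pair_def)
  moreover have "iso_pairs \<A> (k, p) (i, p)"
    unfolding iso_pairs_def prod.case
    by (rule exI[of _ a], rule exI[of _ "Ide \<A> (Dom \<A> p)"], rule exI[of _ "Ide \<A> (Cod \<A> p)"])
      (use iso ide a i k in auto)
  ultimately show ?thesis using E_iso_closed kp by blast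
qed

text \<open>The axiom only says that \<open>p'\<close> has some kernel \<open>j\<close> with
  \<open>(j, p')\<close> in \<open>\<E>\<close>. The kernel wanted is the arrow into the pullback
  induced by \<open>i\<close> and zero, since it starts at \<open>Dom i\<close> and lies over
  \<open>i\<close>; \<open>kernel_of_admissible_epic\<close> lets it replace
  \<open>j\<close>.\<close>

lemma pullback_conflation:
  assumes ip: "(i, p) \<in> \<E>" and h: "h \<in> Arr \<A>" "Cod \<A> h = Cod \<A> p"
  obtains g i' p' where "is_pullback \<A> p h g p'" "(i', p') \<in> \<E>" "g \<cdot> i' = i" "Dom \<A> i' = Dom \<A> i"
proof -
  note k = conflation[OF ip]
  have "admissible_epic \<E> p" using ip by (auto simp: admissible_epic_def)
  from pullback_admissible_epic[OF this h] obtain g p' where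
    pb: "is_pullback \<A> p h g p'" and "admissible_epic \<E> p'" by blast
  then obtain j where j: "(j, p') \<in> \<E>" by (auto simp: admissible_epic_def)
  note t = pullback_typing[OF pb]
  obtain i' where i': "i' \<in> Arr \<A>" "Dom \<A> i' = Dom \<A> i" "Cod \<A> i' = Dom \<A> p'" "g \<cdot> i' = i"
    "p' \<cdot> i' = Zero \<A> (Dom \<A> i) (Dom \<A> h)"
    using pullback_factor[OF pb, of i "Zero \<A> (Dom \<A> i) (Dom \<A> h)"] t k by auto
  have "is_kernel \<A> i' p'"
    unfolding is_kernel_def
  proof (intro conjI ballI impI)
    fix X f assume X: "X \<in> Obj \<A>" "f \<in> homset \<A> X (Dom \<A> p')" "p' \<cdot> f = Zero \<A> X (Cod \<A> p')"
    then have f: "f \<in> Arr \<A>" "Dom \<A> f = X" "Cod \<A> f = Dom \<A> p'" by (auto simp: homset_def)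
    have "p \<cdot> (g \<cdot> f) = Zero \<A> X (Cod \<A> p)"
      using f X t by (subst Comp_reassoc[OF t(9)]) auto
    then obtain x where x: "x \<in> Arr \<A>" "Dom \<A> x = X" "Cod \<A> x = Dom \<A> i" "i \<cdot> x = g \<cdot> f"
      using kernel_factor[OF k(1), of "g \<cdot> f"] f t by auto
    show "\<exists>!x. x \<in> homset \<A> X (Dom \<A> i') \<and> i' \<cdot> x = f"
    proof (rule ex1I[of _ x])
      have "i' \<cdot> x = f"
        by (rule pullback_unique[OF pb])
          (use x f t i' k X in \<open>auto simp: Comp_reassoc[OF i'(4)] Comp_reassoc[OF i'(5)]\<close>)
      then show "x \<in> homset \<A> X (Dom \<A> i') \<and> i' \<cdot> x = f" using x i' by (auto simp: homset_def)
    next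
      fix y assume y: "y \<in> homset \<A> X (Dom \<A> i') \<and> i' \<cdot> y = f"
      show "y = x"
      proof (rule kernel_mono[OF k(1)])
        have "i \<cdot> y = g \<cdot> (i' \<cdot> y)" using y i' t by (subst Comp_reassoc[OF i'(4)]) (auto simp: homset_def)
        then show "i \<cdot> y = i \<cdot> x" using x y by simp
      qed (use x y i' in \<open>auto simp: homset_def\<close>)
    qed
  qed (use i' t in auto)
  with kernel_of_admissible_epic[OF j] have "(i', p') \<in> \<E>" by blast
  with that pb i' show ?thesis by blast
qed

text \<open>The universal property supplies the middle arrow \<open>w\<close> but says nothing about
  kernels. Their square is tested after both projections of the pullback: \<open>g\<close> reduces
  it to the hypothesis on \<open>c\<close>, and \<open>p'\<close> sends both sides to zero.\<close>

lemma factor_through_pullback: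
  assumes pb: "is_pullback \<A> p h g p'" and E: "(i', p') \<in> \<E>" "(j, q) \<in> \<E>"
    and f: "f \<in> Arr \<A>" "Dom \<A> f = Dom \<A> j" "Cod \<A> f = Dom \<A> i'"
    and c: "c \<in> Arr \<A>" "Dom \<A> c = Dom \<A> q" "Cod \<A> c = Dom \<A> p"
    and h': "h' \<in> Arr \<A>" "Dom \<A> h' = Cod \<A> q" "Cod \<A> h' = Dom \<A> h"
    and eq: "c \<cdot> j = (g \<cdot> i') \<cdot> f" "p \<cdot> c = (h \<cdot> h') \<cdot> q"
  obtains w where "w \<in> Arr \<A>" "Dom \<A> w = Dom \<A> q" "Cod \<A> w = Dom \<A> p'" "g \<cdot> w = c"
    "p' \<cdot> w = h' \<cdot> q" "w \<cdot> j = i' \<cdot> f"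
proof -
  note k' = conflation[OF E(1)] and kj = conflation[OF E(2)]
  note t = pullback_typing[OF pb]
  obtain w where w: "w \<in> Arr \<A>" "Dom \<A> w = Dom \<A> q" "Cod \<A> w = Dom \<A> p'" "g \<cdot> w = c" "p' \<cdot> w = h' \<cdot> q"
    using pullback_factor[OF pb c(1), of "h' \<cdot> q"] c h' eq t kj by auto
  have "w \<cdot> j = i' \<cdot> f"
  proof (rule pullback_unique[OF pb])
    show "g \<cdot> (w \<cdot> j) = g \<cdot> (i' \<cdot> f)"
      using w f kj k' t eq by (subst Comp_reassoc[OF w(4)]) auto
    show "p' \<cdot> (w \<cdot> j) = p' \<cdot> (i' \<cdot> f)"
      using w f kj k' t h' by (simp add: Comp_reassoc[OF w(5)] Comp_reassoc[OF k'(6)])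
  qed (use w f kj k' t in auto)
  with that w show ?thesis by blast
qed

text \<open>
  The pullback of \<open>p\<close> along \<open>p'\<close> is split over \<open>Dom p\<close> by \<open>b\<close>, hence a biproduct of \<open>Dom i'\<close> and
  \<open>Dom p\<close>, while its other projection is a cokernel of a map from \<open>Dom i\<close>. This one diagram yields
  the short five lemma (where \<open>f\<close> is an identity) and the closure of additive pairs under pushout.
\<close>

lemma morphism_over_identity:
  assumes E: "(i, p) \<in> \<E>" "(i', p') \<in> \<E>" "Cod \<A> p' = Cod \<A> p"
    and f: "f \<in> Arr \<A>" "Dom \<A> f = Dom \<A> i" "Cod \<A> f = Dom \<A> i'"
    and b: "b \<in> Arr \<A>" "Dom \<A> b = Dom \<A> p" "Cod \<A> b = Dom \<A> p'"
    and eq: "b \<cdot> i = i' \<cdot> f" "p' \<cdot> b = p"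
  obtains j q l s r t where
    "is_biproduct \<A> [Dom \<A> i', Dom \<A> p] (Dom \<A> q)
       (\<lambda>n. if n = 0 then l else s) (\<lambda>n. if n = 0 then r else t)"
    "(j, q) \<in> \<E>" "Dom \<A> j = Dom \<A> i" "Cod \<A> q = Dom \<A> p'"
    "q \<cdot> l = i'" "q \<cdot> s = b" "t \<cdot> j = i" "r \<cdot> j \<boxplus> f = Zero \<A> (Dom \<A> i) (Dom \<A> i')"
proof -
  note k = conflation[OF E(1)] and k' = conflation[OF E(2)]
  obtain t j q where pb: "is_pullback \<A> p p' t q" and jq: "(j, q) \<in> \<E>"
    and tj: "t \<cdot> j = i" and domj: "Dom \<A> j = Dom \<A> i"
    using pullback_conflation[OF E(1), of p'] k' E(3) by metis
  note ty = pullback_typing[OF pb]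
  note kj = conflation[OF jq]
  have qj: "q \<cdot> j = Zero \<A> (Dom \<A> i) (Dom \<A> p')" using kj ty domj by simp
  \<comment> \<open>In coordinates of the pullback of \<open>p\<close> and \<open>p'\<close>, the
    section \<open>s\<close> is \<open>(1, b)\<close> and the inclusion \<open>l\<close> is
    \<open>(0, i')\<close>.\<close>
  obtain s where s: "s \<in> Arr \<A>" "Dom \<A> s = Dom \<A> p" "Cod \<A> s = Dom \<A> q"
    "t \<cdot> s = Ide \<A> (Dom \<A> p)" "q \<cdot> s = b"
    using pullback_factor[OF pb, of "Ide \<A> (Dom \<A> p)" b] b eq k by auto
  obtain l where l: "l \<in> Arr \<A>" "Dom \<A> l = Dom \<A> i'" "Cod \<A> l = Dom \<A> q"
    "t \<cdot> l = Zero \<A> (Dom \<A> i') (Dom \<A> p)" "q \<cdot> l = i'"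
    using pullback_factor[OF pb, of "Zero \<A> (Dom \<A> i') (Dom \<A> p)" i'] k k' E(3) by auto
  have pb': "p' \<cdot> (b \<cdot> t) = p \<cdot> t" using b ty k' by (subst Comp_reassoc[OF eq(2)]) auto
  \<comment> \<open>The difference \<open>q - b \<cdot> t\<close> is killed by \<open>p'\<close> and
    so factors through its kernel \<open>i'\<close>; the factor \<open>r\<close> is the coordinate
    in \<open>Dom i'\<close>. On \<open>j\<close> it gives \<open>-f\<close>, because
    \<open>q \<cdot> j = 0\<close> and
    \<open>b \<cdot> t \<cdot> j = b \<cdot> i = i' \<cdot> f\<close>.\<close>
  obtain r where r: "r \<in> Arr \<A>" "Dom \<A> r = Dom \<A> q" "Cod \<A> r = Dom \<A> i'"
    "i' \<cdot> r = q \<boxplus> neg (b \<cdot> t)"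
    by (rule kernel_factor[OF k'(1), of "q \<boxplus> neg (b \<cdot> t)"]) (use ty b k' E(3) pb' in auto)
  have r': "i' \<cdot> r \<boxplus> b \<cdot> t = q"
    using r ty b k' by (simp add: Add_assoc)
  have m: "x = y" if "i' \<cdot> x = i' \<cdot> y" "x \<in> Arr \<A>" "y \<in> Arr \<A>" "Dom \<A> x = Dom \<A> y"
    "Cod \<A> x = Dom \<A> i'" "Cod \<A> y = Dom \<A> i'" for x y
    using kernel_mono[OF k'(1)] that by blast
  have rl: "r \<cdot> l = Ide \<A> (Dom \<A> i')"
    by (rule m) (use r l ty b k' k in \<open>auto simp: Comp_reassoc[OF r(4)]\<close>)
  have rs: "r \<cdot> s = Zero \<A> (Dom \<A> p) (Dom \<A> i')"
    by (rule m) (use r s ty b k' k in \<open>auto simp: Comp_reassoc[OF r(4)]\<close>)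
  have rj: "r \<cdot> j \<boxplus> f = Zero \<A> (Dom \<A> i) (Dom \<A> i')"
    by (rule m) (use r tj domj qj kj ty b k' k f eq(1)[symmetric] in \<open>auto simp: Comp_reassoc[OF r(4)] Add_assoc\<close>)
  have sum: "l \<cdot> r \<boxplus> s \<cdot> t = Ide \<A> (Dom \<A> q)"
    by (rule pullback_unique[OF pb])
      (use r r' l s ty b k' k in \<open>auto simp: Comp_reassoc[OF l(4)] Comp_reassoc[OF s(4)] Comp_reassoc[OF l(5)] Comp_reassoc[OF s(5)]\<close>)
  have "is_biproduct \<A> [Dom \<A> i', Dom \<A> p] (Dom \<A> q)
       (\<lambda>n. if n = 0 then l else s) (\<lambda>n. if n = 0 then r else t)"
    unfolding is_biproduct_pair_iff using r l s ty rl rs sum k k' by (auto simp: homset_def)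
  then show ?thesis
    by (rule that) (use jq domj ty l s tj rj in auto)
qed

text \<open>For \<open>f\<close> the identity, \<open>r \<cdot> j = -1\<close> and
  \<open>t \<cdot> j = i\<close>, so \<open>i \<cdot> r \<boxplus> t\<close> vanishes on
  \<open>j\<close> and factors through the cokernel \<open>q\<close>. The factor \<open>c\<close> is
  the inverse: \<open>c \<cdot> b\<close> is computed by restricting to \<open>s\<close>, and
  \<open>b \<cdot> c\<close> by cancelling the epic \<open>q\<close>.\<close>

lemma short_five:
  assumes E: "(i, p) \<in> \<E>" "(i', p') \<in> \<E>"
    and b: "b \<in> Arr \<A>" "Dom \<A> b = Dom \<A> p" "Cod \<A> b = Dom \<A> p'"
    and eq: "b \<cdot> i = i'" "p' \<cdot> b = p"
  obtains c where "c \<in> Arr \<A>" "Dom \<A> c = Dom \<A> p'" "Cod \<A> c = Dom \<A> p"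
    "c \<cdot> b = Ide \<A> (Dom \<A> p)" "b \<cdot> c = Ide \<A> (Dom \<A> p')"
proof -
  note k = conflation[OF E(1)] and k' = conflation[OF E(2)]
  have "Dom \<A> (b \<cdot> i) = Dom \<A> i" "Cod \<A> (p' \<cdot> b) = Cod \<A> p'"
    using k k' b by auto
  then have doms: "Dom \<A> i' = Dom \<A> i" "Cod \<A> p' = Cod \<A> p"
    using eq by auto
  obtain j q l s r t where
    bi: "is_biproduct \<A> [Dom \<A> i', Dom \<A> p] (Dom \<A> q)
       (\<lambda>n. if n = 0 then l else s) (\<lambda>n. if n = 0 then r else t)" and
    jq: "(j, q) \<in> \<E>" and j: "Dom \<A> j = Dom \<A> i" "Cod \<A> q = Dom \<A> p'"
    "q \<cdot> l = i'" "q \<cdot> s = b" "t \<cdot> j = i" "r \<cdot> j \<boxplus> Ide \<A> (Dom \<A> i) = Zero \<A> (Dom \<A> i) (Dom \<A> i')"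
    by (rule morphism_over_identity[OF E, of "Ide \<A> (Dom \<A> i)" b]) (use k k' b eq doms in auto)
  note kj = conflation[OF jq]
  have bi': "l \<in> homset \<A> (Dom \<A> i) (Dom \<A> q)" "s \<in> homset \<A> (Dom \<A> p) (Dom \<A> q)"
    "r \<in> homset \<A> (Dom \<A> q) (Dom \<A> i)" "t \<in> homset \<A> (Dom \<A> q) (Dom \<A> p)"
    "r \<cdot> l = Ide \<A> (Dom \<A> i)" "t \<cdot> s = Ide \<A> (Dom \<A> p)" "r \<cdot> s = Zero \<A> (Dom \<A> p) (Dom \<A> i)"
    "t \<cdot> l = Zero \<A> (Dom \<A> i) (Dom \<A> p)" "l \<cdot> r \<boxplus> s \<cdot> t = Ide \<A> (Dom \<A> q)"
    using bi doms unfolding is_biproduct_pair_iff by auto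
  note ty = bi'(1-4)[unfolded homset_iff]
  let ?t = "i \<cdot> r \<boxplus> t"
  have "i \<cdot> (r \<cdot> j \<boxplus> Ide \<A> (Dom \<A> i)) = Zero \<A> (Dom \<A> i) (Dom \<A> p)"
    using j k doms by simp
  moreover have "i \<cdot> (r \<cdot> j \<boxplus> Ide \<A> (Dom \<A> i)) = i \<cdot> (r \<cdot> j) \<boxplus> i"
    using j(1-5) k kj ty doms by simp
  ultimately have "?t \<cdot> j = Zero \<A> (Dom \<A> i) (Dom \<A> p)"
    using j k kj ty doms by simp
  then obtain c where c: "c \<in> Arr \<A>" "Dom \<A> c = Cod \<A> q" "Cod \<A> c = Dom \<A> p" "c \<cdot> q = ?t"
    using cokernel_factor[OF kj(2), of ?t] j k kj ty doms by auto
  have "c \<cdot> b = (c \<cdot> q) \<cdot> s" unfolding j(4)[symmetric] using c(1-3) kj ty j(1,2) by simp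
  also have "\<dots> = Ide \<A> (Dom \<A> p)" using c(4) ty k kj j bi' by simp
  finally have cb: "c \<cdot> b = Ide \<A> (Dom \<A> p)" .
  have bi2: "b \<cdot> i = q \<cdot> l" using eq j by simp
  have "b \<cdot> (c \<cdot> q) = q \<cdot> (l \<cdot> r \<boxplus> s \<cdot> t)"
    using c ty b k kj j by (simp add: Comp_reassoc[OF eq(1)] Comp_reassoc[OF j(3)] Comp_reassoc[OF j(4)])
  then have "(b \<cdot> c) \<cdot> q = Ide \<A> (Dom \<A> p') \<cdot> q" using c ty b k kj j bi' by simp
  then have "b \<cdot> c = Ide \<A> (Dom \<A> p')"
    by (rule cokernel_epi[OF kj(2)]) (use b c kj j(1,2) k' in auto)
  with that[of c] c cb j show ?thesis by auto
qed

text \<open>The comparison \<open>w\<close> with the pullback conflation is the identity on kernels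
  and on cokernels, hence invertible by the short five lemma, and the universal property is carried
  along its inverse \<open>c\<close>.\<close>

lemma morphism_is_pullback:
  assumes E: "(i, p) \<in> \<E>" "(i', p') \<in> \<E>"
    and b: "b \<in> Arr \<A>" "Dom \<A> b = Dom \<A> p'" "Cod \<A> b = Dom \<A> p"
    and h: "h \<in> Arr \<A>" "Dom \<A> h = Cod \<A> p'" "Cod \<A> h = Cod \<A> p"
    and eq: "b \<cdot> i' = i" "p \<cdot> b = h \<cdot> p'"
  shows "is_pullback \<A> p h b p'"
proof -
  note k = conflation[OF E(1)] and k' = conflation[OF E(2)]
  obtain g j q where pb: "is_pullback \<A> p h g q" and jq: "(j, q) \<in> \<E>"
    and gj: "g \<cdot> j = i" and domj: "Dom \<A> j = Dom \<A> i"
    using pullback_conflation[OF E(1) h(1,3)] by metis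
  note ty = pullback_typing[OF pb] and kj = conflation[OF jq]
  have "Dom \<A> (b \<cdot> i') = Dom \<A> i'" using k' b by auto
  then have domi: "Dom \<A> i' = Dom \<A> i" using eq by simp
  obtain w where w: "w \<in> Arr \<A>" "Dom \<A> w = Dom \<A> p'" "Cod \<A> w = Dom \<A> q" "g \<cdot> w = b"
    "q \<cdot> w = Ide \<A> (Cod \<A> p') \<cdot> p'" "w \<cdot> i' = j \<cdot> Ide \<A> (Dom \<A> i)"
    by (rule factor_through_pullback[OF pb jq E(2), of "Ide \<A> (Dom \<A> i)" b "Ide \<A> (Cod \<A> p')"])
      (use k k' b h eq domi domj gj ty in auto)
  obtain c where c: "c \<in> Arr \<A>" "Dom \<A> c = Dom \<A> q" "Cod \<A> c = Dom \<A> p'"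
    "c \<cdot> w = Ide \<A> (Dom \<A> p')" "w \<cdot> c = Ide \<A> (Dom \<A> q)"
    by (rule short_five[OF E(2) jq, of w]) (use w k' kj domj in auto)
  have w5: "q \<cdot> w = p'" using w k' by simp
  show ?thesis
    unfolding is_pullback_def
  proof (intro conjI ballI impI)
    fix X u v
    assume "X \<in> Obj \<A>" "u \<in> homset \<A> X (Dom \<A> p)" "v \<in> homset \<A> X (Dom \<A> h)" and e: "p \<cdot> u = h \<cdot> v"
    then have uv: "u \<in> Arr \<A>" "Dom \<A> u = X" "Cod \<A> u = Dom \<A> p"
      "v \<in> Arr \<A>" "Dom \<A> v = X" "Cod \<A> v = Dom \<A> h" by (auto simp: homset_def)
    obtain y where y: "y \<in> Arr \<A>" "Dom \<A> y = X" "Cod \<A> y = Dom \<A> q" "g \<cdot> y = u" "q \<cdot> y = v"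
      using pullback_factor[OF pb, of u v] uv e by auto
    have bc: "b \<cdot> c = g" unfolding w(4)[symmetric] using w(1-3) c ty by simp
    have pc: "p' \<cdot> c = q" unfolding w5[symmetric] using w(1-3) c ty by simp
    show "\<exists>!w. w \<in> homset \<A> X (Dom \<A> p') \<and> b \<cdot> w = u \<and> p' \<cdot> w = v"
    proof (rule ex1I[of _ "c \<cdot> y"])
      show "c \<cdot> y \<in> homset \<A> X (Dom \<A> p') \<and> b \<cdot> (c \<cdot> y) = u \<and> p' \<cdot> (c \<cdot> y) = v"
        using c y b k' by (simp add: homset_def Comp_reassoc[OF bc] Comp_reassoc[OF pc])
    next
      fix x assume "x \<in> homset \<A> X (Dom \<A> p') \<and> b \<cdot> x = u \<and> p' \<cdot> x = v"
      then have x: "x \<in> Arr \<A>" "Dom \<A> x = X" "Cod \<A> x = Dom \<A> p'" "b \<cdot> x = u" "p' \<cdot> x = v"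
        by (auto simp: homset_def)
      have "w \<cdot> x = y"
        by (rule pullback_unique[OF pb])
          (use x y w w5 ty in \<open>auto simp: Comp_reassoc[OF w(4)] Comp_reassoc[OF w5]\<close>)
      then show "x = c \<cdot> y" using Comp_reassoc[OF c(4), of x] x w c by auto
    qed
  qed (use k k' b h eq in auto)
qed

section \<open>Calculus of morphisms of conflations\<close>

lemma ext_morI:
  assumes "(i, p) \<in> \<E>" "(i', p') \<in> \<E>"
    and "f \<in> Arr \<A>" "Dom \<A> f = Dom \<A> i" "Cod \<A> f = Dom \<A> i'"
    and "b \<in> Arr \<A>" "Dom \<A> b = Dom \<A> p" "Cod \<A> b = Dom \<A> p'"
    and "h \<in> Arr \<A>" "Dom \<A> h = Cod \<A> p" "Cod \<A> h = Cod \<A> p'"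
    and "b \<cdot> i = i' \<cdot> f" "p' \<cdot> b = h \<cdot> p"
  shows "ext_mor \<A> \<E> f h (i, p) (i', p')"
  using assms conflation[OF assms(1)] conflation[OF assms(2)]
  unfolding ext_mor_def homset_def by auto

lemma ext_morE:
  assumes "ext_mor \<A> \<E> f h (i, p) (i', p')"
  obtains b where "(i, p) \<in> \<E>" "(i', p') \<in> \<E>"
    "f \<in> Arr \<A>" "Dom \<A> f = Dom \<A> i" "Cod \<A> f = Dom \<A> i'"
    "b \<in> Arr \<A>" "Dom \<A> b = Dom \<A> p" "Cod \<A> b = Dom \<A> p'"
    "h \<in> Arr \<A>" "Dom \<A> h = Cod \<A> p" "Cod \<A> h = Cod \<A> p'"
    "b \<cdot> i = i' \<cdot> f" "p' \<cdot> b = h \<cdot> p"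
proof -
  have "(i, p) \<in> \<E>" "(i', p') \<in> \<E>" using assms by (auto simp: ext_mor_def)
  note k = conflation[OF this(1)] conflation[OF this(2)]
  from assms show ?thesis using that k(5,11) unfolding ext_mor_def homset_def by auto
qed

lemma ext_pairs_iff: "(i, p) \<in> ext_pairs \<A> \<E> C A \<longleftrightarrow> (i, p) \<in> \<E> \<and> Dom \<A> i = A \<and> Cod \<A> p = C"
  by (simp add: ext_pairs_def)

lemma ext_pairs_Obj:
  assumes "\<sigma> \<in> ext_pairs \<A> \<E> C A"
  shows "C \<in> Obj \<A>" "A \<in> Obj \<A>"
  using assms conflation[of "fst \<sigma>" "snd \<sigma>"] by (auto simp: ext_pairs_def)

lemma ext_mor_typing:
  assumes "ext_mor \<A> \<E> f h \<sigma> \<tau>"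
  shows "f \<in> Arr \<A>" "h \<in> Arr \<A>" "\<sigma> \<in> ext_pairs \<A> \<E> (Dom \<A> h) (Dom \<A> f)"
    "\<tau> \<in> ext_pairs \<A> \<E> (Cod \<A> h) (Cod \<A> f)"
  using assms by (auto simp: ext_mor_def ext_pairs_def homset_def split: prod.splits)

text \<open>Reversing arrows exchanges source with target and the kernel end with the cokernel end,
  hence also \<open>f\<close> with \<open>h\<close>.\<close>

lemma ext_mor_op:
  "ext_mor (op_add_cat \<A>) (\<E>\<inverse>) h f \<tau> \<sigma> \<longleftrightarrow> ext_mor \<A> \<E> f h (prod.swap \<sigma>) (prod.swap \<tau>)"
proof -
  obtain i p i' p' where [simp]: "\<sigma> = (p, i)" "\<tau> = (p', i')" by (cases \<sigma>, cases \<tau>) auto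
  show ?thesis
    using conflation(5)[of i p] conflation(5)[of i' p'] unfolding ext_mor_def by auto
qed

lemma ext_pairs_op: "\<sigma> \<in> ext_pairs (op_add_cat \<A>) (\<E>\<inverse>) A C \<longleftrightarrow> prod.swap \<sigma> \<in> ext_pairs \<A> \<E> C A"
  by (cases \<sigma>) (auto simp: ext_pairs_def)

lemma ext_mor_Ide:
  assumes "\<sigma> \<in> ext_pairs \<A> \<E> C A"
  shows "ext_mor \<A> \<E> (Ide \<A> A) (Ide \<A> C) \<sigma> \<sigma>"
proof -
  obtain i p where s: "\<sigma> = (i, p)" by (cases \<sigma>)
  with assms have ip: "(i, p) \<in> \<E>" "Dom \<A> i = A" "Cod \<A> p = C" by (auto simp: ext_pairs_iff)
  note k = conflation[OF ip(1)]
  show ?thesis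
    unfolding s by (rule ext_morI[where b = "Ide \<A> (Dom \<A> p)"]) (use ip k ext_pairs_Obj[OF assms] in simp_all)
qed

lemma ext_mor_Comp:
  assumes "ext_mor \<A> \<E> f h \<sigma> \<tau>" "ext_mor \<A> \<E> f' h' \<tau> \<rho>"
  shows "ext_mor \<A> \<E> (f' \<cdot> f) (h' \<cdot> h) \<sigma> \<rho>"
proof -
  obtain i p i' p' i'' p'' where s: "\<sigma> = (i, p)" "\<tau> = (i', p')" "\<rho> = (i'', p'')"
    by (cases \<sigma>, cases \<tau>, cases \<rho>) auto
  obtain b where b: "(i, p) \<in> \<E>" "(i', p') \<in> \<E>"
    "f \<in> Arr \<A>" "Dom \<A> f = Dom \<A> i" "Cod \<A> f = Dom \<A> i'"
    "b \<in> Arr \<A>" "Dom \<A> b = Dom \<A> p" "Cod \<A> b = Dom \<A> p'"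
    "h \<in> Arr \<A>" "Dom \<A> h = Cod \<A> p" "Cod \<A> h = Cod \<A> p'"
    "b \<cdot> i = i' \<cdot> f" "p' \<cdot> b = h \<cdot> p" using assms(1) unfolding s by (rule ext_morE)
  obtain b' where b': "(i', p') \<in> \<E>" "(i'', p'') \<in> \<E>"
    "f' \<in> Arr \<A>" "Dom \<A> f' = Dom \<A> i'" "Cod \<A> f' = Dom \<A> i''"
    "b' \<in> Arr \<A>" "Dom \<A> b' = Dom \<A> p'" "Cod \<A> b' = Dom \<A> p''"
    "h' \<in> Arr \<A>" "Dom \<A> h' = Cod \<A> p'" "Cod \<A> h' = Cod \<A> p''"
    "b' \<cdot> i' = i'' \<cdot> f'" "p'' \<cdot> b' = h' \<cdot> p'" using assms(2) unfolding s by (rule ext_morE)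
  note k = conflation[OF b(1)] conflation[OF b(2)] conflation[OF b'(2)]
  show ?thesis
    unfolding s by (rule ext_morI[where b = "b' \<cdot> b"])
      (use b b' k in \<open>simp_all add: Comp_reassoc[OF b'(12)] Comp_reassoc[OF b'(13)]\<close>)
qed

text \<open>The short five lemma inverts the middle arrow. This is what makes the equivalence of
  extensions, given by an arrow in one direction only, symmetric.\<close>

lemma ext_mor_sym:
  assumes "ext_mor \<A> \<E> (Ide \<A> A) (Ide \<A> C) \<sigma> \<tau>" "A \<in> Obj \<A>" "C \<in> Obj \<A>"
  shows "ext_mor \<A> \<E> (Ide \<A> A) (Ide \<A> C) \<tau> \<sigma>"
proof -
  obtain i p i' p' where s: "\<sigma> = (i, p)" "\<tau> = (i', p')" by (cases \<sigma>, cases \<tau>) auto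
  obtain b where b: "(i, p) \<in> \<E>" "(i', p') \<in> \<E>" "Dom \<A> i = A" "Dom \<A> i' = A" "Cod \<A> p = C" "Cod \<A> p' = C"
    "b \<in> Arr \<A>" "Dom \<A> b = Dom \<A> p" "Cod \<A> b = Dom \<A> p'"
    "b \<cdot> i = i' \<cdot> Ide \<A> A" "p' \<cdot> b = Ide \<A> C \<cdot> p"
    using ext_morE[OF assms(1)[unfolded s]] assms(2,3) by (metis Ide_typing(2,3))
  note k = conflation[OF b(1)] and k' = conflation[OF b(2)]
  have e: "b \<cdot> i = i'" "p' \<cdot> b = p" using b k k' by auto
  obtain c where c: "c \<in> Arr \<A>" "Dom \<A> c = Dom \<A> p'" "Cod \<A> c = Dom \<A> p"
    "c \<cdot> b = Ide \<A> (Dom \<A> p)" "b \<cdot> c = Ide \<A> (Dom \<A> p')"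
    using short_five[OF b(1,2) b(7-9) e] .
  have "c \<cdot> i' = i" using Comp_reassoc[OF c(4), of i] b(7-9) c k e(1) by simp
  moreover have "p \<cdot> c = p'" using Comp_assoc_simp[of c b p'] b(7-9) c k' e(2) by simp
  ultimately show ?thesis
    unfolding s by (intro ext_morI[where b = c]) (use b(1-9) c k k' assms in simp_all)
qed

lemma ext_mor_pullback_ex:
  assumes "\<tau> \<in> ext_pairs \<A> \<E> C A" "h \<in> Arr \<A>" "Cod \<A> h = C"
  obtains \<sigma> where "ext_mor \<A> \<E> (Ide \<A> A) h \<sigma> \<tau>"
proof -
  obtain i p where s: "\<tau> = (i, p)" by (cases \<tau>)
  with assms have ip: "(i, p) \<in> \<E>" "Dom \<A> i = A" "Cod \<A> p = C" by (auto simp: ext_pairs_iff)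
  note k = conflation[OF ip(1)]
  obtain g i' p' where pb: "is_pullback \<A> p h g p'" and E: "(i', p') \<in> \<E>" "g \<cdot> i' = i" "Dom \<A> i' = Dom \<A> i"
    by (rule pullback_conflation[OF ip(1), of h]) (use assms ip in auto)
  note k' = conflation[OF E(1)] and ty = pullback_typing[OF pb]
  have "ext_mor \<A> \<E> (Ide \<A> A) h (i', p') \<tau>"
    unfolding s by (rule ext_morI[where b = g]) (use ip k E k' ty ext_pairs_Obj[OF assms(1)] in simp_all)
  then show ?thesis by (rule that)
qed

text \<open>By \<open>morphism_is_pullback\<close> the square over \<open>h\<close> is a pullback,
  so the middle arrow factors. In other words \<open>\<sigma>\<close> is cartesian over
  \<open>h\<close>; this cancellation rule does the work of the uniqueness of pullbacks up to
  equivalence.\<close>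

lemma ext_mor_through_pullback:
  assumes "ext_mor \<A> \<E> (Ide \<A> A) h \<sigma> \<tau>" "ext_mor \<A> \<E> f (h \<cdot> h') \<rho> \<tau>"
    and h': "h' \<in> Arr \<A>" "Cod \<A> h' = Dom \<A> h" and A: "A \<in> Obj \<A>"
  shows "ext_mor \<A> \<E> f h' \<rho> \<sigma>"
proof -
  obtain i p i' p' j q where s: "\<sigma> = (i', p')" "\<tau> = (i, p)" "\<rho> = (j, q)"
    by (cases \<sigma>, cases \<tau>, cases \<rho>) auto
  obtain g where g: "(i', p') \<in> \<E>" "(i, p) \<in> \<E>"
    "Ide \<A> A \<in> Arr \<A>" "Dom \<A> (Ide \<A> A) = Dom \<A> i'" "Cod \<A> (Ide \<A> A) = Dom \<A> i"
    "g \<in> Arr \<A>" "Dom \<A> g = Dom \<A> p'" "Cod \<A> g = Dom \<A> p"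
    "h \<in> Arr \<A>" "Dom \<A> h = Cod \<A> p'" "Cod \<A> h = Cod \<A> p"
    "g \<cdot> i' = i \<cdot> Ide \<A> A" "p \<cdot> g = h \<cdot> p'" using assms(1) unfolding s by (rule ext_morE)
  obtain c where c: "(j, q) \<in> \<E>" "(i, p) \<in> \<E>"
    "f \<in> Arr \<A>" "Dom \<A> f = Dom \<A> j" "Cod \<A> f = Dom \<A> i"
    "c \<in> Arr \<A>" "Dom \<A> c = Dom \<A> q" "Cod \<A> c = Dom \<A> p"
    "h \<cdot> h' \<in> Arr \<A>" "Dom \<A> (h \<cdot> h') = Cod \<A> q" "Cod \<A> (h \<cdot> h') = Cod \<A> p"
    "c \<cdot> j = i \<cdot> f" "p \<cdot> c = (h \<cdot> h') \<cdot> q" using assms(2) unfolding s by (rule ext_morE)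
  note k = conflation[OF g(1)] and k' = conflation[OF g(2)] and k'' = conflation[OF c(1)]
  have a: "Dom \<A> i = A" "Dom \<A> i' = A" using A g by auto
  have gi: "g \<cdot> i' = i" using g a k' by auto
  have dh: "Dom \<A> h' = Cod \<A> q" using c h' g by auto
  have pb: "is_pullback \<A> p h g p'"
    by (rule morphism_is_pullback[OF g(2,1)]) (use g gi in auto)
  obtain w where w: "w \<in> Arr \<A>" "Dom \<A> w = Dom \<A> q" "Cod \<A> w = Dom \<A> p'" "g \<cdot> w = c"
    "p' \<cdot> w = h' \<cdot> q" "w \<cdot> j = i' \<cdot> f"
    by (rule factor_through_pullback[OF pb g(1) c(1), of f c h']) (use g c h' a gi dh in auto)
  show ?thesis
    unfolding s by (rule ext_morI[where b = w]) (use g(1,10) c(1-5) w a h' dh in simp_all)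
qed

text \<open>Only the direction from right to left has content: for a morphism that is the identity
  on kernels the universal property is automatic.\<close>

lemma pullback_pair_iff:
  assumes "\<tau> \<in> ext_pairs \<A> \<E> C A"
  shows "pullback_pair \<A> \<E> h \<tau> \<sigma> \<longleftrightarrow> ext_mor \<A> \<E> (Ide \<A> A) h \<sigma> \<tau>"
proof -
  obtain i p i' p' where s: "\<tau> = (i, p)" "\<sigma> = (i', p')" by (cases \<sigma>, cases \<tau>) auto
  with assms have ip: "(i, p) \<in> \<E>" "Dom \<A> i = A" "Cod \<A> p = C" by (auto simp: ext_pairs_iff)
  note k = conflation[OF ip(1)]
  have A: "A \<in> Obj \<A>" using ip k by auto
  show ?thesis
  proof
    assume "pullback_pair \<A> \<E> h \<tau> \<sigma>"
    then obtain g where g: "(i', p') \<in> \<E>" "is_pullback \<A> p h g p'" "g \<cdot> i' = i"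
      by (auto simp: s pullback_pair_def)
    note k' = conflation[OF g(1)] and ty = pullback_typing[OF g(2)]
    have "Dom \<A> (g \<cdot> i') = Dom \<A> i'" using k' ty by auto
    then have "Dom \<A> i' = A" using g ip by simp
    then show "ext_mor \<A> \<E> (Ide \<A> A) h \<sigma> \<tau>"
      unfolding s by (intro ext_morI[where b = g]) (use ip k g k' ty A in simp_all)
  next
    assume "ext_mor \<A> \<E> (Ide \<A> A) h \<sigma> \<tau>"
    then obtain g where g: "(i', p') \<in> \<E>" "(i, p) \<in> \<E>"
      "g \<in> Arr \<A>" "Dom \<A> g = Dom \<A> p'" "Cod \<A> g = Dom \<A> p"
      "h \<in> Arr \<A>" "Dom \<A> h = Cod \<A> p'" "Cod \<A> h = Cod \<A> p"
      "g \<cdot> i' = i \<cdot> Ide \<A> A" "p \<cdot> g = h \<cdot> p'" unfolding s by (rule ext_morE)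
    have gi: "g \<cdot> i' = i" using g ip k by auto
    have "is_pullback \<A> p h g p'"
      by (rule morphism_is_pullback[OF g(2,1)]) (use g gi in auto)
    then show "pullback_pair \<A> \<E> h \<tau> \<sigma>" using g gi by (auto simp: s pullback_pair_def)
  qed
qed

lemma ext_mor_pushout_ex:
  assumes "\<sigma> \<in> ext_pairs \<A> \<E> C A" "f \<in> Arr \<A>" "Dom \<A> f = A"
  obtains \<tau> where "ext_mor \<A> \<E> f (Ide \<A> C) \<sigma> \<tau>"
proof -
  interpret op: exact_category "op_add_cat \<A>" "\<E>\<inverse>"
    by (rule exact_category_op) unfold_locales
  obtain \<tau> where "ext_mor (op_add_cat \<A>) (\<E>\<inverse>) (Ide \<A> C) f \<tau> (prod.swap \<sigma>)"
    using op.ext_mor_pullback_ex[of "prod.swap \<sigma>" A C f] assms by (auto simp: ext_pairs_op)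
  then show ?thesis using that by (auto simp: ext_mor_op)
qed

text \<open>Opposite of \<open>ext_mor_through_pullback\<close>: pushouts of extensions are
  cocartesian.\<close>

lemma ext_mor_through_pushout:
  assumes "ext_mor \<A> \<E> f (Ide \<A> C) \<sigma> \<tau>" "ext_mor \<A> \<E> (f' \<cdot> f) h \<sigma> \<rho>"
    and "f' \<in> Arr \<A>" "Dom \<A> f' = Cod \<A> f" and "C \<in> Obj \<A>"
  shows "ext_mor \<A> \<E> f' h \<tau> \<rho>"
proof -
  interpret op: exact_category "op_add_cat \<A>" "\<E>\<inverse>"
    by (rule exact_category_op) unfold_locales
  show ?thesis
    using op.ext_mor_through_pullback[of C f "prod.swap \<tau>" "prod.swap \<sigma>" h f' "prod.swap \<rho>"] assms
    by (simp add: ext_mor_op)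
qed

lemma pushout_pair_iff:
  assumes "\<sigma> \<in> ext_pairs \<A> \<E> C A"
  shows "pushout_pair \<A> \<E> f \<sigma> \<tau> \<longleftrightarrow> ext_mor \<A> \<E> f (Ide \<A> C) \<sigma> \<tau>"
proof -
  interpret op: exact_category "op_add_cat \<A>" "\<E>\<inverse>"
    by (rule exact_category_op) unfold_locales
  have "pushout_pair \<A> \<E> f \<sigma> \<tau> \<longleftrightarrow> pullback_pair (op_add_cat \<A>) (\<E>\<inverse>) f (prod.swap \<sigma>) (prod.swap \<tau>)"
    by (cases \<sigma>, cases \<tau>) (simp add: pushout_pair_def pullback_pair_def)
  also have "\<dots> \<longleftrightarrow> ext_mor \<A> \<E> f (Ide \<A> C) \<sigma> \<tau>"
    using op.pullback_pair_iff[of "prod.swap \<sigma>" A C f "prod.swap \<tau>"] assms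
    by (simp add: ext_pairs_op ext_mor_op)
  finally show ?thesis .
qed

end

section \<open>Direct sums and Baer sums\<close>

context additive_category
begin

text \<open>The four structure arrows are separate parameters instead of two families indexed by
  numbers, so that any arrows can be put in their place directly.\<close>

definition binary_biproduct where
  "binary_biproduct X Y P i0 i1 p0 p1 \<longleftrightarrow>
     i0 \<in> Arr \<A> \<and> Dom \<A> i0 = X \<and> Cod \<A> i0 = P \<and>
     i1 \<in> Arr \<A> \<and> Dom \<A> i1 = Y \<and> Cod \<A> i1 = P \<and>
     p0 \<in> Arr \<A> \<and> Dom \<A> p0 = P \<and> Cod \<A> p0 = X \<and>
     p1 \<in> Arr \<A> \<and> Dom \<A> p1 = P \<and> Cod \<A> p1 = Y \<and>
     p0 \<cdot> i0 = Ide \<A> X \<and> p1 \<cdot> i1 = Ide \<A> Y \<and>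
     p0 \<cdot> i1 = Zero \<A> Y X \<and> p1 \<cdot> i0 = Zero \<A> X Y \<and>
     i0 \<cdot> p0 \<boxplus> i1 \<cdot> p1 = Ide \<A> P"

lemma is_biproduct_iff_binary:
  "is_biproduct \<A> [X, Y] P i p \<longleftrightarrow> binary_biproduct X Y P (i 0) (i 1) (p 0) (p 1)"
  unfolding is_biproduct_pair_iff binary_biproduct_def homset_def by auto

lemma is_biproduct_binaryI:
  assumes "binary_biproduct X Y P i0 i1 p0 p1"
  shows "is_biproduct \<A> [X, Y] P (\<lambda>n. if n = 0 then i0 else i1) (\<lambda>n. if n = 0 then p0 else p1)"
  using assms by (simp add: is_biproduct_iff_binary)

lemma binary_biproductD:
  assumes "binary_biproduct X Y P i0 i1 p0 p1"
  shows "i0 \<in> Arr \<A>" "Dom \<A> i0 = X" "Cod \<A> i0 = P"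
     "i1 \<in> Arr \<A>" "Dom \<A> i1 = Y" "Cod \<A> i1 = P"
     "p0 \<in> Arr \<A>" "Dom \<A> p0 = P" "Cod \<A> p0 = X"
     "p1 \<in> Arr \<A>" "Dom \<A> p1 = P" "Cod \<A> p1 = Y"
     "p0 \<cdot> i0 = Ide \<A> X" "p1 \<cdot> i1 = Ide \<A> Y"
     "p0 \<cdot> i1 = Zero \<A> Y X" "p1 \<cdot> i0 = Zero \<A> X Y"
     "i0 \<cdot> p0 \<boxplus> i1 \<cdot> p1 = Ide \<A> P"
  using assms by (simp_all add: binary_biproduct_def)

lemma binary_biproduct_Obj:
  assumes "binary_biproduct X Y P i0 i1 p0 p1"
  shows "X \<in> Obj \<A>" "Y \<in> Obj \<A>" "P \<in> Obj \<A>"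
  using assms Dom_in_Obj Cod_in_Obj unfolding binary_biproduct_def by metis+

lemma binary_biproduct_reassoc:
  assumes "binary_biproduct X Y P i0 i1 p0 p1" "x \<in> Arr \<A>"
  shows "Cod \<A> x = X \<Longrightarrow> p0 \<cdot> (i0 \<cdot> x) = x" "Cod \<A> x = Y \<Longrightarrow> p1 \<cdot> (i1 \<cdot> x) = x"
    "Cod \<A> x = Y \<Longrightarrow> p0 \<cdot> (i1 \<cdot> x) = Zero \<A> (Dom \<A> x) X"
    "Cod \<A> x = X \<Longrightarrow> p1 \<cdot> (i0 \<cdot> x) = Zero \<A> (Dom \<A> x) Y"
  using binary_biproductD[OF assms(1)] binary_biproduct_Obj[OF assms(1)] assms(2)
    Comp_reassoc[of p0 i0 _ x] Comp_reassoc[of p1 i1 _ x] Comp_reassoc[of p0 i1 _ x] Comp_reassoc[of p1 i0 _ x]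
  by simp_all

lemma binary_biproduct_ex:
  assumes "X \<in> Obj \<A>" "Y \<in> Obj \<A>"
  obtains P i0 i1 p0 p1 where "binary_biproduct X Y P i0 i1 p0 p1"
  using ex_biproduct[of "[X, Y]"] assms by (auto simp: is_biproduct_iff_binary)

lemma binary_biproduct_unique:
  assumes bp: "binary_biproduct X Y P i0 i1 p0 p1"
    and x: "x \<in> Arr \<A>" "Cod \<A> x = P" and y: "y \<in> Arr \<A>" "Cod \<A> y = P" "Dom \<A> x = Dom \<A> y"
    and eq: "p0 \<cdot> x = p0 \<cdot> y" "p1 \<cdot> x = p1 \<cdot> y"
  shows "x = y"
proof -
  note b = binary_biproductD[OF bp]
  have *: "z = i0 \<cdot> (p0 \<cdot> z) \<boxplus> i1 \<cdot> (p1 \<cdot> z)" if "z \<in> Arr \<A>" "Cod \<A> z = P" for z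
  proof -
    have "z = (i0 \<cdot> p0 \<boxplus> i1 \<cdot> p1) \<cdot> z" using b that by simp
    also have "\<dots> = i0 \<cdot> (p0 \<cdot> z) \<boxplus> i1 \<cdot> (p1 \<cdot> z)" using b(1-12) that by simp
    finally show ?thesis .
  qed
  show ?thesis using *[OF x] *[OF y(1,2)] eq by simp
qed

text \<open>The injections are induced by \<open>(1, 0)\<close> and \<open>(0, 1)\<close>, and the
  sum formula is verified after both projections. This serves for an object obtained by iterated
  pullback, of which only the projections are known.\<close>

lemma product_is_biproduct:
  assumes p: "p0 \<in> Arr \<A>" "p1 \<in> Arr \<A>" "Dom \<A> p0 = P" "Dom \<A> p1 = P" "Cod \<A> p0 = X" "Cod \<A> p1 = Y"
    and ex: "\<And>u v. \<lbrakk>u \<in> Arr \<A>; v \<in> Arr \<A>; Dom \<A> u = Dom \<A> v; Cod \<A> u = X; Cod \<A> v = Y\<rbrakk>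
      \<Longrightarrow> \<exists>w \<in> Arr \<A>. Dom \<A> w = Dom \<A> u \<and> Cod \<A> w = P \<and> p0 \<cdot> w = u \<and> p1 \<cdot> w = v"
    and unique: "\<And>x y. \<lbrakk>x \<in> Arr \<A>; y \<in> Arr \<A>; Dom \<A> x = Dom \<A> y; Cod \<A> x = P; Cod \<A> y = P;
      p0 \<cdot> x = p0 \<cdot> y; p1 \<cdot> x = p1 \<cdot> y\<rbrakk> \<Longrightarrow> x = y"
  obtains i0 i1 where "binary_biproduct X Y P i0 i1 p0 p1"
proof -
  have ob: "X \<in> Obj \<A>" "Y \<in> Obj \<A>" "P \<in> Obj \<A>" using p by auto
  obtain i0 where i0: "i0 \<in> Arr \<A>" "Dom \<A> i0 = X" "Cod \<A> i0 = P" "p0 \<cdot> i0 = Ide \<A> X" "p1 \<cdot> i0 = Zero \<A> X Y"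
    using ex[of "Ide \<A> X" "Zero \<A> X Y"] ob by auto
  obtain i1 where i1: "i1 \<in> Arr \<A>" "Dom \<A> i1 = Y" "Cod \<A> i1 = P" "p0 \<cdot> i1 = Zero \<A> Y X" "p1 \<cdot> i1 = Ide \<A> Y"
    using ex[of "Zero \<A> Y X" "Ide \<A> Y"] ob by auto
  have "i0 \<cdot> p0 \<boxplus> i1 \<cdot> p1 = Ide \<A> P"
    by (rule unique) (use p ob i0 i1 in
      \<open>simp_all add: Comp_reassoc[OF i0(4)] Comp_reassoc[OF i0(5)] Comp_reassoc[OF i1(4)] Comp_reassoc[OF i1(5)]\<close>)
  then show ?thesis using that[of i0 i1] p i0 i1 by (simp add: binary_biproduct_def)
qed

text \<open>The projections decouple the two summands: \<open>j0\<close> and \<open>q0\<close> turn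
  an equation about the direct sum into one about \<open>i, p\<close> and one about
  \<open>i', p'\<close>, where the given kernels apply.\<close>

lemma direct_sum_is_kernel:
  assumes bA: "binary_biproduct (Dom \<A> i) (Dom \<A> i') PA iA0 iA1 pA0 pA1"
    and bB: "binary_biproduct (Dom \<A> p) (Dom \<A> p') PB iB0 iB1 pB0 pB1"
    and bC: "binary_biproduct (Cod \<A> p) (Cod \<A> p') PC iC0 iC1 pC0 pC1"
    and k: "is_kernel \<A> i p" and k': "is_kernel \<A> i' p'"
  shows "is_kernel \<A> (iB0 \<cdot> i \<cdot> pA0 \<boxplus> iB1 \<cdot> i' \<cdot> pA1) (iC0 \<cdot> p \<cdot> pB0 \<boxplus> iC1 \<cdot> p' \<cdot> pB1)"
    (is "is_kernel \<A> ?j ?q")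
proof -
  note a = binary_biproductD[OF bA] and b = binary_biproductD[OF bB] and c = binary_biproductD[OF bC]
  note ob = binary_biproduct_Obj[OF bA] binary_biproduct_Obj[OF bB] binary_biproduct_Obj[OF bC]
  note ra = binary_biproduct_reassoc[OF bA] and rb = binary_biproduct_reassoc[OF bB]
    and rc = binary_biproduct_reassoc[OF bC]
  have i: "i \<in> Arr \<A>" "Cod \<A> i = Dom \<A> p" "p \<in> Arr \<A>" "p \<cdot> i = Zero \<A> (Dom \<A> i) (Cod \<A> p)"
    using k by (auto simp: is_kernel_def)
  have i': "i' \<in> Arr \<A>" "Cod \<A> i' = Dom \<A> p'" "p' \<in> Arr \<A>" "p' \<cdot> i' = Zero \<A> (Dom \<A> i') (Cod \<A> p')"
    using k' by (auto simp: is_kernel_def)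
  note ty = a(1-12) b(1-12) c(1-12) i(1-3) i'(1-3) ob
  have "?q \<cdot> ?j = Zero \<A> PA PC"
    using ty by (simp add: rb Comp_reassoc[OF i(4)] Comp_reassoc[OF i'(4)])
  have j0: "pB0 \<cdot> (?j \<cdot> g) = i \<cdot> (pA0 \<cdot> g)" "pB1 \<cdot> (?j \<cdot> g) = i' \<cdot> (pA1 \<cdot> g)"
    if "g \<in> Arr \<A>" "Cod \<A> g = PA" for g
    using ty that by (simp_all add: rb)
  have q0: "pC0 \<cdot> (?q \<cdot> f) = p \<cdot> (pB0 \<cdot> f)" "pC1 \<cdot> (?q \<cdot> f) = p' \<cdot> (pB1 \<cdot> f)"
    if "f \<in> Arr \<A>" "Cod \<A> f = PB" for f
    using ty that by (simp_all add: rc)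
  have jq: "?j \<in> Arr \<A>" "Dom \<A> ?j = PA" "Cod \<A> ?j = PB" "?q \<in> Arr \<A>" "Dom \<A> ?q = PB" "Cod \<A> ?q = PC"
    using ty by simp_all
  show ?thesis
    unfolding is_kernel_def jq
  proof (intro conjI ballI impI)
    show "?q \<cdot> ?j = Zero \<A> PA PC" by fact
    fix X f assume "X \<in> Obj \<A>" and f': "f \<in> homset \<A> X PB" "?q \<cdot> f = Zero \<A> X PC"
    then have f: "f \<in> Arr \<A>" "Dom \<A> f = X" "Cod \<A> f = PB" by (auto simp: homset_def)
    have z: "p \<cdot> (pB0 \<cdot> f) = Zero \<A> X (Cod \<A> p)" "p' \<cdot> (pB1 \<cdot> f) = Zero \<A> X (Cod \<A> p')"
      using q0[OF f(1,3)] unfolding f'(2) using ty \<open>X \<in> Obj \<A>\<close> by simp_all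
    obtain x where x: "x \<in> Arr \<A>" "Dom \<A> x = X" "Cod \<A> x = Dom \<A> i" "i \<cdot> x = pB0 \<cdot> f"
      using kernel_factor[OF k, of "pB0 \<cdot> f"] f ty z by simp metis
    obtain y where y: "y \<in> Arr \<A>" "Dom \<A> y = X" "Cod \<A> y = Dom \<A> i'" "i' \<cdot> y = pB1 \<cdot> f"
      using kernel_factor[OF k', of "pB1 \<cdot> f"] f ty z by simp metis
    let ?g = "iA0 \<cdot> x \<boxplus> iA1 \<cdot> y"
    have g: "?g \<in> Arr \<A>" "Dom \<A> ?g = X" "Cod \<A> ?g = PA" using x y ty by simp_all
    have pg: "pA0 \<cdot> ?g = x" "pA1 \<cdot> ?g = y" using x y ty by (simp_all add: ra)
    show "\<exists>!g. g \<in> homset \<A> X PA \<and> ?j \<cdot> g = f"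
    proof (rule ex1I[of _ ?g])
      have "?j \<cdot> ?g = f"
      proof (rule binary_biproduct_unique[OF bB])
        show "pB0 \<cdot> (?j \<cdot> ?g) = pB0 \<cdot> f" unfolding j0[OF g(1,3)] pg x ..
        show "pB1 \<cdot> (?j \<cdot> ?g) = pB1 \<cdot> f" unfolding j0[OF g(1,3)] pg y ..
      qed (use g f ty in simp_all)
      then show "?g \<in> homset \<A> X PA \<and> ?j \<cdot> ?g = f" using g by (simp add: homset_def)
    next
      fix h assume "h \<in> homset \<A> X PA \<and> ?j \<cdot> h = f"
      then have h: "h \<in> Arr \<A>" "Dom \<A> h = X" "Cod \<A> h = PA" and e: "?j \<cdot> h = f"
        by (auto simp: homset_def)
      have "i \<cdot> (pA0 \<cdot> h) = i \<cdot> x" "i' \<cdot> (pA1 \<cdot> h) = i' \<cdot> y"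
        using j0[OF h(1,3)] unfolding e x y by simp_all
      then have "pA0 \<cdot> h = x" "pA1 \<cdot> h = y"
        using kernel_mono[OF k, of "pA0 \<cdot> h" x] kernel_mono[OF k', of "pA1 \<cdot> h" y] h x y ty by simp_all
      then have "pA0 \<cdot> h = pA0 \<cdot> ?g" "pA1 \<cdot> h = pA1 \<cdot> ?g" using pg by simp_all
      with binary_biproduct_unique[OF bA, of h ?g] h g show "h = ?g" by simp
    qed
  qed (use jq in simp_all)
qed

end

context exact_category
begin

text \<open>No axiom makes \<open>p \<oplus> p'\<close> an admissible epic. It is the composite of
  two arrows that are: the pullback \<open>q1\<close> of \<open>p\<close> along \<open>pC0\<close>,
  which plays the role of \<open>p \<oplus> 1\<close>, and the pullback \<open>q2\<close> of
  \<open>p'\<close> along \<open>pC1 \<cdot> q1\<close>, which plays the role of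
  \<open>1 \<oplus> p'\<close>. The middle biproduct is therefore an outcome of the construction,
  not an input.\<close>

lemma direct_sum_conflation:
  assumes E: "(i, p) \<in> \<E>" "(i', p') \<in> \<E>"
    and bA: "binary_biproduct (Dom \<A> i) (Dom \<A> i') PA iA0 iA1 pA0 pA1"
    and bC: "binary_biproduct (Cod \<A> p) (Cod \<A> p') PC iC0 iC1 pC0 pC1"
  obtains PB iB0 iB1 pB0 pB1 where "binary_biproduct (Dom \<A> p) (Dom \<A> p') PB iB0 iB1 pB0 pB1"
    "(iB0 \<cdot> i \<cdot> pA0 \<boxplus> iB1 \<cdot> i' \<cdot> pA1, iC0 \<cdot> p \<cdot> pB0 \<boxplus> iC1 \<cdot> p' \<cdot> pB1) \<in> \<E>"
proof -
  note k = conflation[OF E(1)] and k' = conflation[OF E(2)]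
  note a = binary_biproductD[OF bA] and c = binary_biproductD[OF bC]
  note rc = binary_biproduct_reassoc[OF bC]
  obtain g1 j1 q1 where pb1: "is_pullback \<A> p pC0 g1 q1" and E1: "(j1, q1) \<in> \<E>"
    by (rule pullback_conflation[OF E(1), of pC0]) (use c in simp_all)
  note ty1 = pullback_typing[OF pb1]
  obtain g2 j2 q2 where pb2: "is_pullback \<A> p' (pC1 \<cdot> q1) g2 q2" and E2: "(j2, q2) \<in> \<E>"
    by (rule pullback_conflation[OF E(2), of "pC1 \<cdot> q1"]) (use c ty1 in simp_all)
  note ty2 = pullback_typing[OF pb2]
  have t: "g1 \<in> Arr \<A>" "Dom \<A> g1 = Dom \<A> q1" "Cod \<A> g1 = Dom \<A> p" "q1 \<in> Arr \<A>" "Cod \<A> q1 = PC"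
    "g2 \<in> Arr \<A>" "Dom \<A> g2 = Dom \<A> q2" "Cod \<A> g2 = Dom \<A> p'" "q2 \<in> Arr \<A>" "Cod \<A> q2 = Dom \<A> q1"
    "p \<in> Arr \<A>" "p' \<in> Arr \<A>"
    using ty1 ty2 k k' c by simp_all
  have e1: "p \<cdot> g1 = pC0 \<cdot> q1" and e2: "p' \<cdot> g2 = pC1 \<cdot> (q1 \<cdot> q2)"
    using ty1 ty2 t c by simp_all
  obtain iB0 iB1 where bB: "binary_biproduct (Dom \<A> p) (Dom \<A> p') (Dom \<A> q2) iB0 iB1 (g1 \<cdot> q2) g2"
  proof (rule product_is_biproduct[of "g1 \<cdot> q2" g2 "Dom \<A> q2" "Dom \<A> p" "Dom \<A> p'"])
    fix u v assume uv: "u \<in> Arr \<A>" "v \<in> Arr \<A>" "Dom \<A> u = Dom \<A> v" "Cod \<A> u = Dom \<A> p" "Cod \<A> v = Dom \<A> p'"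
    \<comment> \<open>The component of \<open>y\<close> in \<open>PC\<close> is forced: it must be
      \<open>p \<cdot> u\<close> in the first coordinate, and \<open>p' \<cdot> v\<close> in the
      second so that \<open>v\<close> can be lifted through the second pullback.\<close>
    obtain y where y: "y \<in> Arr \<A>" "Dom \<A> y = Dom \<A> v" "Cod \<A> y = Dom \<A> q1" "g1 \<cdot> y = u"
      "q1 \<cdot> y = iC0 \<cdot> (p \<cdot> u) \<boxplus> iC1 \<cdot> (p' \<cdot> v)"
      by (rule pullback_factor[OF pb1, of u "iC0 \<cdot> (p \<cdot> u) \<boxplus> iC1 \<cdot> (p' \<cdot> v)"])
        (use uv t c in \<open>simp_all add: rc\<close>)
    obtain w where w: "w \<in> Arr \<A>" "Dom \<A> w = Dom \<A> y" "Cod \<A> w = Dom \<A> q2" "g2 \<cdot> w = v" "q2 \<cdot> w = y"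
      by (rule pullback_factor[OF pb2, of v y]) (use uv t c y in \<open>simp_all add: rc\<close>)
    show "\<exists>w \<in> Arr \<A>. Dom \<A> w = Dom \<A> u \<and> Cod \<A> w = Dom \<A> q2 \<and> (g1 \<cdot> q2) \<cdot> w = u \<and> g2 \<cdot> w = v"
      by (rule bexI[of _ w]) (use w y t uv in simp_all)
  next
    fix x y assume xy: "x \<in> Arr \<A>" "y \<in> Arr \<A>" "Dom \<A> x = Dom \<A> y" "Cod \<A> x = Dom \<A> q2" "Cod \<A> y = Dom \<A> q2"
      "(g1 \<cdot> q2) \<cdot> x = (g1 \<cdot> q2) \<cdot> y" "g2 \<cdot> x = g2 \<cdot> y"
    \<comment> \<open>Both coordinates of \<open>q1 \<cdot> q2 \<cdot> z\<close> are determined by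
      the projections of \<open>z\<close>; hence so is \<open>q1 \<cdot> q2 \<cdot> z\<close>, and
      the uniqueness parts of the two pullbacks apply one after the other.\<close>
    have c0: "pC0 \<cdot> (q1 \<cdot> (q2 \<cdot> z)) = p \<cdot> ((g1 \<cdot> q2) \<cdot> z)" and c1: "pC1 \<cdot> (q1 \<cdot> (q2 \<cdot> z)) = p' \<cdot> (g2 \<cdot> z)"
      if "z \<in> Arr \<A>" "Cod \<A> z = Dom \<A> q2" for z
      using that t c by (simp_all add: Comp_reassoc[OF e1] Comp_reassoc[OF e2])
    have "q1 \<cdot> (q2 \<cdot> x) = q1 \<cdot> (q2 \<cdot> y)"
    proof (rule binary_biproduct_unique[OF bC])
      show "pC0 \<cdot> (q1 \<cdot> (q2 \<cdot> x)) = pC0 \<cdot> (q1 \<cdot> (q2 \<cdot> y))"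
        unfolding c0[OF xy(1,4)] c0[OF xy(2,5)] xy(6) ..
      show "pC1 \<cdot> (q1 \<cdot> (q2 \<cdot> x)) = pC1 \<cdot> (q1 \<cdot> (q2 \<cdot> y))"
        unfolding c1[OF xy(1,4)] c1[OF xy(2,5)] xy(7) ..
    qed (use xy(1-5) t in simp_all)
    moreover have "g1 \<cdot> (q2 \<cdot> x) = g1 \<cdot> (q2 \<cdot> y)" using xy t by simp
    ultimately have "q2 \<cdot> x = q2 \<cdot> y"
      using pullback_unique[OF pb1, of "q2 \<cdot> x" "q2 \<cdot> y"] xy(1-5) t by simp
    then show "x = y"
      using pullback_unique[OF pb2, of x y] xy(1-5,7) t by simp
  qed (use t in simp_all)
  note b = binary_biproductD[OF bB]
  let ?q = "iC0 \<cdot> p \<cdot> (g1 \<cdot> q2) \<boxplus> iC1 \<cdot> p' \<cdot> g2"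
  have "?q = q1 \<cdot> q2"
    by (rule binary_biproduct_unique[OF bC])
      (use t c in \<open>simp_all add: rc e2 Comp_reassoc[OF e1]\<close>)
  moreover have "admissible_epic \<E> (q1 \<cdot> q2)"
    using E1 E2 t by (intro Comp_admissible_epic) (auto simp: admissible_epic_def)
  ultimately obtain j where j: "(j, ?q) \<in> \<E>" by (auto simp: admissible_epic_def)
  have "(iB0 \<cdot> i \<cdot> pA0 \<boxplus> iB1 \<cdot> i' \<cdot> pA1, ?q) \<in> \<E>"
    by (rule kernel_of_admissible_epic[OF j direct_sum_is_kernel[OF bA bB bC k(1) k'(1)]])
  with bB that show ?thesis by blast
qed

definition ext_direct_sum where
  "ext_direct_sum i p i' p' PA iA0 iA1 pA0 pA1 PC iC0 iC1 pC0 pC1 \<rho> \<longleftrightarrow>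
     binary_biproduct (Dom \<A> i) (Dom \<A> i') PA iA0 iA1 pA0 pA1 \<and>
     binary_biproduct (Cod \<A> p) (Cod \<A> p') PC iC0 iC1 pC0 pC1 \<and>
     (\<exists>PB iB0 iB1 pB0 pB1. binary_biproduct (Cod \<A> i) (Cod \<A> i') PB iB0 iB1 pB0 pB1 \<and>
       \<rho> = (iB0 \<cdot> i \<cdot> pA0 \<boxplus> iB1 \<cdot> i' \<cdot> pA1, iC0 \<cdot> p \<cdot> pB0 \<boxplus> iC1 \<cdot> p' \<cdot> pB1))"

lemma direct_sum_pair_iff:
  "direct_sum_pair \<A> (i, p) (i', p') (PA, iA, pA) (PC, iC, pC) \<rho> \<longleftrightarrow>
     ext_direct_sum i p i' p' PA (iA 0) (iA 1) (pA 0) (pA 1) PC (iC 0) (iC 1) (pC 0) (pC 1) \<rho>"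
proof -
  obtain j q where r: "\<rho> = (j, q)" by (cases \<rho>)
  have *: "(\<exists>PB iB pB. is_biproduct \<A> [Cod \<A> i, Cod \<A> i'] PB iB pB \<and> Q PB (iB 0) (iB 1) (pB 0) (pB 1)) \<longleftrightarrow>
     (\<exists>PB iB0 iB1 pB0 pB1. binary_biproduct (Cod \<A> i) (Cod \<A> i') PB iB0 iB1 pB0 pB1 \<and> Q PB iB0 iB1 pB0 pB1)"
    (is "?L \<longleftrightarrow> ?R") for Q
  proof
    assume ?L then show ?R unfolding is_biproduct_iff_binary by blast
  next
    assume ?R
    then obtain PB iB0 iB1 pB0 pB1 where
      b: "binary_biproduct (Cod \<A> i) (Cod \<A> i') PB iB0 iB1 pB0 pB1" "Q PB iB0 iB1 pB0 pB1" by blast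
    show ?L
      using is_biproduct_binaryI[OF b(1)] b(2)
      by - (rule exI[of _ PB], rule exI[of _ "\<lambda>n. if n = 0 then iB0 else iB1"],
          rule exI[of _ "\<lambda>n. if n = 0 then pB0 else pB1"], simp)
  qed
  show ?thesis
    unfolding direct_sum_pair_def ext_direct_sum_def r prod.case prod.inject is_biproduct_iff_binary[symmetric]
    using *[of "\<lambda>PB iB0 iB1 pB0 pB1. j = iB0 \<cdot> i \<cdot> pA 0 \<boxplus> iB1 \<cdot> i' \<cdot> pA 1 \<and> q = iC 0 \<cdot> p \<cdot> pB0 \<boxplus> iC 1 \<cdot> p' \<cdot> pB1"]
    by (simp add: is_biproduct_iff_binary)
qed

lemma ext_direct_sum_projections:
  assumes "ext_direct_sum i p i' p' PA iA0 iA1 pA0 pA1 PC iC0 iC1 pC0 pC1 \<rho>"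
    and E: "(i, p) \<in> \<E>" "(i', p') \<in> \<E>" "\<rho> \<in> \<E>"
  shows "ext_mor \<A> \<E> pA0 pC0 \<rho> (i, p)" "ext_mor \<A> \<E> pA1 pC1 \<rho> (i', p')"
proof -
  note k = conflation[OF E(1)] and k' = conflation[OF E(2)]
  obtain PB iB0 iB1 pB0 pB1 where bA: "binary_biproduct (Dom \<A> i) (Dom \<A> i') PA iA0 iA1 pA0 pA1"
    and bC: "binary_biproduct (Cod \<A> p) (Cod \<A> p') PC iC0 iC1 pC0 pC1"
    and bB: "binary_biproduct (Dom \<A> p) (Dom \<A> p') PB iB0 iB1 pB0 pB1"
    and r: "\<rho> = (iB0 \<cdot> i \<cdot> pA0 \<boxplus> iB1 \<cdot> i' \<cdot> pA1, iC0 \<cdot> p \<cdot> pB0 \<boxplus> iC1 \<cdot> p' \<cdot> pB1)"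
    using assms(1) k k' by (auto simp: ext_direct_sum_def)
  note a = binary_biproductD[OF bA] and b = binary_biproductD[OF bB] and c = binary_biproductD[OF bC]
  note ob = binary_biproduct_Obj[OF bA] binary_biproduct_Obj[OF bB] binary_biproduct_Obj[OF bC]
  note rb = binary_biproduct_reassoc[OF bB] and rc = binary_biproduct_reassoc[OF bC]
  note ty = a(1-12) b(1-12) c(1-12) k(3-5) k'(3-5) ob
  show "ext_mor \<A> \<E> pA0 pC0 \<rho> (i, p)"
    using E unfolding r by (intro ext_morI[where b = pB0]) (use ty in \<open>simp_all add: rb rc\<close>)
  show "ext_mor \<A> \<E> pA1 pC1 \<rho> (i', p')"
    using E unfolding r by (intro ext_morI[where b = pB1]) (use ty in \<open>simp_all add: rb rc\<close>)
qed

text \<open>The middle arrow is the tuple of the two given middle arrows. Together with the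
  projections this lets the direct sum act as a product of extensions.\<close>

lemma ext_direct_sum_tuple:
  assumes "ext_direct_sum i p i' p' PA iA0 iA1 pA0 pA1 PC iC0 iC1 pC0 pC1 \<rho>" "\<rho> \<in> \<E>"
    and f: "ext_mor \<A> \<E> f h \<omega> (i, p)" and f': "ext_mor \<A> \<E> f' h' \<omega> (i', p')"
  shows "ext_mor \<A> \<E> (iA0 \<cdot> f \<boxplus> iA1 \<cdot> f') (iC0 \<cdot> h \<boxplus> iC1 \<cdot> h') \<omega> \<rho>"
proof -
  obtain j q where w: "\<omega> = (j, q)" by (cases \<omega>)
  obtain g where g: "(j, q) \<in> \<E>" "(i, p) \<in> \<E>"
    "f \<in> Arr \<A>" "Dom \<A> f = Dom \<A> j" "Cod \<A> f = Dom \<A> i"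
    "g \<in> Arr \<A>" "Dom \<A> g = Dom \<A> q" "Cod \<A> g = Dom \<A> p"
    "h \<in> Arr \<A>" "Dom \<A> h = Cod \<A> q" "Cod \<A> h = Cod \<A> p"
    "g \<cdot> j = i \<cdot> f" "p \<cdot> g = h \<cdot> q" using f unfolding w by (rule ext_morE)
  obtain g' where g': "(j, q) \<in> \<E>" "(i', p') \<in> \<E>"
    "f' \<in> Arr \<A>" "Dom \<A> f' = Dom \<A> j" "Cod \<A> f' = Dom \<A> i'"
    "g' \<in> Arr \<A>" "Dom \<A> g' = Dom \<A> q" "Cod \<A> g' = Dom \<A> p'"
    "h' \<in> Arr \<A>" "Dom \<A> h' = Cod \<A> q" "Cod \<A> h' = Cod \<A> p'"
    "g' \<cdot> j = i' \<cdot> f'" "p' \<cdot> g' = h' \<cdot> q" using f' unfolding w by (rule ext_morE)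
  note k = conflation[OF g(2)] and k' = conflation[OF g'(2)] and kj = conflation[OF g(1)]
  obtain PB iB0 iB1 pB0 pB1 where bA: "binary_biproduct (Dom \<A> i) (Dom \<A> i') PA iA0 iA1 pA0 pA1"
    and bC: "binary_biproduct (Cod \<A> p) (Cod \<A> p') PC iC0 iC1 pC0 pC1"
    and bB: "binary_biproduct (Dom \<A> p) (Dom \<A> p') PB iB0 iB1 pB0 pB1"
    and r: "\<rho> = (iB0 \<cdot> i \<cdot> pA0 \<boxplus> iB1 \<cdot> i' \<cdot> pA1, iC0 \<cdot> p \<cdot> pB0 \<boxplus> iC1 \<cdot> p' \<cdot> pB1)"
    using assms(1) k k' by (auto simp: ext_direct_sum_def)
  note a = binary_biproductD[OF bA] and b = binary_biproductD[OF bB] and c = binary_biproductD[OF bC]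
  note ob = binary_biproduct_Obj[OF bA] binary_biproduct_Obj[OF bB] binary_biproduct_Obj[OF bC]
  note ra = binary_biproduct_reassoc[OF bA] and rb = binary_biproduct_reassoc[OF bB]
  note ty = a(1-12) b(1-12) c(1-12) k(3-5) k'(3-5) kj(3-5) ob g(3-13) g'(3-13)
  show ?thesis
    using assms(2) g(1) unfolding r w
    by (intro ext_morI[where b = "iB0 \<cdot> g \<boxplus> iB1 \<cdot> g'"]) (use ty in \<open>simp_all add: ra rb\<close>)
qed

lemma ext_direct_sum_ex:
  assumes E: "(i, p) \<in> \<E>" "(i', p') \<in> \<E>"
    and bA: "binary_biproduct (Dom \<A> i) (Dom \<A> i') PA iA0 iA1 pA0 pA1"
    and bC: "binary_biproduct (Cod \<A> p) (Cod \<A> p') PC iC0 iC1 pC0 pC1"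
  obtains \<rho> where "ext_direct_sum i p i' p' PA iA0 iA1 pA0 pA1 PC iC0 iC1 pC0 pC1 \<rho>" "\<rho> \<in> \<E>"
proof (rule direct_sum_conflation[OF assms])
  fix PB iB0 iB1 pB0 pB1 
  assume "binary_biproduct (Dom \<A> p) (Dom \<A> p') PB iB0 iB1 pB0 pB1"
    "(iB0 \<cdot> i \<cdot> pA0 \<boxplus> iB1 \<cdot> i' \<cdot> pA1, iC0 \<cdot> p \<cdot> pB0 \<boxplus> iC1 \<cdot> p' \<cdot> pB1) \<in> \<E>"
  then show thesis
    using that bA bC conflation(5)[OF E(1)] conflation(5)[OF E(2)]
    unfolding ext_direct_sum_def by metis
qed

text \<open>Take for \<open>\<omega>\<close> the direct sum pulled back along the diagonal of
  \<open>C\<close>, an extension by \<open>A \<oplus> A'\<close>; the arrows \<open>f\<close> and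
  \<open>f'\<close> are the projections of that biproduct. This is the surjectivity of \<open>Ext(C,
  A \<oplus> A') \<rightarrow> Ext(C, A) \<times> Ext(C, A')\<close>.\<close>

lemma ext_mor_joint_ex:
  assumes "\<sigma> \<in> ext_pairs \<A> \<E> C A" "\<sigma>' \<in> ext_pairs \<A> \<E> C A'"
  obtains \<omega> f f' where "ext_mor \<A> \<E> f (Ide \<A> C) \<omega> \<sigma>" "ext_mor \<A> \<E> f' (Ide \<A> C) \<omega> \<sigma>'"
proof -
  obtain i p i' p' where s: "\<sigma> = (i, p)" "\<sigma>' = (i', p')" by (cases \<sigma>, cases \<sigma>') auto
  have E: "(i, p) \<in> \<E>" "Dom \<A> i = A" "Cod \<A> p = C" "(i', p') \<in> \<E>" "Dom \<A> i' = A'" "Cod \<A> p' = C"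
    using assms by (auto simp: s ext_pairs_iff)
  note ob = ext_pairs_Obj[OF assms(1)] ext_pairs_Obj[OF assms(2)]
  obtain PA iA0 iA1 pA0 pA1 where bA: "binary_biproduct A A' PA iA0 iA1 pA0 pA1"
    using binary_biproduct_ex ob by metis
  obtain PC iC0 iC1 pC0 pC1 where bC: "binary_biproduct C C PC iC0 iC1 pC0 pC1"
    using binary_biproduct_ex ob by metis
  obtain \<rho> where r: "ext_direct_sum i p i' p' PA iA0 iA1 pA0 pA1 PC iC0 iC1 pC0 pC1 \<rho>" "\<rho> \<in> \<E>"
    by (rule ext_direct_sum_ex[OF E(1,4), of PA iA0 iA1 pA0 pA1 PC iC0 iC1 pC0 pC1]) (use bA bC E in simp_all)
  note pr = ext_direct_sum_projections[OF r(1) E(1,4) r(2)]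
  note a = binary_biproductD[OF bA] and c = binary_biproductD[OF bC]
  have "\<rho> \<in> ext_pairs \<A> \<E> PC PA" using ext_mor_typing[OF pr(1)] a c by simp
  then obtain \<omega> where w: "ext_mor \<A> \<E> (Ide \<A> PA) (iC0 \<boxplus> iC1) \<omega> \<rho>"
    by (rule ext_mor_pullback_ex[of _ _ _ "iC0 \<boxplus> iC1"]) (use c in simp_all)
  show ?thesis
    by (rule that[of pA0 \<omega> pA1])
      (use ext_mor_Comp[OF w pr(1)] ext_mor_Comp[OF w pr(2)] a c ob in \<open>simp_all add: s\<close>)
qed

text \<open>
  Writing \<open>f\<^sub>*\<close> for the map induced on Ext, this says \<open>f\<^sub>*[\<omega>] + f'\<^sub>*[\<omega>] = (f + f')\<^sub>*[\<omega>]\<close>. Every finite family of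
  extensions of \<open>C\<close> has the form \<open>f\<^sub>*[\<omega>]\<close> for a common \<open>\<omega>\<close> (lemma \<open>ext_mor_joint_ex\<close>), so the group axioms and the
  naturality of the Baer sum reduce to identities between arrows.
\<close>

lemma is_baer_sum_iff:
  assumes "\<sigma> \<in> ext_pairs \<A> \<E> C A" "\<sigma>' \<in> ext_pairs \<A> \<E> C A"
    and f: "ext_mor \<A> \<E> f (Ide \<A> C) \<omega> \<sigma>" and f': "ext_mor \<A> \<E> f' (Ide \<A> C) \<omega> \<sigma>'"
  shows "is_baer_sum \<A> \<E> \<sigma> \<sigma>' \<tau> \<longleftrightarrow> ext_mor \<A> \<E> (f \<boxplus> f') (Ide \<A> C) \<omega> \<tau>"
proof -
  obtain i p i' p' where s: "\<sigma> = (i, p)" "\<sigma>' = (i', p')" by (cases \<sigma>, cases \<sigma>') auto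
  have E: "(i, p) \<in> \<E>" "Dom \<A> i = A" "Cod \<A> p = C" "(i', p') \<in> \<E>" "Dom \<A> i' = A" "Cod \<A> p' = C"
    using assms by (auto simp: s ext_pairs_iff)
  note ob = ext_pairs_Obj[OF assms(1)]
  have w: "\<omega> \<in> ext_pairs \<A> \<E> C (Dom \<A> f)" "\<omega> \<in> ext_pairs \<A> \<E> C (Dom \<A> f')"
    using ext_mor_typing[OF f] ext_mor_typing[OF f'] ob by simp_all
  have ff: "f \<in> Arr \<A>" "f' \<in> Arr \<A>" "Dom \<A> f = Dom \<A> f'" "Cod \<A> f = A" "Cod \<A> f' = A"
    using ext_mor_typing[OF f] ext_mor_typing[OF f'] assms(1,2)
    by (auto simp: ext_pairs_def)
  \<comment> \<open>Stated for arbitrary choices in the construction of a Baer sum, so that it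
    serves both directions. The tuple \<open>(f, f')\<close> lies over the diagonal of
    \<open>C\<close>, so it lands in the pullback \<open>\<rho>'\<close>; following it by the
    codiagonal gives \<open>f \<boxplus> f'\<close>, and the cocartesian property of the tuple
    cancels it again.\<close>
  have key: "ext_mor \<A> \<E> (pA0 \<boxplus> pA1) (Ide \<A> C) \<rho>' \<tau> \<longleftrightarrow> ext_mor \<A> \<E> (f \<boxplus> f') (Ide \<A> C) \<omega> \<tau>"
    if r: "ext_direct_sum i p i' p' PA iA0 iA1 pA0 pA1 PC iC0 iC1 pC0 pC1 \<rho>" "\<rho> \<in> \<E>"
      and r': "ext_mor \<A> \<E> (Ide \<A> PA) (iC0 \<boxplus> iC1) \<rho>' \<rho>"
    for PA iA0 iA1 pA0 pA1 PC iC0 iC1 pC0 pC1 \<rho> \<rho>'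
  proof -
    have bA: "binary_biproduct A A PA iA0 iA1 pA0 pA1" and bC: "binary_biproduct C C PC iC0 iC1 pC0 pC1"
      using r(1) E by (auto simp: ext_direct_sum_def)
    note a = binary_biproductD[OF bA] and c = binary_biproductD[OF bC] and ra = binary_biproduct_reassoc[OF bA]
    let ?g = "iA0 \<cdot> f \<boxplus> iA1 \<cdot> f'"
    have "ext_mor \<A> \<E> ?g ((iC0 \<boxplus> iC1) \<cdot> Ide \<A> C) \<omega> \<rho>"
      using ext_direct_sum_tuple[OF r f[unfolded s] f'[unfolded s]] c ob by simp
    then have g: "ext_mor \<A> \<E> ?g (Ide \<A> C) \<omega> \<rho>'"
      by (rule ext_mor_through_pullback[OF r']) (use c ob binary_biproduct_Obj[OF bA] in simp_all)
    have e: "(pA0 \<boxplus> pA1) \<cdot> ?g = f \<boxplus> f'" using ff a by (simp add: ra)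
    show ?thesis
    proof
      assume "ext_mor \<A> \<E> (pA0 \<boxplus> pA1) (Ide \<A> C) \<rho>' \<tau>"
      from ext_mor_Comp[OF g this] show "ext_mor \<A> \<E> (f \<boxplus> f') (Ide \<A> C) \<omega> \<tau>"
        using e ob by simp
    next
      assume "ext_mor \<A> \<E> (f \<boxplus> f') (Ide \<A> C) \<omega> \<tau>"
      then show "ext_mor \<A> \<E> (pA0 \<boxplus> pA1) (Ide \<A> C) \<rho>' \<tau>"
        by (intro ext_mor_through_pushout[OF g]) (use e a ff ob in simp_all)
    qed
  qed
  show ?thesis
  proof
    assume "is_baer_sum \<A> \<E> \<sigma> \<sigma>' \<tau>"
    then obtain PA PC \<rho> \<rho>' and iA pA iC pC :: "nat \<Rightarrow> 'm" where
      r: "ext_direct_sum i p i' p' PA (iA 0) (iA 1) (pA 0) (pA 1) PC (iC 0) (iC 1) (pC 0) (pC 1) \<rho>"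
      and r': "pullback_pair \<A> \<E> (iC 0 \<boxplus> iC 1) \<rho> \<rho>'" and t: "pushout_pair \<A> \<E> (pA 0 \<boxplus> pA 1) \<rho>' \<tau>"
      unfolding is_baer_sum_def s direct_sum_pair_iff by blast
    have rE: "\<rho> \<in> \<E>" using r' by (auto simp: pullback_pair_def)
    note pr = ext_direct_sum_projections[OF r E(1,4) rE]
    have bA: "binary_biproduct A A PA (iA 0) (iA 1) (pA 0) (pA 1)" and bC: "binary_biproduct C C PC (iC 0) (iC 1) (pC 0) (pC 1)"
      using r E by (auto simp: ext_direct_sum_def)
    note a = binary_biproductD[OF bA] and c = binary_biproductD[OF bC]
    have "\<rho> \<in> ext_pairs \<A> \<E> PC PA" using ext_mor_typing[OF pr(1)] unfolding a c by simp
    with r' have r'': "ext_mor \<A> \<E> (Ide \<A> PA) (iC 0 \<boxplus> iC 1) \<rho>' \<rho>" by (simp only: pullback_pair_iff)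
    have "Dom \<A> (iC 0 \<boxplus> iC 1) = C"
      by (subst Add_typing(2)) (simp_all only: c)
    then have "\<rho>' \<in> ext_pairs \<A> \<E> C PA"
      using ext_mor_typing(3)[OF r''] binary_biproduct_Obj[OF bA] by simp
    with t have "ext_mor \<A> \<E> (pA 0 \<boxplus> pA 1) (Ide \<A> C) \<rho>' \<tau>" by (simp only: pushout_pair_iff)
    then show "ext_mor \<A> \<E> (f \<boxplus> f') (Ide \<A> C) \<omega> \<tau>" using key[OF r rE r''] by blast
  next
    assume t: "ext_mor \<A> \<E> (f \<boxplus> f') (Ide \<A> C) \<omega> \<tau>"
    obtain PA iA0 iA1 pA0 pA1 where bA: "binary_biproduct A A PA iA0 iA1 pA0 pA1"
      using binary_biproduct_ex ob by metis
    obtain PC iC0 iC1 pC0 pC1 where bC: "binary_biproduct C C PC iC0 iC1 pC0 pC1"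
      using binary_biproduct_ex ob by metis
    obtain \<rho> where r: "ext_direct_sum i p i' p' PA iA0 iA1 pA0 pA1 PC iC0 iC1 pC0 pC1 \<rho>" "\<rho> \<in> \<E>"
      by (rule ext_direct_sum_ex[OF E(1,4), of PA iA0 iA1 pA0 pA1 PC iC0 iC1 pC0 pC1]) (use bA bC E in simp_all)
    note pr = ext_direct_sum_projections[OF r(1) E(1,4) r(2)]
    note a = binary_biproductD[OF bA] and c = binary_biproductD[OF bC]
    have rP: "\<rho> \<in> ext_pairs \<A> \<E> PC PA" using ext_mor_typing[OF pr(1)] a c by simp
    obtain \<rho>' where r': "ext_mor \<A> \<E> (Ide \<A> PA) (iC0 \<boxplus> iC1) \<rho>' \<rho>"
      by (rule ext_mor_pullback_ex[OF rP, of "iC0 \<boxplus> iC1"]) (use c in simp_all)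
    have r'P: "\<rho>' \<in> ext_pairs \<A> \<E> C PA" using ext_mor_typing[OF r'] binary_biproduct_Obj[OF bA] c by simp
    have "pushout_pair \<A> \<E> (pA0 \<boxplus> pA1) \<rho>' \<tau>" using key[OF r r'] t pushout_pair_iff[OF r'P] by simp
    moreover have "pullback_pair \<A> \<E> (iC0 \<boxplus> iC1) \<rho> \<rho>'" using pullback_pair_iff[OF rP] r' by simp
    moreover define iA pA iC pC :: "nat \<Rightarrow> 'm" where "iA = (\<lambda>n. if n = 0 then iA0 else iA1)"
      "pA = (\<lambda>n. if n = 0 then pA0 else pA1)" "iC = (\<lambda>n. if n = 0 then iC0 else iC1)"
      "pC = (\<lambda>n. if n = 0 then pC0 else pC1)"
    then have v: "iA 0 = iA0" "iA 1 = iA1" "pA 0 = pA0" "pA 1 = pA1"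
      "iC 0 = iC0" "iC 1 = iC1" "pC 0 = pC0" "pC 1 = pC1" by simp_all
    ultimately show "is_baer_sum \<A> \<E> \<sigma> \<sigma>' \<tau>"
      unfolding is_baer_sum_def s direct_sum_pair_iff using r(1) unfolding v[symmetric] by blast
  qed
qed

end

section \<open>Split conflations\<close>

context additive_category
begin

lemma binary_biproduct_kernel_cokernel:
  assumes bp: "binary_biproduct X Y P i0 i1 p0 p1"
  shows "kernel_cokernel_pair \<A> (i0, p1)"
proof -
  note b = binary_biproductD[OF bp] and ob = binary_biproduct_Obj[OF bp] and rb = binary_biproduct_reassoc[OF bp]
  have "is_kernel \<A> i0 p1"
    unfolding is_kernel_def
  proof (intro conjI ballI impI)
    fix Z f assume Z: "Z \<in> Obj \<A>" "f \<in> homset \<A> Z (Dom \<A> p1)" "p1 \<cdot> f = Zero \<A> Z (Cod \<A> p1)"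
    then have f: "f \<in> Arr \<A>" "Dom \<A> f = Z" "Cod \<A> f = P" using b by (simp_all add: homset_def)
    show "\<exists>!g. g \<in> homset \<A> Z (Dom \<A> i0) \<and> i0 \<cdot> g = f"
    proof (rule ex1I[of _ "p0 \<cdot> f"])
      have "i0 \<cdot> (p0 \<cdot> f) = f"
        by (rule binary_biproduct_unique[OF bp]) (use b f Z ob in \<open>simp_all add: rb\<close>)
      then show "p0 \<cdot> f \<in> homset \<A> Z (Dom \<A> i0) \<and> i0 \<cdot> (p0 \<cdot> f) = f"
        using f b by (simp add: homset_def)
    next
      fix g assume "g \<in> homset \<A> Z (Dom \<A> i0) \<and> i0 \<cdot> g = f"
      then show "g = p0 \<cdot> f" using b by (auto simp: homset_def rb)
    qed
  qed (use b in simp_all)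
  moreover have "is_cokernel \<A> p1 i0"
    unfolding is_cokernel_def
  proof (intro conjI ballI impI)
    fix Z f assume Z: "Z \<in> Obj \<A>" "f \<in> homset \<A> (Cod \<A> i0) Z" "f \<cdot> i0 = Zero \<A> (Dom \<A> i0) Z"
    then have f: "f \<in> Arr \<A>" "Dom \<A> f = P" "Cod \<A> f = Z" using b by (simp_all add: homset_def)
    have "f = f \<cdot> (i0 \<cdot> p0 \<boxplus> i1 \<cdot> p1)" using b f by simp
    also have "\<dots> = f \<cdot> i1 \<cdot> p1"
      using b(1-14) f ob Z by (simp add: Comp_reassoc[OF Z(3)])
    finally have ff: "f = f \<cdot> i1 \<cdot> p1" .
    show "\<exists>!g. g \<in> homset \<A> (Cod \<A> p1) Z \<and> g \<cdot> p1 = f"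
    proof (rule ex1I[of _ "f \<cdot> i1"])
      show "f \<cdot> i1 \<in> homset \<A> (Cod \<A> p1) Z \<and> f \<cdot> i1 \<cdot> p1 = f"
        using b f ff by (simp add: homset_def)
    next
      fix g assume "g \<in> homset \<A> (Cod \<A> p1) Z \<and> g \<cdot> p1 = f"
      then show "g = f \<cdot> i1" using b by (auto simp: homset_def)
    qed
  qed (use b in simp_all)
  ultimately show ?thesis by (simp add: kernel_cokernel_pair_def)
qed

lemma iso_arr_Ide: "X \<in> Obj \<A> \<Longrightarrow> iso_arr \<A> X X (Ide \<A> X)"
  unfolding iso_arr_def homset_def by auto

end

context exact_category
begin

text \<open>The axioms mention no split sequences; they only say that the identity of
  \<open>A\<close> begins some conflation, with second arrow \<open>z\<close>. Its pullback along
  the zero arrow \<open>C \<rightarrow> Cod z\<close> is a conflation from \<open>A\<close> to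
  \<open>C\<close> with a retraction \<open>g\<close> and a section \<open>s\<close>, and
  \<open>?v\<close>, \<open>?w\<close> identify it with the biproduct.\<close>

lemma split_conflation:
  assumes bp: "binary_biproduct A C P i0 i1 p0 p1"
  shows "(i0, p1) \<in> \<E>"
proof -
  note b = binary_biproductD[OF bp] and ob = binary_biproduct_Obj[OF bp] and rb = binary_biproduct_reassoc[OF bp]
  obtain z where z: "(Ide \<A> A, z) \<in> \<E>"
    using Ide_admissible_monic[OF ob(1)] by (auto simp: admissible_monic_def)
  note kz = conflation[OF z]
  have z0: "z = Zero \<A> A (Cod \<A> z)" using kz ob by simp
  have dz: "Dom \<A> z = A" using kz ob by simp
  obtain g i' p' where pb: "is_pullback \<A> z (Zero \<A> C (Cod \<A> z)) g p'" and E: "(i', p') \<in> \<E>"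
    and gi: "g \<cdot> i' = Ide \<A> A" and di: "Dom \<A> i' = Dom \<A> (Ide \<A> A)"
    by (rule pullback_conflation[OF z, of "Zero \<A> C (Cod \<A> z)"]) (use kz ob in simp_all)
  note ty = pullback_typing[OF pb] and k = conflation[OF E]
  have t: "g \<in> Arr \<A>" "Dom \<A> g = Dom \<A> p'" "Cod \<A> g = A" "p' \<in> Arr \<A>" "Cod \<A> p' = C"
    "i' \<in> Arr \<A>" "Dom \<A> i' = A" "Cod \<A> i' = Dom \<A> p'" "p' \<cdot> i' = Zero \<A> A C"
    using ty k di ob kz dz by simp_all
  have "z \<cdot> Zero \<A> C A = Zero \<A> C (Cod \<A> z)" using kz(4) dz ob by simp
  then obtain s where s: "s \<in> Arr \<A>" "Dom \<A> s = C" "Cod \<A> s = Dom \<A> p'" "g \<cdot> s = Zero \<A> C A" "p' \<cdot> s = Ide \<A> C"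
    using pullback_factor[OF pb, of "Zero \<A> C A" "Ide \<A> C"] ob kz(4) dz by auto
  let ?w = "i' \<cdot> p0 \<boxplus> s \<cdot> p1" and ?v = "i0 \<cdot> g \<boxplus> i1 \<cdot> p'"
  have pv: "p0 \<cdot> ?v = g" "p1 \<cdot> ?v = p'" using b(1-14) t ob by (simp_all add: rb)
  have wv: "?w \<cdot> ?v = Ide \<A> (Dom \<A> p')"
    by (rule pullback_unique[OF pb])
      (use b(1-14) t s ob in \<open>simp_all add: rb Comp_reassoc[OF gi] Comp_reassoc[OF s(4)] Comp_reassoc[OF s(5)] Comp_reassoc[OF t(9)]\<close>)
  have vw: "?v \<cdot> ?w = Ide \<A> P"
    by (rule binary_biproduct_unique[OF bp])
      (use b(1-14) t s ob in \<open>simp_all add: rb Comp_reassoc[OF gi] Comp_reassoc[OF s(4)] Comp_reassoc[OF s(5)] Comp_reassoc[OF t(9)]\<close>)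
  have "iso_arr \<A> (Dom \<A> p') P ?v"
    unfolding iso_arr_def
    by (intro conjI bexI[of _ ?w]) (use wv vw b t s in \<open>simp_all add: homset_def del: Comp_Add_simp Add_Comp_simp\<close>)
  moreover have "?v \<cdot> i' = i0 \<cdot> Ide \<A> A" using b t gi ob by simp
  moreover have "Ide \<A> C \<cdot> p' = p1 \<cdot> ?v" unfolding pv using t by simp
  ultimately have "iso_pairs \<A> (i', p') (i0, p1)"
    using iso_arr_Ide[OF ob(1)] iso_arr_Ide[OF ob(2)] b t unfolding iso_pairs_def prod.case by metis
  with E_iso_closed[OF E binary_biproduct_kernel_cokernel[OF bp]] show ?thesis by blast
qed

text \<open>The middle arrow \<open>i1 \<cdot> p\<close> vanishes on the kernel. So the split class
  is \<open>0_*[\<sigma>]\<close> for every \<open>\<sigma>\<close>, which makes it neutral once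
  sums of classes are sums of arrows.\<close>

lemma ext_mor_to_split:
  assumes bp: "binary_biproduct A C P i0 i1 p0 p1" and s: "\<sigma> \<in> ext_pairs \<A> \<E> C A'"
  shows "ext_mor \<A> \<E> (Zero \<A> A' A) (Ide \<A> C) \<sigma> (i0, p1)"
proof -
  note b = binary_biproductD[OF bp] and ob = binary_biproduct_Obj[OF bp] and rb = binary_biproduct_reassoc[OF bp]
  obtain i p where sp: "\<sigma> = (i, p)" by (cases \<sigma>)
  have E: "(i, p) \<in> \<E>" "Dom \<A> i = A'" "Cod \<A> p = C" using s by (auto simp: sp ext_pairs_iff)
  note k = conflation[OF E(1)]
  show ?thesis
    unfolding sp by (rule ext_morI[OF E(1) split_conflation[OF bp], where b = "i1 \<cdot> p"])
      (use b k E ob ext_pairs_Obj[OF s] in \<open>simp_all add: rb\<close>)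
qed

text \<open>The unit of Ext is defined as the set of split sequences over all biproducts, and this
  identifies it with a single class. An equivalence transports the whole biproduct structure along
  its invertible middle arrow \<open>w\<close>; conversely two biproducts are compared by
  \<open>j0 \<cdot> p0 \<boxplus> j1 \<cdot> p1\<close>.\<close>

lemma ext_mor_from_split_iff:
  assumes bp: "binary_biproduct A C P i0 i1 p0 p1"
  shows "ext_mor \<A> \<E> (Ide \<A> A) (Ide \<A> C) (i0, p1) \<tau> \<longleftrightarrow>
    (\<exists>Q j q. is_biproduct \<A> [A, C] Q j q \<and> \<tau> = (j 0, q 1))"
proof
  note b = binary_biproductD[OF bp] and ob = binary_biproduct_Obj[OF bp] and rb = binary_biproduct_reassoc[OF bp]
  {
    assume m: "ext_mor \<A> \<E> (Ide \<A> A) (Ide \<A> C) (i0, p1) \<tau>"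
    obtain j q where t: "\<tau> = (j, q)" by (cases \<tau>)
    obtain w where w: "(i0, p1) \<in> \<E>" "(j, q) \<in> \<E>" "Ide \<A> A \<in> Arr \<A>" "Dom \<A> (Ide \<A> A) = Dom \<A> i0" "Cod \<A> (Ide \<A> A) = Dom \<A> j"
      "w \<in> Arr \<A>" "Dom \<A> w = Dom \<A> p1" "Cod \<A> w = Dom \<A> q"
      "Ide \<A> C \<in> Arr \<A>" "Dom \<A> (Ide \<A> C) = Cod \<A> p1" "Cod \<A> (Ide \<A> C) = Cod \<A> q"
      "w \<cdot> i0 = j \<cdot> Ide \<A> A" "q \<cdot> w = Ide \<A> C \<cdot> p1"
      using m unfolding t by (rule ext_morE)
    note k = conflation[OF w(2)]
    have ty: "w \<in> Arr \<A>" "Dom \<A> w = P" "Cod \<A> w = Dom \<A> q" "j \<in> Arr \<A>" "q \<in> Arr \<A>"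
      "Dom \<A> j = A" "Cod \<A> q = C" "Cod \<A> j = Dom \<A> q"
      using w(5-11) b(1-12) k(3-5) ob by simp_all
    have e: "w \<cdot> i0 = j" "q \<cdot> w = p1" using w(12,13) ty b(1-12) ob by simp_all
    obtain c where c: "c \<in> Arr \<A>" "Dom \<A> c = Dom \<A> q" "Cod \<A> c = P"
      "c \<cdot> w = Ide \<A> P" "w \<cdot> c = Ide \<A> (Dom \<A> q)"
      by (rule short_five[OF w(1,2,6-8) e]) (use b in simp_all)
    have qc: "p1 \<cdot> c = q" using Comp_assoc_simp[of c w q] e ty c by simp
    have wc: "w \<cdot> (i0 \<cdot> p0 \<boxplus> i1 \<cdot> p1) \<cdot> c = Ide \<A> (Dom \<A> q)" using b c ty by simp
    have "binary_biproduct A C (Dom \<A> q) (w \<cdot> i0) (w \<cdot> i1) (p0 \<cdot> c) (p1 \<cdot> c)"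
      unfolding binary_biproduct_def
    proof (intro conjI)
      show "w \<cdot> i0 \<cdot> (p0 \<cdot> c) \<boxplus> w \<cdot> i1 \<cdot> (p1 \<cdot> c) = Ide \<A> (Dom \<A> q)"
        unfolding wc[symmetric] using b(1-12) c(1-3) ty(1-3) by simp
    qed (use b c(1-3) ty(1-3) in \<open>simp_all add: Comp_reassoc[OF c(4)]\<close>)
    then have "binary_biproduct A C (Dom \<A> q) j (w \<cdot> i1) (p0 \<cdot> c) q" unfolding e qc .
    from is_biproduct_binaryI[OF this] show "\<exists>Q j q. is_biproduct \<A> [A, C] Q j q \<and> \<tau> = (j 0, q 1)"
      unfolding t by force
  next
    assume "\<exists>Q j q. is_biproduct \<A> [A, C] Q j q \<and> \<tau> = (j 0, q 1)"
    then obtain Q j0 j1 q0 q1 where bq: "binary_biproduct A C Q j0 j1 q0 q1" and t: "\<tau> = (j0, q1)"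
      unfolding is_biproduct_iff_binary by blast
    note c = binary_biproductD[OF bq] and rc = binary_biproduct_reassoc[OF bq]
    show "ext_mor \<A> \<E> (Ide \<A> A) (Ide \<A> C) (i0, p1) \<tau>"
      unfolding t by (rule ext_morI[OF split_conflation[OF bp] split_conflation[OF bq], where b = "j0 \<cdot> p0 \<boxplus> j1 \<cdot> p1"])
        (use b c ob in \<open>simp_all add: rc\<close>)
  }
qed

section \<open>Equivalence classes and the group structure on Ext\<close>

definition ext_class :: "'o \<Rightarrow> 'o \<Rightarrow> 'm \<times> 'm \<Rightarrow> ('m \<times> 'm) set" where
  "ext_class C A \<sigma> = ext_rel \<A> \<E> C A `` {\<sigma>}"

lemma ext_class_iff:
  assumes "\<sigma> \<in> ext_pairs \<A> \<E> C A"
  shows "\<tau> \<in> ext_class C A \<sigma> \<longleftrightarrow> ext_mor \<A> \<E> (Ide \<A> A) (Ide \<A> C) \<sigma> \<tau>"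
proof -
  obtain i p j q where st: "\<sigma> = (i, p)" "\<tau> = (j, q)" by (cases \<sigma>, cases \<tau>) auto
  have ip: "(i, p) \<in> \<E>" "Dom \<A> i = A" "Cod \<A> p = C" using assms by (simp_all add: st ext_pairs_iff)
  note k = conflation[OF ip(1)] and ob = ext_pairs_Obj[OF assms]
  have "\<tau> \<in> ext_class C A \<sigma> \<longleftrightarrow> (j, q) \<in> \<E> \<and> Dom \<A> j = A \<and> Cod \<A> q = C \<and>
      (\<exists>b \<in> homset \<A> (Cod \<A> i) (Cod \<A> j). b \<cdot> i = j \<and> q \<cdot> b = p)"
    using ip by (simp add: ext_class_def ext_rel_def st ext_pairs_iff)
  also have "\<dots> \<longleftrightarrow> ext_mor \<A> \<E> (Ide \<A> A) (Ide \<A> C) \<sigma> \<tau>"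
  proof (cases "(j, q) \<in> \<E> \<and> Dom \<A> j = A \<and> Cod \<A> q = C")
    case True
    then have "j \<cdot> Ide \<A> A = j" "Ide \<A> C \<cdot> p = p"
      using conflation(3)[of j q] k ip by simp_all
    with True show ?thesis using ip ob by (simp add: st ext_mor_def homset_def)
  next
    case False
    then show ?thesis using ip ob by (simp add: st ext_mor_def homset_def) metis
  qed
  finally show ?thesis .
qed

lemma Ext_carrier_iff:
  "S \<in> carrier (Ext_group \<A> \<E> C A) \<longleftrightarrow> (\<exists>\<sigma> \<in> ext_pairs \<A> \<E> C A. S = ext_class C A \<sigma>)"
  by (auto simp: Ext_group_def ext_class_def quotient_def)

text \<open>The left side gathers the pushouts of all representatives. Cancellation against
  \<open>m\<close> makes each of them equivalent to \<open>\<tau>\<close>, and everything equivalent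
  to \<open>\<tau>\<close> is already a pushout of \<open>\<sigma>\<close> itself.\<close>

lemma Ext_push_class:
  assumes \<sigma>: "\<sigma> \<in> ext_pairs \<A> \<E> C A" and \<tau>: "\<tau> \<in> ext_pairs \<A> \<E> C A'"
    and m: "ext_mor \<A> \<E> f (Ide \<A> C) \<sigma> \<tau>"
  shows "Ext_push \<A> \<E> f (ext_class C A \<sigma>) = ext_class C A' \<tau>"
proof -
  note ob = ext_pairs_Obj[OF \<sigma>] ext_pairs_Obj[OF \<tau>]
  have f: "f \<in> Arr \<A>" "Dom \<A> f = A" "Cod \<A> f = A'"
    using ext_mor_typing[OF m] \<sigma> \<tau> by (auto simp: ext_pairs_def)
  have cl: "\<sigma>' \<in> ext_pairs \<A> \<E> C A" if "ext_mor \<A> \<E> (Ide \<A> A) (Ide \<A> C) \<sigma> \<sigma>'" for \<sigma>'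
    using ext_mor_typing(4)[OF that] ob by simp
  have 1: "ext_mor \<A> \<E> (Ide \<A> A') (Ide \<A> C) \<tau> \<tau>'"
    if "ext_mor \<A> \<E> (Ide \<A> A) (Ide \<A> C) \<sigma> \<sigma>'" "ext_mor \<A> \<E> f (Ide \<A> C) \<sigma>' \<tau>'" for \<sigma>' \<tau>'
    by (rule ext_mor_through_pushout[OF m]) (use ext_mor_Comp[OF that] f ob in simp_all)
  have 2: "ext_mor \<A> \<E> f (Ide \<A> C) \<sigma> \<tau>'" if "ext_mor \<A> \<E> (Ide \<A> A') (Ide \<A> C) \<tau> \<tau>'" for \<tau>'
    using ext_mor_Comp[OF m that] f ob by simp
  show ?thesis
  proof (rule Set.set_eqI)
    fix \<tau>'
    have "\<tau>' \<in> Ext_push \<A> \<E> f (ext_class C A \<sigma>) \<longleftrightarrow>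
        (\<exists>\<sigma>'. ext_mor \<A> \<E> (Ide \<A> A) (Ide \<A> C) \<sigma> \<sigma>' \<and> ext_mor \<A> \<E> f (Ide \<A> C) \<sigma>' \<tau>')"
      unfolding Ext_push_def mem_Collect_eq Bex_def ext_class_iff[OF \<sigma>]
      using cl pushout_pair_iff by blast
    also have "\<dots> \<longleftrightarrow> \<tau>' \<in> ext_class C A' \<tau>"
      unfolding ext_class_iff[OF \<tau>] using 1 2 ext_mor_Ide[OF \<sigma>] by blast
    finally show "\<tau>' \<in> Ext_push \<A> \<E> f (ext_class C A \<sigma>) \<longleftrightarrow> \<tau>' \<in> ext_class C A' \<tau>" .
  qed
qed

text \<open>Here the varying representatives sit at the target of the arrows, so the equivalences
  must be reversed with \<open>ext_mor_sym\<close> before cancelling.\<close>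

lemma Ext_pull_class:
  assumes \<sigma>: "\<sigma> \<in> ext_pairs \<A> \<E> C' A" and \<tau>: "\<tau> \<in> ext_pairs \<A> \<E> C A"
    and m: "ext_mor \<A> \<E> (Ide \<A> A) h \<sigma> \<tau>"
  shows "Ext_pull \<A> \<E> h (ext_class C A \<tau>) = ext_class C' A \<sigma>"
proof -
  note ob = ext_pairs_Obj[OF \<sigma>] ext_pairs_Obj[OF \<tau>]
  have h: "h \<in> Arr \<A>" "Dom \<A> h = C'" "Cod \<A> h = C"
    using ext_mor_typing[OF m] \<sigma> \<tau> by (auto simp: ext_pairs_def)
  have cl: "\<tau>' \<in> ext_pairs \<A> \<E> C A" if "ext_mor \<A> \<E> (Ide \<A> A) (Ide \<A> C) \<tau> \<tau>'" for \<tau>'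
    using ext_mor_typing(4)[OF that] ob by simp
  have 1: "ext_mor \<A> \<E> (Ide \<A> A) (Ide \<A> C') \<sigma> \<sigma>'"
    if "ext_mor \<A> \<E> (Ide \<A> A) (Ide \<A> C) \<tau> \<tau>'" "ext_mor \<A> \<E> (Ide \<A> A) h \<sigma>' \<tau>'" for \<sigma>' \<tau>'
  proof -
    have "ext_mor \<A> \<E> (Ide \<A> A) (Ide \<A> C) \<tau>' \<tau>" using ext_mor_sym that ob by blast
    from ext_mor_Comp[OF that(2) this] have "ext_mor \<A> \<E> (Ide \<A> A) (h \<cdot> Ide \<A> C') \<sigma>' \<tau>" using h ob by simp
    then have "ext_mor \<A> \<E> (Ide \<A> A) (Ide \<A> C') \<sigma>' \<sigma>"
      by (rule ext_mor_through_pullback[OF m]) (use h ob in simp_all)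
    then show ?thesis using ext_mor_sym ob by blast
  qed
  have 2: "ext_mor \<A> \<E> (Ide \<A> A) h \<sigma>' \<tau>" if "ext_mor \<A> \<E> (Ide \<A> A) (Ide \<A> C') \<sigma> \<sigma>'" for \<sigma>'
    using ext_mor_Comp[OF ext_mor_sym[OF that] m] h ob by simp
  show ?thesis
  proof (rule Set.set_eqI)
    fix \<sigma>'
    have "\<sigma>' \<in> Ext_pull \<A> \<E> h (ext_class C A \<tau>) \<longleftrightarrow>
        (\<exists>\<tau>'. ext_mor \<A> \<E> (Ide \<A> A) (Ide \<A> C) \<tau> \<tau>' \<and> ext_mor \<A> \<E> (Ide \<A> A) h \<sigma>' \<tau>')"
      unfolding Ext_pull_def mem_Collect_eq Bex_def ext_class_iff[OF \<tau>]
      using cl pullback_pair_iff by blast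
    also have "\<dots> \<longleftrightarrow> \<sigma>' \<in> ext_class C' A \<sigma>"
      unfolding ext_class_iff[OF \<sigma>] using 1 2 ext_mor_Ide[OF \<tau>] by blast
    finally show "\<sigma>' \<in> Ext_pull \<A> \<E> h (ext_class C A \<tau>) \<longleftrightarrow> \<sigma>' \<in> ext_class C' A \<sigma>" .
  qed
qed

text \<open>Composing with an equivalence leaves the components \<open>f\<close> and
  \<open>f'\<close> unchanged, so every choice of representatives is still reached from the same
  \<open>\<omega>\<close> by the same arrows, and \<open>is_baer_sum_iff\<close> gives the same
  outcomes each time.\<close>

lemma Ext_mult_class:
  assumes \<sigma>: "\<sigma> \<in> ext_pairs \<A> \<E> C A" and \<sigma>': "\<sigma>' \<in> ext_pairs \<A> \<E> C A" and \<tau>: "\<tau> \<in> ext_pairs \<A> \<E> C A"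
    and f: "ext_mor \<A> \<E> f (Ide \<A> C) \<omega> \<sigma>" and f': "ext_mor \<A> \<E> f' (Ide \<A> C) \<omega> \<sigma>'"
    and ff': "ext_mor \<A> \<E> (f \<boxplus> f') (Ide \<A> C) \<omega> \<tau>"
  shows "ext_class C A \<sigma> \<otimes>\<^bsub>Ext_group \<A> \<E> C A\<^esub> ext_class C A \<sigma>' = ext_class C A \<tau>"
proof -
  note ob = ext_pairs_Obj[OF \<sigma>]
  have ty: "f \<in> Arr \<A>" "Cod \<A> f = A" "f' \<in> Arr \<A>" "Cod \<A> f' = A" "f \<boxplus> f' \<in> Arr \<A>" "Cod \<A> (f \<boxplus> f') = A"
    using ext_mor_typing[OF f] ext_mor_typing[OF f'] ext_mor_typing[OF ff'] \<sigma> \<sigma>' \<tau> by (auto simp: ext_pairs_def)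
  have baer: "is_baer_sum \<A> \<E> \<sigma>1 \<sigma>2 \<tau>' \<longleftrightarrow> ext_mor \<A> \<E> (Ide \<A> A) (Ide \<A> C) \<tau> \<tau>'"
    if "ext_mor \<A> \<E> (Ide \<A> A) (Ide \<A> C) \<sigma> \<sigma>1" "ext_mor \<A> \<E> (Ide \<A> A) (Ide \<A> C) \<sigma>' \<sigma>2" for \<sigma>1 \<sigma>2 \<tau>'
  proof -
    have "ext_mor \<A> \<E> f (Ide \<A> C) \<omega> \<sigma>1" "ext_mor \<A> \<E> f' (Ide \<A> C) \<omega> \<sigma>2"
      using ext_mor_Comp[OF f that(1)] ext_mor_Comp[OF f' that(2)] ty ob by simp_all
    then have "is_baer_sum \<A> \<E> \<sigma>1 \<sigma>2 \<tau>' \<longleftrightarrow> ext_mor \<A> \<E> (f \<boxplus> f') (Ide \<A> C) \<omega> \<tau>'"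
      using ext_mor_typing(4)[OF that(1)] ext_mor_typing(4)[OF that(2)] ob by (intro is_baer_sum_iff) simp_all
    also have "\<dots> \<longleftrightarrow> ext_mor \<A> \<E> (Ide \<A> A) (Ide \<A> C) \<tau> \<tau>'"
    proof
      assume "ext_mor \<A> \<E> (f \<boxplus> f') (Ide \<A> C) \<omega> \<tau>'"
      then show "ext_mor \<A> \<E> (Ide \<A> A) (Ide \<A> C) \<tau> \<tau>'"
        by (intro ext_mor_through_pushout[OF ff']) (use ty ob in simp_all)
    next
      assume "ext_mor \<A> \<E> (Ide \<A> A) (Ide \<A> C) \<tau> \<tau>'"
      from ext_mor_Comp[OF ff' this] show "ext_mor \<A> \<E> (f \<boxplus> f') (Ide \<A> C) \<omega> \<tau>'" using ty ob by simp
    qed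
    finally show ?thesis .
  qed
  have "ext_class C A \<sigma> \<otimes>\<^bsub>Ext_group \<A> \<E> C A\<^esub> ext_class C A \<sigma>' =
      {\<tau>'. \<exists>\<sigma>1 \<in> ext_class C A \<sigma>. \<exists>\<sigma>2 \<in> ext_class C A \<sigma>'. is_baer_sum \<A> \<E> \<sigma>1 \<sigma>2 \<tau>'}"
    by (simp add: Ext_group_def)
  also have "\<dots> = ext_class C A \<tau>"
    unfolding set_eq_iff mem_Collect_eq Bex_def
      ext_class_iff[OF \<sigma>] ext_class_iff[OF \<sigma>'] ext_class_iff[OF \<tau>]
    using baer ext_mor_Ide[OF \<sigma>] ext_mor_Ide[OF \<sigma>'] by blast
  finally show ?thesis .
qed

lemma Ext_one_class:
  assumes "binary_biproduct A C P i0 i1 p0 p1"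
  shows "(i0, p1) \<in> ext_pairs \<A> \<E> C A" "\<one>\<^bsub>Ext_group \<A> \<E> C A\<^esub> = ext_class C A (i0, p1)"
proof -
  show s: "(i0, p1) \<in> ext_pairs \<A> \<E> C A"
    using split_conflation[OF assms] binary_biproductD[OF assms] by (simp add: ext_pairs_iff)
  show "\<one>\<^bsub>Ext_group \<A> \<E> C A\<^esub> = ext_class C A (i0, p1)"
    using ext_mor_from_split_iff[OF assms] unfolding set_eq_iff ext_class_iff[OF s]
    by (simp add: Ext_group_def) blast
qed

lemma Ext_mult_ex:
  assumes "\<sigma> \<in> ext_pairs \<A> \<E> C A" "\<sigma>' \<in> ext_pairs \<A> \<E> C A"
    and f: "ext_mor \<A> \<E> f (Ide \<A> C) \<omega> \<sigma>" and f': "ext_mor \<A> \<E> f' (Ide \<A> C) \<omega> \<sigma>'"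
  obtains \<tau> where "\<tau> \<in> ext_pairs \<A> \<E> C A" "ext_mor \<A> \<E> (f \<boxplus> f') (Ide \<A> C) \<omega> \<tau>"
    "ext_class C A \<sigma> \<otimes>\<^bsub>Ext_group \<A> \<E> C A\<^esub> ext_class C A \<sigma>' = ext_class C A \<tau>"
proof -
  note ob = ext_pairs_Obj[OF assms(1)]
  have w: "\<omega> \<in> ext_pairs \<A> \<E> C (Dom \<A> f)" "\<omega> \<in> ext_pairs \<A> \<E> C (Dom \<A> f')"
    using ext_mor_typing(3)[OF f] ext_mor_typing(3)[OF f'] ob by simp_all
  have ff: "f \<in> Arr \<A>" "f' \<in> Arr \<A>" "Dom \<A> f = Dom \<A> f'" "Cod \<A> f = A" "Cod \<A> f' = A"
    using ext_mor_typing[OF f] ext_mor_typing[OF f'] assms(1,2) by (auto simp: ext_pairs_def)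
  obtain \<tau> where t: "ext_mor \<A> \<E> (f \<boxplus> f') (Ide \<A> C) \<omega> \<tau>"
    by (rule ext_mor_pushout_ex[OF w(2), of "f \<boxplus> f'"]) (use ff in simp_all)
  then have "\<tau> \<in> ext_pairs \<A> \<E> C A" using ext_mor_typing(4)[OF t] ff ob by simp
  with that t Ext_mult_class[OF assms(1,2) _ f f' t] show ?thesis by blast
qed

lemma Ext_comm_group:
  assumes "C \<in> Obj \<A>" "A \<in> Obj \<A>"
  shows "comm_group (Ext_group \<A> \<E> C A)"
proof -
  let ?G = "Ext_group \<A> \<E> C A"
  obtain P i0 i1 p0 p1 where bp: "binary_biproduct A C P i0 i1 p0 p1"
    using binary_biproduct_ex assms by metis
  note one = Ext_one_class[OF bp]
  show ?thesis
  proof (rule comm_groupI)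
    show "\<one>\<^bsub>?G\<^esub> \<in> carrier ?G" using one by (auto simp: Ext_carrier_iff)
  next
    fix x y assume "x \<in> carrier ?G" "y \<in> carrier ?G"
    then obtain a b where a: "a \<in> ext_pairs \<A> \<E> C A" "x = ext_class C A a"
      and b: "b \<in> ext_pairs \<A> \<E> C A" "y = ext_class C A b" by (auto simp: Ext_carrier_iff)
    obtain w f g where w: "ext_mor \<A> \<E> f (Ide \<A> C) w a" "ext_mor \<A> \<E> g (Ide \<A> C) w b"
      by (rule ext_mor_joint_ex[OF a(1) b(1)])
    obtain t where t: "t \<in> ext_pairs \<A> \<E> C A" "ext_mor \<A> \<E> (f \<boxplus> g) (Ide \<A> C) w t" "x \<otimes>\<^bsub>?G\<^esub> y = ext_class C A t"
      using Ext_mult_ex[OF a(1) b(1) w] a b by metis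
    then show "x \<otimes>\<^bsub>?G\<^esub> y \<in> carrier ?G" by (auto simp: Ext_carrier_iff)
    have "f \<in> Arr \<A>" "g \<in> Arr \<A>" "Dom \<A> f = Dom \<A> g" "Cod \<A> f = Cod \<A> g"
      using ext_mor_typing[OF w(1)] ext_mor_typing[OF w(2)] a b by (auto simp: ext_pairs_def)
    then have "ext_mor \<A> \<E> (g \<boxplus> f) (Ide \<A> C) w t" using t Add_comm by metis
    from Ext_mult_class[OF b(1) a(1) t(1) w(2,1) this] t(3) show "x \<otimes>\<^bsub>?G\<^esub> y = y \<otimes>\<^bsub>?G\<^esub> x"
      using a b by simp
  next
    fix x y z assume "x \<in> carrier ?G" "y \<in> carrier ?G" "z \<in> carrier ?G"
    then obtain a b c where a: "a \<in> ext_pairs \<A> \<E> C A" "x = ext_class C A a"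
      and b: "b \<in> ext_pairs \<A> \<E> C A" "y = ext_class C A b"
      and c: "c \<in> ext_pairs \<A> \<E> C A" "z = ext_class C A c" by (auto simp: Ext_carrier_iff)
    \<comment> \<open>Two rounds give a common source \<open>w\<close> for three extensions:
      \<open>v\<close> lies over \<open>a\<close> and \<open>b\<close>, then \<open>w\<close> lies
      over \<open>v\<close> and \<open>c\<close>. Associativity becomes that of adding the arrows
      \<open>f \<cdot> k\<close>, \<open>g \<cdot> k\<close> and \<open>l\<close>.\<close>
    obtain v f g where v: "ext_mor \<A> \<E> f (Ide \<A> C) v a" "ext_mor \<A> \<E> g (Ide \<A> C) v b"
      by (rule ext_mor_joint_ex[OF a(1) b(1)])
    have "v \<in> ext_pairs \<A> \<E> C (Dom \<A> f)" using ext_mor_typing(3)[OF v(1)] assms by simp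
    then obtain w k l where w: "ext_mor \<A> \<E> k (Ide \<A> C) w v" "ext_mor \<A> \<E> l (Ide \<A> C) w c"
      by (rule ext_mor_joint_ex[OF _ c(1)])
    have wa: "ext_mor \<A> \<E> (f \<cdot> k) (Ide \<A> C) w a" and wb: "ext_mor \<A> \<E> (g \<cdot> k) (Ide \<A> C) w b"
      using ext_mor_Comp[OF w(1) v(1)] ext_mor_Comp[OF w(1) v(2)] assms by simp_all
    have ty: "f \<cdot> k \<in> Arr \<A>" "g \<cdot> k \<in> Arr \<A>" "l \<in> Arr \<A>"
      "Dom \<A> (f \<cdot> k) = Dom \<A> l" "Cod \<A> (f \<cdot> k) = A" "Dom \<A> (g \<cdot> k) = Dom \<A> l" "Cod \<A> (g \<cdot> k) = A" "Cod \<A> l = A"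
      using ext_mor_typing[OF wa] ext_mor_typing[OF wb] ext_mor_typing[OF w(2)] a b c by (auto simp: ext_pairs_def)
    obtain s where s: "s \<in> ext_pairs \<A> \<E> C A" "ext_mor \<A> \<E> (f \<cdot> k \<boxplus> g \<cdot> k) (Ide \<A> C) w s"
      "ext_class C A a \<otimes>\<^bsub>?G\<^esub> ext_class C A b = ext_class C A s"
      by (rule Ext_mult_ex[OF a(1) b(1) wa wb])
    obtain s' where s': "s' \<in> ext_pairs \<A> \<E> C A" "ext_mor \<A> \<E> (g \<cdot> k \<boxplus> l) (Ide \<A> C) w s'"
      "ext_class C A b \<otimes>\<^bsub>?G\<^esub> ext_class C A c = ext_class C A s'"
      by (rule Ext_mult_ex[OF b(1) c(1) wb w(2)])
    obtain t where t: "t \<in> ext_pairs \<A> \<E> C A" "ext_mor \<A> \<E> (f \<cdot> k \<boxplus> g \<cdot> k \<boxplus> l) (Ide \<A> C) w t"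
      "ext_class C A s \<otimes>\<^bsub>?G\<^esub> ext_class C A c = ext_class C A t"
      by (rule Ext_mult_ex[OF s(1) c(1) s(2) w(2)])
    have "ext_mor \<A> \<E> (f \<cdot> k \<boxplus> (g \<cdot> k \<boxplus> l)) (Ide \<A> C) w t"
      using t(2) Add_assoc[of "f \<cdot> k" "g \<cdot> k" l] ty by simp
    from Ext_mult_class[OF a(1) s'(1) t(1) wa s'(2) this]
    show "x \<otimes>\<^bsub>?G\<^esub> y \<otimes>\<^bsub>?G\<^esub> z = x \<otimes>\<^bsub>?G\<^esub> (y \<otimes>\<^bsub>?G\<^esub> z)"
      using a b c s s' t by simp
  next
    fix x assume "x \<in> carrier ?G"
    then obtain a where a: "a \<in> ext_pairs \<A> \<E> C A" "x = ext_class C A a" by (auto simp: Ext_carrier_iff)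
    note za = ext_mor_to_split[OF bp a(1)] and ia = ext_mor_Ide[OF a(1)]
    have "ext_mor \<A> \<E> (Zero \<A> A A \<boxplus> Ide \<A> A) (Ide \<A> C) a a" using ia assms by simp
    from Ext_mult_class[OF one(1) a(1) a(1) za ia this]
    show "\<one>\<^bsub>?G\<^esub> \<otimes>\<^bsub>?G\<^esub> x = x" using one a by simp
    \<comment> \<open>The inverse is the pushout along \<open>-1\<close>: adding the identity gives
      the zero arrow, whose pushout is the split class.\<close>
    obtain b where nb: "ext_mor \<A> \<E> (neg (Ide \<A> A)) (Ide \<A> C) a b"
      by (rule ext_mor_pushout_ex[OF a(1), of "neg (Ide \<A> A)"]) (use assms in simp_all)
    then have b: "b \<in> ext_pairs \<A> \<E> C A" using ext_mor_typing(4)[OF nb] assms by simp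
    have "ext_mor \<A> \<E> (neg (Ide \<A> A) \<boxplus> Ide \<A> A) (Ide \<A> C) a (i0, p1)" using za assms by simp
    from Ext_mult_class[OF b a(1) one(1) nb ia this]
    have "ext_class C A b \<otimes>\<^bsub>?G\<^esub> x = \<one>\<^bsub>?G\<^esub>" using one a by simp
    with b show "\<exists>y \<in> carrier ?G. y \<otimes>\<^bsub>?G\<^esub> x = \<one>\<^bsub>?G\<^esub>"
      by (intro bexI[of _ "ext_class C A b"]) (auto simp: Ext_carrier_iff)
  qed
qed

end

section \<open>The functor Ext\<close>

lemma homset_op_prod_iff:
  "(h, f) \<in> homset (prod_cat (op_cat \<A>) \<A>) (C, A) (C', A') \<longleftrightarrow> h \<in> homset \<A> C' C \<and> f \<in> homset \<A> A A'"
  by (auto simp: homset_def prod_cat_def op_cat_def)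

lemma Obj_op_prod_iff:
  "(C, A) \<in> Obj (prod_cat (op_cat \<A>) \<A>) \<longleftrightarrow> C \<in> Obj \<A> \<and> A \<in> Obj \<A>"
  by (auto simp: prod_cat_def op_cat_def)

context exact_category
begin

lemma Ext_on_arr_class:
  assumes \<sigma>: "\<sigma> \<in> ext_pairs \<A> \<E> C A"
    and \<rho>: "ext_mor \<A> \<E> (Ide \<A> A) h \<rho> \<sigma>" and \<tau>: "ext_mor \<A> \<E> f (Ide \<A> C') \<rho> \<tau>"
    and "C' \<in> Obj \<A>"
  shows "on_arr (Ext \<A> \<E>) (h, f) (ext_class C A \<sigma>) = ext_class C' (Cod \<A> f) \<tau>"
    "\<tau> \<in> ext_pairs \<A> \<E> C' (Cod \<A> f)"
proof -
  note ob = ext_pairs_Obj[OF \<sigma>]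
  have r: "\<rho> \<in> ext_pairs \<A> \<E> C' A"
    using ext_mor_typing(3)[OF \<rho>] ext_mor_typing(3)[OF \<tau>] ob assms(4) by (auto simp: ext_pairs_def)
  show t: "\<tau> \<in> ext_pairs \<A> \<E> C' (Cod \<A> f)"
    using ext_mor_typing(4)[OF \<tau>] assms(4) by simp
  show "on_arr (Ext \<A> \<E>) (h, f) (ext_class C A \<sigma>) = ext_class C' (Cod \<A> f) \<tau>"
    by (simp add: Ext_def Ext_pull_class[OF r \<sigma> \<rho>] Ext_push_class[OF r t \<tau>])
qed

lemma Ext_on_arr_ex:
  assumes \<sigma>: "\<sigma> \<in> ext_pairs \<A> \<E> C A" and h: "h \<in> homset \<A> C' C" and f: "f \<in> homset \<A> A A'"
  obtains \<rho> \<tau> where "ext_mor \<A> \<E> (Ide \<A> A) h \<rho> \<sigma>" "ext_mor \<A> \<E> f (Ide \<A> C') \<rho> \<tau>"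
    "\<rho> \<in> ext_pairs \<A> \<E> C' A" "\<tau> \<in> ext_pairs \<A> \<E> C' A'"
    "on_arr (Ext \<A> \<E>) (h, f) (ext_class C A \<sigma>) = ext_class C' A' \<tau>"
proof -
  note ob = ext_pairs_Obj[OF \<sigma>]
  have ty: "h \<in> Arr \<A>" "Dom \<A> h = C'" "Cod \<A> h = C" "f \<in> Arr \<A>" "Dom \<A> f = A" "Cod \<A> f = A'"
    using h f by (auto simp: homset_def)
  have C': "C' \<in> Obj \<A>" using ty by auto
  obtain \<rho> where r: "ext_mor \<A> \<E> (Ide \<A> A) h \<rho> \<sigma>" by (rule ext_mor_pullback_ex[OF \<sigma> ty(1,3)])
  then have r': "\<rho> \<in> ext_pairs \<A> \<E> C' A" using ext_mor_typing(3)[OF r] ty ob by simp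
  obtain \<tau> where t: "ext_mor \<A> \<E> f (Ide \<A> C') \<rho> \<tau>" by (rule ext_mor_pushout_ex[OF r' ty(4,5)])
  show ?thesis
    using that[OF r t r'] Ext_on_arr_class[OF \<sigma> r t C'] ty by simp
qed

text \<open>Everything is expressed through the single extension \<open>v\<close>, the pullback of
  the common source \<open>w\<close>. Since pulling back commutes with pushing out (the local fact
  \<open>push\<close>), the claim reduces to \<open>f \<cdot> (k \<boxplus> l) = f \<cdot> k
  \<boxplus> f \<cdot> l\<close>.\<close>

lemma Ext_on_arr_mult:
  assumes x: "x \<in> carrier (Ext_group \<A> \<E> C A)" and y: "y \<in> carrier (Ext_group \<A> \<E> C A)"
    and h: "h \<in> homset \<A> C' C" and f: "f \<in> homset \<A> A A'"
  shows "on_arr (Ext \<A> \<E>) (h, f) (x \<otimes>\<^bsub>Ext_group \<A> \<E> C A\<^esub> y) =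
    on_arr (Ext \<A> \<E>) (h, f) x \<otimes>\<^bsub>Ext_group \<A> \<E> C' A'\<^esub> on_arr (Ext \<A> \<E>) (h, f) y"
proof -
  obtain a b where a: "a \<in> ext_pairs \<A> \<E> C A" "x = ext_class C A a"
    and b: "b \<in> ext_pairs \<A> \<E> C A" "y = ext_class C A b" using x y by (auto simp: Ext_carrier_iff)
  note ob = ext_pairs_Obj[OF a(1)]
  have ty: "h \<in> Arr \<A>" "Dom \<A> h = C'" "Cod \<A> h = C" "f \<in> Arr \<A>" "Dom \<A> f = A" "Cod \<A> f = A'"
    using h f by (auto simp: homset_def)
  have C': "C' \<in> Obj \<A>" using ty by auto
  obtain w k l where w: "ext_mor \<A> \<E> k (Ide \<A> C) w a" "ext_mor \<A> \<E> l (Ide \<A> C) w b"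
    by (rule ext_mor_joint_ex[OF a(1) b(1)])
  obtain t where t: "t \<in> ext_pairs \<A> \<E> C A" "ext_mor \<A> \<E> (k \<boxplus> l) (Ide \<A> C) w t" "x \<otimes>\<^bsub>Ext_group \<A> \<E> C A\<^esub> y = ext_class C A t"
    using Ext_mult_ex[OF a(1) b(1) w] a b by metis
  have kl: "k \<in> Arr \<A>" "l \<in> Arr \<A>" "Dom \<A> k = Dom \<A> l" "Cod \<A> k = A" "Cod \<A> l = A"
    using ext_mor_typing[OF w(1)] ext_mor_typing[OF w(2)] a b by (auto simp: ext_pairs_def)
  have wP: "w \<in> ext_pairs \<A> \<E> C (Dom \<A> l)" using ext_mor_typing(3)[OF w(2)] ob by simp
  obtain v where v: "ext_mor \<A> \<E> (Ide \<A> (Dom \<A> l)) h v w" by (rule ext_mor_pullback_ex[OF wP ty(1,3)])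
  have push: "ext_mor \<A> \<E> (f \<cdot> g) (Ide \<A> C') v \<tau>"
    if g: "ext_mor \<A> \<E> g (Ide \<A> C) w \<sigma>" "g \<in> Arr \<A>" "Dom \<A> g = Dom \<A> l" "Cod \<A> g = A"
      and \<rho>: "ext_mor \<A> \<E> (Ide \<A> A) h \<rho> \<sigma>" "ext_mor \<A> \<E> f (Ide \<A> C') \<rho> \<tau>" for g \<sigma> \<rho> \<tau>
  proof -
    have "ext_mor \<A> \<E> g (h \<cdot> Ide \<A> C') v \<sigma>" using ext_mor_Comp[OF v g(1)] g ty ob by simp
    then have "ext_mor \<A> \<E> g (Ide \<A> C') v \<rho>"
      by (rule ext_mor_through_pullback[OF \<rho>(1)]) (use ty C' ob in simp_all)
    from ext_mor_Comp[OF this \<rho>(2)] show ?thesis using C' by simp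
  qed
  obtain a1 a2 where a': "ext_mor \<A> \<E> (Ide \<A> A) h a1 a" "ext_mor \<A> \<E> f (Ide \<A> C') a1 a2" "a2 \<in> ext_pairs \<A> \<E> C' A'"
    "on_arr (Ext \<A> \<E>) (h, f) x = ext_class C' A' a2"
    unfolding a(2) by (rule Ext_on_arr_ex[OF a(1) h f])
  obtain b1 b2 where b': "ext_mor \<A> \<E> (Ide \<A> A) h b1 b" "ext_mor \<A> \<E> f (Ide \<A> C') b1 b2" "b2 \<in> ext_pairs \<A> \<E> C' A'"
    "on_arr (Ext \<A> \<E>) (h, f) y = ext_class C' A' b2"
    unfolding b(2) by (rule Ext_on_arr_ex[OF b(1) h f])
  obtain t1 t2 where t': "ext_mor \<A> \<E> (Ide \<A> A) h t1 t" "ext_mor \<A> \<E> f (Ide \<A> C') t1 t2" "t2 \<in> ext_pairs \<A> \<E> C' A'"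
    "on_arr (Ext \<A> \<E>) (h, f) (ext_class C A t) = ext_class C' A' t2"
    by (rule Ext_on_arr_ex[OF t(1) h f])
  have "ext_mor \<A> \<E> (f \<cdot> k \<boxplus> f \<cdot> l) (Ide \<A> C') v t2"
    using push[OF t(2) _ _ _ t'(1,2)] kl ty by simp
  from Ext_mult_class[OF a'(3) b'(3) t'(3) push[OF w(1) _ _ _ a'(1,2)] push[OF w(2) _ _ _ b'(1,2)] this]
  show ?thesis using kl a' b' t' t by simp
qed

text \<open>The right side pulls, pushes, pulls and pushes, so the two inner operations must be
  exchanged. The composite \<open>a2 \<rightarrow> a1 \<rightarrow> b\<close> lies over
  \<open>h'\<close> and therefore factors through the pullback \<open>b1\<close> of
  \<open>b\<close>, which exhibits \<open>b1\<close> as a pushout of \<open>a2\<close> along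
  \<open>f\<close>.\<close>

lemma Ext_on_arr_Comp:
  assumes x: "x \<in> carrier (Ext_group \<A> \<E> C A)"
    and h: "h \<in> homset \<A> C' C" and f: "f \<in> homset \<A> A A'"
    and h': "h' \<in> homset \<A> C'' C'" and f': "f' \<in> homset \<A> A' A''"
  shows "on_arr (Ext \<A> \<E>) (h \<cdot> h', f' \<cdot> f) x = on_arr (Ext \<A> \<E>) (h', f') (on_arr (Ext \<A> \<E>) (h, f) x)"
proof -
  obtain a where a: "a \<in> ext_pairs \<A> \<E> C A" "x = ext_class C A a" using x by (auto simp: Ext_carrier_iff)
  note ob = ext_pairs_Obj[OF a(1)]
  have ty: "h \<in> Arr \<A>" "Dom \<A> h = C'" "Cod \<A> h = C" "f \<in> Arr \<A>" "Dom \<A> f = A" "Cod \<A> f = A'"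
    "h' \<in> Arr \<A>" "Dom \<A> h' = C''" "Cod \<A> h' = C'" "f' \<in> Arr \<A>" "Dom \<A> f' = A'" "Cod \<A> f' = A''"
    using h f h' f' by (auto simp: homset_def)
  have ob': "C' \<in> Obj \<A>" "A' \<in> Obj \<A>" "C'' \<in> Obj \<A>" using ty by auto
  obtain a1 b where b: "ext_mor \<A> \<E> (Ide \<A> A) h a1 a" "ext_mor \<A> \<E> f (Ide \<A> C') a1 b"
    "a1 \<in> ext_pairs \<A> \<E> C' A" "b \<in> ext_pairs \<A> \<E> C' A'"
    "on_arr (Ext \<A> \<E>) (h, f) x = ext_class C' A' b"
    unfolding a(2) by (rule Ext_on_arr_ex[OF a(1) h f])
  obtain b1 c where c: "ext_mor \<A> \<E> (Ide \<A> A') h' b1 b" "ext_mor \<A> \<E> f' (Ide \<A> C'') b1 c"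
    "on_arr (Ext \<A> \<E>) (h', f') (ext_class C' A' b) = ext_class C'' A'' c"
    by (rule Ext_on_arr_ex[OF b(4) h' f'])
  obtain a2 where a2: "ext_mor \<A> \<E> (Ide \<A> A) h' a2 a1"
    by (rule ext_mor_pullback_ex[OF b(3) ty(7,9)])
  have "ext_mor \<A> \<E> f (h' \<cdot> Ide \<A> C'') a2 b"
    using ext_mor_Comp[OF a2 b(2)] ty ob ob' by simp
  then have "ext_mor \<A> \<E> f (Ide \<A> C'') a2 b1"
    by (rule ext_mor_through_pullback[OF c(1)]) (use ty ob' in simp_all)
  from ext_mor_Comp[OF this c(2)] have 1: "ext_mor \<A> \<E> (f' \<cdot> f) (Ide \<A> C'') a2 c" using ob' by simp
  have 2: "ext_mor \<A> \<E> (Ide \<A> A) (h \<cdot> h') a2 a" using ext_mor_Comp[OF a2 b(1)] ob by simp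
  show ?thesis using Ext_on_arr_class(1)[OF a(1) 2 1 ob'(3)] a b c ty by simp
qed

lemma ab_functor_Ext: "ab_functor (prod_cat (op_cat \<A>) \<A>) (Ext \<A> \<E>)"
proof -
  interpret P: category "prod_cat (op_cat \<A>) \<A>"
    by (intro category_prod_cat category_op_cat) unfold_locales
  have on_obj: "on_obj (Ext \<A> \<E>) (C, A) = Ext_group \<A> \<E> C A" for C A by (simp add: Ext_def)
  show ?thesis
  proof (intro ab_functor.intro ab_functor_axioms.intro)
    show "category (prod_cat (op_cat \<A>) \<A>)" by unfold_locales
  next
    fix X assume "X \<in> Obj (prod_cat (op_cat \<A>) \<A>)"
    then show "comm_group (on_obj (Ext \<A> \<E>) X)"
      by (cases X) (simp add: on_obj Obj_op_prod_iff Ext_comm_group)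
  next
    fix g X Y assume g: "g \<in> homset (prod_cat (op_cat \<A>) \<A>) X Y"
    obtain h f C A C' A' where s: "g = (h, f)" "X = (C, A)" "Y = (C', A')" by (cases g, cases X, cases Y) auto
    have hf: "h \<in> homset \<A> C' C" "f \<in> homset \<A> A A'" using g by (auto simp: s homset_op_prod_iff)
    show "on_arr (Ext \<A> \<E>) g \<in> hom (on_obj (Ext \<A> \<E>) X) (on_obj (Ext \<A> \<E>) Y)"
      unfolding s on_obj
    proof (rule homI)
      fix x assume "x \<in> carrier (Ext_group \<A> \<E> C A)"
      then obtain a where a: "a \<in> ext_pairs \<A> \<E> C A" "x = ext_class C A a" by (auto simp: Ext_carrier_iff)
      show "on_arr (Ext \<A> \<E>) (h, f) x \<in> carrier (Ext_group \<A> \<E> C' A')"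
        unfolding a(2) Ext_carrier_iff by (rule Ext_on_arr_ex[OF a(1) hf]) blast
    qed (use Ext_on_arr_mult hf in blast)
  next
    fix X x assume "X \<in> Obj (prod_cat (op_cat \<A>) \<A>)" "x \<in> carrier (on_obj (Ext \<A> \<E>) X)"
    then obtain C A a where s: "X = (C, A)" "C \<in> Obj \<A>" "A \<in> Obj \<A>" "a \<in> ext_pairs \<A> \<E> C A" "x = ext_class C A a"
      by (cases X) (auto simp: Obj_op_prod_iff on_obj Ext_carrier_iff)
    note m = ext_mor_Ide[OF s(4)]
    show "on_arr (Ext \<A> \<E>) (Ide (prod_cat (op_cat \<A>) \<A>) X) x = x"
      using Ext_on_arr_class(1)[OF s(4) m m s(2)] s by (simp add: prod_cat_def op_cat_def)
  next
    fix g X Y g' Z x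
    assume "g \<in> homset (prod_cat (op_cat \<A>) \<A>) X Y" "g' \<in> homset (prod_cat (op_cat \<A>) \<A>) Y Z"
      "x \<in> carrier (on_obj (Ext \<A> \<E>) X)"
    moreover obtain h f C A C' A' h' f' C'' A'' where
      s: "g = (h, f)" "X = (C, A)" "Y = (C', A')" "g' = (h', f')" "Z = (C'', A'')"
      by (cases g, cases X, cases Y, cases g', cases Z) auto
    ultimately have "x \<in> carrier (Ext_group \<A> \<E> C A)" "h \<in> homset \<A> C' C" "f \<in> homset \<A> A A'"
      "h' \<in> homset \<A> C'' C'" "f' \<in> homset \<A> A' A''"
      by (auto simp: homset_op_prod_iff on_obj)
    from Ext_on_arr_Comp[OF this]
    show "on_arr (Ext \<A> \<E>) (g' \<cdot>\<^bsub>prod_cat (op_cat \<A>) \<A>\<^esub> g) x = on_arr (Ext \<A> \<E>) g' (on_arr (Ext \<A> \<E>) g x)"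
      by (simp add: s prod_cat_def op_cat_def)
  qed
qed

end

section \<open>Subfunctors from stable families of subgroups\<close>

lemma subfunctor_via_restrict:
  assumes F: "ab_functor \<D> F"
    and sub: "\<And>X. X \<in> Obj \<D> \<Longrightarrow> subgroup (H X) (on_obj F X)"
    and arr: "\<And>X Y f x. \<lbrakk>f \<in> homset \<D> X Y; x \<in> H X\<rbrakk> \<Longrightarrow> on_arr F f x \<in> H Y"
  shows "subfunctor_via \<D> \<lparr>on_obj = (\<lambda>X. (on_obj F X)\<lparr>carrier := H X\<rparr>), on_arr = on_arr F\<rparr> F (\<lambda>X x. x)"
proof -
  interpret ab_functor \<D> F by fact
  have H: "H X \<subseteq> carrier (on_obj F X)" if "X \<in> Obj \<D>" for X
    using subgroup.subset[OF sub[OF that]] .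
  let ?G = "\<lparr>on_obj = (\<lambda>X. (on_obj F X)\<lparr>carrier := H X\<rparr>), on_arr = on_arr F\<rparr>"
  have "ab_functor \<D> ?G"
  proof (intro ab_functor.intro ab_functor_axioms.intro)
    show "category \<D>" by unfold_locales
  next
    fix X assume X: "X \<in> Obj \<D>"
    interpret C: comm_group "on_obj F X" using X by (rule on_obj_comm_group)
    have "group ((on_obj F X)\<lparr>carrier := H X\<rparr>)" using sub[OF X] by (rule C.subgroup_imp_group)
    then have "comm_group ((on_obj F X)\<lparr>carrier := H X\<rparr>)"
      by (rule group.group_comm_groupI) (use H[OF X] C.m_comm in auto)
    then show "comm_group (on_obj ?G X)" by simp
  next
    fix f X Y assume f: "f \<in> homset \<D> X Y"
    then have "X \<in> Obj \<D>" by (auto simp: homset_def)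
    from H[OF this] show "on_arr ?G f \<in> hom (on_obj ?G X) (on_obj ?G Y)"
      using on_arr_hom[OF f] arr[OF f] by (auto simp: hom_def Pi_def subset_iff)
  next
    fix X x assume "X \<in> Obj \<D>" "x \<in> carrier (on_obj ?G X)"
    then show "on_arr ?G (Ide \<D> X) x = x" using on_arr_Ide[of X x] H[of X] by auto
  next
    fix f X Y g Z x
    assume f: "f \<in> homset \<D> X Y" and gx: "g \<in> homset \<D> Y Z" "x \<in> carrier (on_obj ?G X)"
    then have "X \<in> Obj \<D>" by (auto simp: homset_def)
    from H[OF this] show "on_arr ?G (g \<cdot>\<^bsub>\<D>\<^esub> f) x = on_arr ?G g (on_arr ?G f x)"
      using on_arr_Comp[OF f gx(1), of x] gx(2) by auto
  qed
  with F H show ?thesis unfolding subfunctor_via_def by (auto simp: hom_def inj_on_def)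
qed

section \<open>Additive pairs\<close>

text \<open>Both assumptions are self-dual. As a locale they can be interpreted in the opposite
  category too, which turns the result for pushouts into the one for pullbacks.\<close>

locale subadditive_function = exact_category \<A> \<E>
  for \<A> :: "('o, 'm, 'z) add_cat_scheme" (structure) and \<E> :: "('m \<times> 'm) set" +
  fixes \<phi> :: "'o \<Rightarrow> int"
  assumes biproduct_additive: "is_biproduct \<A> [X, Y] P j q \<Longrightarrow> \<phi> P = \<phi> X + \<phi> Y"
    and subadditive: "(i, p) \<in> \<E> \<Longrightarrow> \<phi> (Cod \<A> i) \<le> \<phi> (Dom \<A> i) + \<phi> (Cod \<A> p)"
begin

text \<open>
  Subadditivity is applied to the conflation \<open>A \<rightarrow> A' \<oplus> B \<rightarrow> B'\<close> of a pushout square. It gives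
  \<open>\<phi> B' \<ge> \<phi> A' + \<phi> B - \<phi> A = \<phi> A' + \<phi> C\<close>.
\<close>

lemma additive_pairs_push:
  assumes m: "ext_mor \<A> \<E> f (Ide \<A> C) \<sigma> \<tau>" and C: "C \<in> Obj \<A>" and \<sigma>: "\<sigma> \<in> additive_pairs \<A> \<E> \<phi>"
  shows "\<tau> \<in> additive_pairs \<A> \<E> \<phi>"
proof -
  obtain i p i' p' where s: "\<sigma> = (i, p)" "\<tau> = (i', p')" by (cases \<sigma>, cases \<tau>) auto
  obtain b where b: "(i, p) \<in> \<E>" "(i', p') \<in> \<E>"
    "f \<in> Arr \<A>" "Dom \<A> f = Dom \<A> i" "Cod \<A> f = Dom \<A> i'"
    "b \<in> Arr \<A>" "Dom \<A> b = Dom \<A> p" "Cod \<A> b = Dom \<A> p'"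
    "Ide \<A> C \<in> Arr \<A>" "Dom \<A> (Ide \<A> C) = Cod \<A> p" "Cod \<A> (Ide \<A> C) = Cod \<A> p'"
    "b \<cdot> i = i' \<cdot> f" "p' \<cdot> b = Ide \<A> C \<cdot> p" using m unfolding s by (rule ext_morE)
  note k = conflation[OF b(1)] and k' = conflation[OF b(2)]
  have c: "Cod \<A> p' = Cod \<A> p" using b(10,11) C by simp
  have "p' \<cdot> b = p" using b(13) C b(10) k by simp
  then obtain j q l s r t where
    bp: "is_biproduct \<A> [Dom \<A> i', Dom \<A> p] (Dom \<A> q) (\<lambda>n. if n = 0 then l else s) (\<lambda>n. if n = 0 then r else t)"
    and jq: "(j, q) \<in> \<E>" "Dom \<A> j = Dom \<A> i" "Cod \<A> q = Dom \<A> p'"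
    by (rule morphism_over_identity[OF b(1,2) c b(3-8) b(12)]) blast
  have "\<phi> (Dom \<A> i') + \<phi> (Dom \<A> p) \<le> \<phi> (Dom \<A> i) + \<phi> (Dom \<A> p')"
    using subadditive[OF jq(1)] biproduct_additive[OF bp] jq conflation(5)[OF jq(1)] by simp
  moreover have "\<phi> (Dom \<A> p) = \<phi> (Dom \<A> i) + \<phi> (Cod \<A> p)"
    using \<sigma> k by (simp add: s additive_pairs_def)
  ultimately show ?thesis using subadditive[OF b(2)] b(2) k' c by (simp add: s additive_pairs_def)
qed

text \<open>In the opposite category this is \<open>additive_pairs_push\<close>: additivity is
  symmetric in the two ends of a sequence, so it survives the swap.\<close>

lemma additive_pairs_pull:
  assumes m: "ext_mor \<A> \<E> (Ide \<A> A) h \<sigma> \<tau>" and A: "A \<in> Obj \<A>" and \<tau>: "\<tau> \<in> additive_pairs \<A> \<E> \<phi>"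
  shows "\<sigma> \<in> additive_pairs \<A> \<E> \<phi>"
proof -
  interpret op: exact_category "op_add_cat \<A>" "\<E>\<inverse>"
    by (rule exact_category_op) unfold_locales
  interpret op: subadditive_function "op_add_cat \<A>" "\<E>\<inverse>" \<phi>
  proof
    fix X Y P i p
    assume "is_biproduct (op_add_cat \<A>) [X, Y] P i p"
    then show "\<phi> P = \<phi> X + \<phi> Y"
      by (intro biproduct_additive[of X Y P p i]) (auto simp: is_biproduct_pair_iff op.is_biproduct_pair_iff)
  next
    fix p i
    assume "(p, i) \<in> \<E>\<inverse>"
    then show "\<phi> (Cod (op_add_cat \<A>) p) \<le> \<phi> (Dom (op_add_cat \<A>) p) + \<phi> (Cod (op_add_cat \<A>) i)"
      using subadditive[of i p] conflation(5)[of i p] by simp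
  qed
  have sw: "prod.swap \<rho> \<in> additive_pairs (op_add_cat \<A>) (\<E>\<inverse>) \<phi> \<longleftrightarrow> \<rho> \<in> additive_pairs \<A> \<E> \<phi>" for \<rho>
    using conflation(5)[of "fst \<rho>" "snd \<rho>"] by (cases \<rho>) (auto simp: additive_pairs_def)
  have "prod.swap \<sigma> \<in> additive_pairs (op_add_cat \<A>) (\<E>\<inverse>) \<phi>"
    by (rule op.additive_pairs_push[where f = h and C = A and \<sigma> = "prod.swap \<tau>"])
      (use m A \<tau> in \<open>simp_all add: ext_mor_op sw\<close>)
  then show ?thesis by (simp add: sw)
qed

text \<open>All three terms of the direct sum are biproducts, so adding the equations for
  \<open>\<sigma>\<close> and \<open>\<sigma>'\<close> makes it additive; the pullback along the
  diagonal and the pushout along the codiagonal then preserve this.\<close>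

lemma additive_pairs_baer_sum:
  assumes m: "is_baer_sum \<A> \<E> \<sigma> \<sigma>' \<tau>" and \<sigma>: "\<sigma> \<in> additive_pairs \<A> \<E> \<phi>" "\<sigma>' \<in> additive_pairs \<A> \<E> \<phi>"
  shows "\<tau> \<in> additive_pairs \<A> \<E> \<phi>"
proof -
  obtain i p i' p' where s: "\<sigma> = (i, p)" "\<sigma>' = (i', p')" by (cases \<sigma>, cases \<sigma>') auto
  obtain PA PC \<rho> \<rho>' and iA pA iC pC :: "nat \<Rightarrow> 'm" where
    r: "direct_sum_pair \<A> (i, p) (i', p') (PA, iA, pA) (PC, iC, pC) \<rho>"
    and r': "pullback_pair \<A> \<E> (iC 0 \<boxplus> iC 1) \<rho> \<rho>'" and t: "pushout_pair \<A> \<E> (pA 0 \<boxplus> pA 1) \<rho>' \<tau>"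
    using m unfolding is_baer_sum_def s by blast
  have E: "(i, p) \<in> \<E>" "(i', p') \<in> \<E>" "\<rho> \<in> \<E>" "\<rho>' \<in> \<E>"
    using r' \<sigma> by (auto simp: s additive_pairs_def pullback_pair_def)
  have bA: "is_biproduct \<A> [Dom \<A> i, Dom \<A> i'] PA iA pA" and bC: "is_biproduct \<A> [Cod \<A> p, Cod \<A> p'] PC iC pC"
    using r by (cases \<rho>; simp add: direct_sum_pair_def)+
  obtain PB iB pB where bB: "is_biproduct \<A> [Cod \<A> i, Cod \<A> i'] PB iB pB"
    and \<rho>: "\<rho> = (iB 0 \<cdot> i \<cdot> pA 0 \<boxplus> iB 1 \<cdot> i' \<cdot> pA 1, iC 0 \<cdot> p \<cdot> pB 0 \<boxplus> iC 1 \<cdot> p' \<cdot> pB 1)"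
    using r by (cases \<rho>) (auto simp: direct_sum_pair_def)
  note b = binary_biproductD[OF bB[unfolded is_biproduct_iff_binary]] and a = binary_biproductD[OF bA[unfolded is_biproduct_iff_binary]]
    and c = binary_biproductD[OF bC[unfolded is_biproduct_iff_binary]]
  note k = conflation[OF E(1)] and k' = conflation[OF E(2)]
  have "Dom \<A> (fst \<rho>) = PA" "Cod \<A> (fst \<rho>) = PB" "Cod \<A> (snd \<rho>) = PC"
    unfolding \<rho> using a(1-12) b(1-12) c(1-12) k k' by simp_all
  then have add: "\<rho> \<in> additive_pairs \<A> \<E> \<phi>"
    using biproduct_additive[OF bA] biproduct_additive[OF bB] biproduct_additive[OF bC] \<sigma> E by (cases \<rho>) (auto simp: s additive_pairs_def)
  have P: "\<rho> \<in> ext_pairs \<A> \<E> (Cod \<A> (snd \<rho>)) (Dom \<A> (fst \<rho>))"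
    "\<rho>' \<in> ext_pairs \<A> \<E> (Cod \<A> (snd \<rho>')) (Dom \<A> (fst \<rho>'))"
    using E by (cases \<rho>, simp add: ext_pairs_iff) (cases \<rho>', use E in \<open>simp add: ext_pairs_iff\<close>)
  have "\<rho>' \<in> additive_pairs \<A> \<E> \<phi>"
    using additive_pairs_pull[OF r'[unfolded pullback_pair_iff[OF P(1)]] ext_pairs_Obj(2)[OF P(1)] add] .
  with additive_pairs_push[OF t[unfolded pushout_pair_iff[OF P(2)]] ext_pairs_Obj(1)[OF P(2)]]
  show ?thesis .
qed

lemma Ext_restrict_subfunctor:
  "subfunctor_via (prod_cat (op_cat \<A>) \<A>)
    (Ext_restrict \<A> \<E> (additive_pairs \<A> \<E> \<phi>)) (Ext \<A> \<E>) (\<lambda>(C, A) S. S)"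
proof -
  let ?\<D> = "prod_cat (op_cat \<A>) \<A>"
  let ?\<E>\<phi> = "additive_pairs \<A> \<E> \<phi>"
  define H where "H = (\<lambda>(C, A). {ext_class C A \<sigma> |\<sigma>. \<sigma> \<in> ext_pairs \<A> \<E> C A \<and> \<sigma> \<in> ?\<E>\<phi>})"
  have H: "x \<in> H (C, A) \<longleftrightarrow> (\<exists>\<sigma>. x = ext_class C A \<sigma> \<and> \<sigma> \<in> ext_pairs \<A> \<E> C A \<and> \<sigma> \<in> ?\<E>\<phi>)" for x C A
    by (simp add: H_def)
  have subgroup: "subgroup (H X) (on_obj (Ext \<A> \<E>) X)" if X: "X \<in> Obj ?\<D>" for X
  proof -
    obtain C A where CA: "X = (C, A)" "C \<in> Obj \<A>" "A \<in> Obj \<A>"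
      using X by (cases X) (simp add: Obj_op_prod_iff)
    let ?G = "Ext_group \<A> \<E> C A"
    have G: "on_obj (Ext \<A> \<E>) (C, A) = ?G" by (simp add: Ext_def)
    interpret G: comm_group ?G using CA by (intro Ext_comm_group)
    obtain P i0 i1 p0 p1 where bp: "binary_biproduct A C P i0 i1 p0 p1"
      using binary_biproduct_ex CA by metis
    note one = Ext_one_class[OF bp] and b = binary_biproductD[OF bp]
    have "(i0, p1) \<in> ?\<E>\<phi>"
      using split_conflation[OF bp] biproduct_additive[OF is_biproduct_binaryI[OF bp]] b by (simp add: additive_pairs_def)
    with one have one_H: "\<one>\<^bsub>?G\<^esub> \<in> H (C, A)" unfolding H by blast
    show "subgroup (H X) (on_obj (Ext \<A> \<E>) X)"
      unfolding CA(1) G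
    proof (rule G.subgroupI)
      show "H (C, A) \<subseteq> carrier ?G" by (auto simp: H Ext_carrier_iff)
      show "H (C, A) \<noteq> {}" using one_H by blast
    next
      fix x assume "x \<in> H (C, A)"
      then obtain a where a: "a \<in> ext_pairs \<A> \<E> C A" "x = ext_class C A a" "a \<in> ?\<E>\<phi>" by (auto simp: H)
      \<comment> \<open>The inverse class is represented by the pushout along \<open>-1\<close>, and
        pushouts of additive pairs are additive.\<close>
      obtain b where nb: "ext_mor \<A> \<E> (neg (Ide \<A> A)) (Ide \<A> C) a b"
        by (rule ext_mor_pushout_ex[OF a(1), of "neg (Ide \<A> A)"]) (use CA in simp_all)
      then have b: "b \<in> ext_pairs \<A> \<E> C A" using ext_mor_typing(4)[OF nb] CA by simp
      have "ext_mor \<A> \<E> (neg (Ide \<A> A) \<boxplus> Ide \<A> A) (Ide \<A> C) a (i0, p1)"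
        using ext_mor_to_split[OF bp a(1)] CA by simp
      from Ext_mult_class[OF b a(1) one(1) nb ext_mor_Ide[OF a(1)] this]
      have "ext_class C A b \<otimes>\<^bsub>?G\<^esub> x = \<one>\<^bsub>?G\<^esub>" using one a by simp
      then have "inv\<^bsub>?G\<^esub> x = ext_class C A b"
        by (rule G.inv_equality) (use a b in \<open>auto simp: Ext_carrier_iff\<close>)
      moreover have "b \<in> ?\<E>\<phi>" using additive_pairs_push[OF nb CA(2) a(3)] .
      ultimately show "inv\<^bsub>?G\<^esub> x \<in> H (C, A)" using b unfolding H by blast
    next
      fix x y assume "x \<in> H (C, A)" "y \<in> H (C, A)"
      then obtain a b where a: "a \<in> ext_pairs \<A> \<E> C A" "x = ext_class C A a" "a \<in> ?\<E>\<phi>"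
        and b: "b \<in> ext_pairs \<A> \<E> C A" "y = ext_class C A b" "b \<in> ?\<E>\<phi>" by (auto simp: H)
      obtain w f g where w: "ext_mor \<A> \<E> f (Ide \<A> C) w a" "ext_mor \<A> \<E> g (Ide \<A> C) w b"
        by (rule ext_mor_joint_ex[OF a(1) b(1)])
      obtain t where t: "t \<in> ext_pairs \<A> \<E> C A" "ext_mor \<A> \<E> (f \<boxplus> g) (Ide \<A> C) w t" "x \<otimes>\<^bsub>?G\<^esub> y = ext_class C A t"
        using Ext_mult_ex[OF a(1) b(1) w] a b by metis
      \<comment> \<open>Nothing is recorded about additivity of the common source \<open>w\<close>,
        so \<open>t\<close> is viewed as a Baer sum of \<open>a\<close> and \<open>b\<close>, whose
        additivity is known.\<close>
      have "is_baer_sum \<A> \<E> a b t" using is_baer_sum_iff[OF a(1) b(1) w] t(2) by blast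
      then have "t \<in> ?\<E>\<phi>" using additive_pairs_baer_sum a(3) b(3) by blast
      then show "x \<otimes>\<^bsub>?G\<^esub> y \<in> H (C, A)" using t unfolding H by blast
    qed
  qed
  have arr: "on_arr (Ext \<A> \<E>) g x \<in> H Y" if g: "g \<in> homset ?\<D> X Y" and x: "x \<in> H X" for X Y g x
  proof -
    obtain h f C A C' A' where s: "g = (h, f)" "X = (C, A)" "Y = (C', A')" by (cases g, cases X, cases Y) auto
    have hf: "h \<in> homset \<A> C' C" "f \<in> homset \<A> A A'" using g by (auto simp: s homset_op_prod_iff)
    obtain a where a: "a \<in> ext_pairs \<A> \<E> C A" "x = ext_class C A a" "a \<in> ?\<E>\<phi>" using x by (auto simp: s H)
    obtain r t where rt: "ext_mor \<A> \<E> (Ide \<A> A) h r a" "ext_mor \<A> \<E> f (Ide \<A> C') r t"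
      "r \<in> ext_pairs \<A> \<E> C' A" "t \<in> ext_pairs \<A> \<E> C' A'"
      "on_arr (Ext \<A> \<E>) (h, f) (ext_class C A a) = ext_class C' A' t"
      by (rule Ext_on_arr_ex[OF a(1) hf])
    note ob = ext_pairs_Obj[OF rt(3)]
    have "t \<in> ?\<E>\<phi>" using additive_pairs_push[OF rt(2) ob(1) additive_pairs_pull[OF rt(1) ob(2) a(3)]] .
    then show ?thesis using rt a unfolding s H by blast
  qed
  have "Ext_restrict \<A> \<E> ?\<E>\<phi> = \<lparr>on_obj = (\<lambda>X. (on_obj (Ext \<A> \<E>) X)\<lparr>carrier := H X\<rparr>), on_arr = on_arr (Ext \<A> \<E>)\<rparr>"
    by (simp add: Ext_restrict_def H_def ext_class_def Ext_def fun_eq_iff)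
  moreover have "(\<lambda>(C :: 'o, A :: 'o) (S :: ('m \<times> 'm) set). S) = (\<lambda>X S. S)" by (simp add: fun_eq_iff)
  moreover have "subfunctor_via ?\<D>
      \<lparr>on_obj = (\<lambda>X. (on_obj (Ext \<A> \<E>) X)\<lparr>carrier := H X\<rparr>), on_arr = on_arr (Ext \<A> \<E>)\<rparr> (Ext \<A> \<E>) (\<lambda>X S. S)"
    by (rule subfunctor_via_restrict[OF ab_functor_Ext]) (use subgroup arr in blast)+
  ultimately show ?thesis by (simp only:)
qed

end

theorem theorem1p1:
  fixes \<A> :: "('o, 'm, 'z) add_cat_scheme"
    and \<E> :: "('m \<times> 'm) set"
    and \<phi> :: "'o \<Rightarrow> int"
  assumes exact: "exact_category \<A> \<E>"
    and phi_iso: "\<And>X Y f. iso_arr \<A> X Y f \<Longrightarrow> \<phi> X = \<phi> Y"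
    and phi_biproduct: "\<And>Xs P i p. is_biproduct \<A> Xs P i p \<Longrightarrow> \<phi> P = (\<Sum>X\<leftarrow>Xs. \<phi> X)"
    and phi_subadditive:
      "\<And>i p. (i, p) \<in> \<E> \<Longrightarrow> \<phi> (Cod \<A> i) \<le> \<phi> (Dom \<A> i) + \<phi> (Cod \<A> p)"
  shows "subfunctor_via (prod_cat (op_cat \<A>) \<A>)
    (Ext_restrict \<A> \<E> (additive_pairs \<A> \<E> \<phi>)) (Ext \<A> \<E>) (\<lambda>(C, A) S. S)"
proof -
  interpret exact_category \<A> \<E> by (rule exact)
  interpret subadditive_function \<A> \<E> \<phi>
    by unfold_locales (use phi_biproduct phi_subadditive in \<open>force+\<close>)
  show ?thesis by (rule Ext_restrict_subfunctor)
qed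

end
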